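(* Let $\mathcal{C}\subset\mathbb{R}$ be a nonempty closed set, let $\rho_0\in\mathcal{P}_2(\mathcal{C})$ and $v_0\in C_0(\mathcal{C})$. Let $Y:[0,\infty)\times\mathcal{C}\to\mathcal{C}$ be the modified flow map and $\tilde v:[0,\infty)\times\mathcal{C}\to\mathbb{R}$ the modified velocity associated with $(\rho_0,v_0)$ as defined in the context, and set $\tilde\rho(t,\cdot):=Y(t,\cdot)_{\#}\rho_0$ for all $t\ge 0$. Then $(\tilde\rho,\tilde v)$ is the sticky particles solution (SPS) on $\mathcal{C}$ with initial data $(\rho_0,v_0)$.
   Context: $\mathcal{P}(\mathcal{C})$ is the set of Borel probability measures on $\mathbb{R}$ with support contained in the closed set $\mathcal{C}$; $\mathcal{P}_2(\mathcal{C})$ is the subset of those with finite second moment. $C_0(\mathcal{C})$ is the set of bounded continuous functions on $\mathcal{C}$ vanishing on $\partial\mathcal{C}$. $X_{\#}\mu$ is the push-forward of $\mu$ by $X$. Narrow convergence is convergence against functions in $C_b(\mathbb{R})$ (bounded continuous functions). **SPS on $\mathcal{C}$.** Consider a narrowly continuous $\rho:[0,\infty)\to\mathcal{P}(\mathcal{C})$ and a Borel map $v:[0,\infty)\times\mathcal{C}\to\mathbb{R}$, and the following conditions. (1) $\int_0^T\int_{\mathbb{R}} v^2(t,y)\,\rho(t,dy)\,dt<\infty$ for each $T>0$. (2) For each $\phi\in C^1_c([0,\infty)\times\mathbb{R})$ with $\partial_y\phi(t,y)=0$ for all $t\ge0$, $y\in\partial\mathcal{C}$: $\int_0^\infty\int_{\mathbb{R}}(\partial_t\phi+v\,\partial_y\phi)(t,y)\,\rho(t,dy)\,dt+\int_{\mathbb{R}}\phi(0,y)\,\rho_0(dy)=0$.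 (3) For each $\phi\in C^1_c([0,\infty)\times\mathbb{R})$ with $\phi(t,y)=0$ for all $t\ge0$, $y\in\partial\mathcal{C}$: $\int_0^\infty\int_{\mathbb{R}}(v\,\partial_t\phi+v^2\partial_y\phi)(t,y)\,\rho(t,dy)\,dt+\int_{\mathbb{R}}\phi(0,y)v_0(y)\,\rho_0(dy)=0$. (4) (Everywhere Oleinik) For all $t>0$, $\frac{v(t,y_2)-v(t,y_1)}{y_2-y_1}\le\frac1t$ for all $y_1<y_2$ lying in the same connected component of $\mathcal{C}$. (5) (Strong initial continuity of energy) For every $\phi\in C_b(\mathbb{R})$, $\int_{\mathbb{R}} v^2(t,y)\phi(y)\,\rho(t,dy)\to\int_{\mathbb{R}} v_0^2(y)\phi(y)\,\rho_0(dy)$ as $t\to0^+$. (6) (Boundary condition) $v(t,y)=0$ for all $t\ge0$ and all $y\in\partial\mathcal{C}$. A pair satisfying (1)–(6) exists and is unique, velocities being identified when they agree $\rho(t,\cdot)$-a.e. for all $t\ge 0$. Accordingly, $(\tilde\rho,\tilde v)$ is called the SPS on $\mathcal{C}$ if there is a Borel map $\hat v$ with $\hat v(t,\cdot)=\tilde v(t,\cdot)$ $\tilde\rho(t,\cdot)$-a.e. for every $t\ge0$, such that $(\tilde\rho,\hat v)$ satisfies (1)–(6). **Lagrangian map of the Cauchy problem on $\mathbb{R}$.** For a probability measure $\mu_0\in\mathcal{P}_2(\mathbb{R})$ and a bounded continuous $w_0$ on $\mathbb{R}$, and Borel $Z:\mathbb{R}\to\mathbb{R}$, $\mathbb{E}_{\mu_0}[w_0|Z]$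 is $f\circ Z$, where $f\in L^2(Z_{\#}\mu_0)$ is the unique element with $\int f(Z)\zeta(Z)\,d\mu_0=\int w_0\,\zeta(Z)\,d\mu_0$ for all $\zeta\in L^2(Z_{\#}\mu_0)$. The Lagrangian map $X$ and velocity $v$ of the SPS of the Cauchy problem with data $(\mu_0,w_0)$ are: a jointly Borel map $X:[0,\infty)\times\mathbb{R}\to\mathbb{R}$, absolutely continuous as a map $[0,\infty)\to L^2(\mu_0)$, with $X(0,\cdot)=\mathrm{id}$, and a Borel map $v:[0,\infty)\times\mathbb{R}\to\mathbb{R}$ such that $\mathbb{E}_{\mu_0}[w_0|X(t,\cdot)]=v(t,X(t,\cdot))$ for all $t\ge0$, $\dot X(t,\cdot)=v(t,X(t,\cdot))$ for a.e. $t\geq 0$, and $(X(t,\cdot)_{\#}\mu_0,v)$ satisfies (1)–(5) with $\mathcal{C}=\mathbb{R}$ and data $(\mu_0,w_0)$ (so the boundary restrictions on test functions are void). It is chosen so that for $\mu_0$-a.e. $y$ the trajectory $X(\cdot,y)$ is locally Lipschitz with $X(t,y)-X(s,y)=\int_s^t v(\tau,X(\tau,y))\,d\tau$ for $0\le s<t$, and $X(t,\cdot)\circ N_0=N(t,\cdot)$, where $N(t,\cdot)$ is the right-continuous nondecreasing map on $(0,1)$ pushing Lebesgue measure forward to $X(t,\cdot)_{\#}\mu_0$ and $N_0=N(0,\cdot)$. Such $X,v$ exist. **Modified flow map and velocity.** Let $I$ be a connected component of $\mathcal{C}$; it is $\mathbb{R}$, $(-\infty,a]$, $[b,\infty)$,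 $[a,b]$ with $a<b$, or a single point. If $I$ is nondegenerate and $\rho_0(I)>0$, let $X,v$ be the Lagrangian map and velocity of the Cauchy problem on $\mathbb{R}$ with data $\rho_0|_I$ (normalized to a probability measure) and $v_0|_I$ (extended by $0$ to $\mathbb{R}$). For $y\in I$ with $X(\cdot,y)$ continuous: $Y(t,y)=X(t,y)$ as long as $X(s,y)$ is not an endpoint of $I$ for $0\le s\le t$; from the first time $t_0$ at which $X(t_0,y)$ equals an endpoint $c$ of $I$ on, $Y(t,y)=c$ for all $t\ge t_0$. (For the remaining $\rho_0$-null set of $y\in I$ put $Y(t,y)=y$.) Put $\tilde v(t,y)=v(t,y)$ for $y$ in the interior of $I$ and $\tilde v(t,c)=0$ at each endpoint $c$ of $I$. If $I$ is a single point or $\rho_0(I)=0$, put $Y(t,y)=y$ and $\tilde v(t,y)=0$ for $y\in I$. *)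

theory Defs
  imports "HOL-Probability.Probability"
begin

section \<open>Function and measure classes\<close>

definition msupport :: "real measure \<Rightarrow> real set" where
  "msupport \<mu> = {x. \<forall>U. open U \<and> x \<in> U \<longrightarrow> emeasure \<mu> U > 0}"

definition prob_on :: "real set \<Rightarrow> real measure set" where
  "prob_on C = {\<mu>. prob_space \<mu> \<and> sets \<mu> = sets borel \<and> msupport \<mu> \<subseteq> C}"

definition prob2_on :: "real set \<Rightarrow> real measure set" where
  "prob2_on C = {\<mu> \<in> prob_on C. integrable \<mu> (\<lambda>y. y\<^sup>2)}"

text \<open>Functions on a set \<open>C\<close> are total functions whose values off \<open>C\<close> are never used.\<close>

definition C0_on :: "real set \<Rightarrow> (real \<Rightarrow> real) set" where
  "C0_on C = {w. continuous_on C w \<and> bounded (w ` C) \<and> (\<forall>y\<in>frontier C. w y = 0)}"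

definition L2 :: "real measure \<Rightarrow> (real \<Rightarrow> real) set" where
  "L2 \<mu> = {f \<in> borel_measurable \<mu>. integrable \<mu> (\<lambda>y. (f y)\<^sup>2)}"

definition l2norm :: "real measure \<Rightarrow> (real \<Rightarrow> real) \<Rightarrow> real" where
  "l2norm \<mu> f = sqrt (LINT y|\<mu>. (f y)\<^sup>2)"

text \<open>\<open>\<phi>\<close> is a \<open>C\<^sup>1\<close> function with compact support on \<open>[0,\<infinity>) \<times> \<real>\<close>, with (at \<open>t = 0\<close> one-sided)
  partial derivatives \<open>\<phi>t\<close> and \<open>\<phi>y\<close>; it need not vanish at \<open>t = 0\<close>.\<close>

definition C1c_test ::
  "(real \<times> real \<Rightarrow> real) \<Rightarrow> (real \<times> real \<Rightarrow> real) \<Rightarrow> (real \<times> real \<Rightarrow> real) \<Rightarrow> bool" where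
  "C1c_test \<phi> \<phi>t \<phi>y \<longleftrightarrow>
     (\<forall>p \<in> {0..} \<times> UNIV.
        (\<phi> has_derivative (\<lambda>(h, k). \<phi>t p * h + \<phi>y p * k)) (at p within {0..} \<times> UNIV)) \<and>
     continuous_on ({0..} \<times> UNIV) \<phi>t \<and> continuous_on ({0..} \<times> UNIV) \<phi>y \<and>
     compact (closure {p \<in> {0..} \<times> UNIV. \<phi> p \<noteq> 0})"

section \<open>Sticky particles solutions\<close>

definition narrowly_continuous :: "(real \<Rightarrow> real measure) \<Rightarrow> bool" where
  "narrowly_continuous \<rho> \<longleftrightarrow>
     (\<forall>\<phi> \<in> (bcontfun :: (real \<Rightarrow> real) set). continuous_on {0..} (\<lambda>t. LINT y|\<rho> t. \<phi> y))"

definition finite_energy :: "real set \<Rightarrow> (real \<Rightarrow> real measure) \<Rightarrow> (real \<Rightarrow> real \<Rightarrow> real) \<Rightarrow> bool" where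
  "finite_energy C \<rho> v \<longleftrightarrow>
     (\<forall>T>0. (\<integral>\<^sup>+t\<in>{0..T}. (\<integral>\<^sup>+y\<in>C. ennreal ((v t y)\<^sup>2) \<partial>\<rho> t) \<partial>lborel) < \<infinity>)"

definition continuity_eq ::
  "real set \<Rightarrow> real measure \<Rightarrow> (real \<Rightarrow> real measure) \<Rightarrow> (real \<Rightarrow> real \<Rightarrow> real) \<Rightarrow> bool" where
  "continuity_eq C \<rho>0 \<rho> v \<longleftrightarrow>
     (\<forall>\<phi> \<phi>t \<phi>y. C1c_test \<phi> \<phi>t \<phi>y \<longrightarrow> (\<forall>t\<ge>0. \<forall>y\<in>frontier C. \<phi>y (t, y) = 0) \<longrightarrow>
        (LINT t:{0..}|lborel. LINT y:C|\<rho> t. \<phi>t (t, y) + v t y * \<phi>y (t, y))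
          + (LINT y:C|\<rho>0. \<phi> (0, y)) = 0)"

definition momentum_eq ::
  "real set \<Rightarrow> real measure \<Rightarrow> (real \<Rightarrow> real) \<Rightarrow> (real \<Rightarrow> real measure) \<Rightarrow> (real \<Rightarrow> real \<Rightarrow> real) \<Rightarrow> bool" where
  "momentum_eq C \<rho>0 v0 \<rho> v \<longleftrightarrow>
     (\<forall>\<phi> \<phi>t \<phi>y. C1c_test \<phi> \<phi>t \<phi>y \<longrightarrow> (\<forall>t\<ge>0. \<forall>y\<in>frontier C. \<phi> (t, y) = 0) \<longrightarrow>
        (LINT t:{0..}|lborel. LINT y:C|\<rho> t. v t y * \<phi>t (t, y) + (v t y)\<^sup>2 * \<phi>y (t, y))
          + (LINT y:C|\<rho>0. \<phi> (0, y) * v0 y) = 0)"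

definition oleinik :: "real set \<Rightarrow> (real \<Rightarrow> real \<Rightarrow> real) \<Rightarrow> bool" where
  "oleinik C v \<longleftrightarrow>
     (\<forall>t>0. \<forall>y1 y2. y1 < y2 \<and> connected_component C y1 y2 \<longrightarrow>
        (v t y2 - v t y1) / (y2 - y1) \<le> 1 / t)"

text \<open>The energy is only a priori finite for almost every \<open>t\<close>. Since a divergent Bochner integral
  is \<open>0\<close> by convention, finiteness near \<open>t = 0\<close> has to be part of the convergence.\<close>

definition initial_energy ::
  "real set \<Rightarrow> real measure \<Rightarrow> (real \<Rightarrow> real) \<Rightarrow> (real \<Rightarrow> real measure) \<Rightarrow> (real \<Rightarrow> real \<Rightarrow> real) \<Rightarrow> bool" where
  "initial_energy C \<rho>0 v0 \<rho> v \<longleftrightarrow>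
     (\<forall>\<^sub>F t in at_right 0. set_integrable (\<rho> t) C (\<lambda>y. (v t y)\<^sup>2)) \<and>
     (\<forall>\<phi> \<in> (bcontfun :: (real \<Rightarrow> real) set).
        ((\<lambda>t. LINT y:C|\<rho> t. (v t y)\<^sup>2 * \<phi> y) \<longlongrightarrow> (LINT y:C|\<rho>0. (v0 y)\<^sup>2 * \<phi> y)) (at_right 0))"

definition boundary_condition :: "real set \<Rightarrow> (real \<Rightarrow> real \<Rightarrow> real) \<Rightarrow> bool" where
  "boundary_condition C v \<longleftrightarrow> (\<forall>t\<ge>0. \<forall>y\<in>frontier C. v t y = 0)"

definition SPS_conditions ::
  "real set \<Rightarrow> real measure \<Rightarrow> (real \<Rightarrow> real) \<Rightarrow> (real \<Rightarrow> real measure) \<Rightarrow> (real \<Rightarrow> real \<Rightarrow> real) \<Rightarrow> bool" where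
  "SPS_conditions C \<rho>0 v0 \<rho> v \<longleftrightarrow>
     (\<forall>t\<ge>0. \<rho> t \<in> prob_on C) \<and>
     narrowly_continuous \<rho> \<and>
     (\<lambda>(t, y). v t y) \<in> borel_measurable (restrict_space borel ({0..} \<times> C)) \<and>
     finite_energy C \<rho> v \<and>
     continuity_eq C \<rho>0 \<rho> v \<and>
     momentum_eq C \<rho>0 v0 \<rho> v \<and>
     oleinik C v \<and>
     initial_energy C \<rho>0 v0 \<rho> v \<and>
     boundary_condition C v"

definition is_SPS ::
  "real set \<Rightarrow> real measure \<Rightarrow> (real \<Rightarrow> real) \<Rightarrow> (real \<Rightarrow> real measure) \<Rightarrow> (real \<Rightarrow> real \<Rightarrow> real) \<Rightarrow> bool" where
  "is_SPS C \<rho>0 v0 \<rho> v \<longleftrightarrow>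
     (\<exists>v'. (\<forall>t\<ge>0. AE y in \<rho> t. y \<in> C \<longrightarrow> v' t y = v t y) \<and> SPS_conditions C \<rho>0 v0 \<rho> v')"

section \<open>Lagrangian map of the Cauchy problem on the line\<close>

text \<open>\<open>f\<close> represents the conditional expectation of \<open>w\<close> given \<open>Z\<close>, which is then \<open>f \<circ> Z\<close>.\<close>

definition cond_exp_rep ::
  "real measure \<Rightarrow> (real \<Rightarrow> real) \<Rightarrow> (real \<Rightarrow> real) \<Rightarrow> (real \<Rightarrow> real) \<Rightarrow> bool" where
  "cond_exp_rep \<mu> w Z f \<longleftrightarrow>
     f \<in> L2 (distr \<mu> borel Z) \<and>
     (\<forall>\<zeta>\<in>L2 (distr \<mu> borel Z). (LINT y|\<mu>. f (Z y) * \<zeta> (Z y)) = (LINT y|\<mu>. w y * \<zeta> (Z y)))"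

definition L2_abs_continuous :: "real measure \<Rightarrow> (real \<Rightarrow> real \<Rightarrow> real) \<Rightarrow> bool" where
  "L2_abs_continuous \<mu> X \<longleftrightarrow>
     (\<forall>t\<ge>0. X t \<in> L2 \<mu>) \<and>
     (\<forall>T>0. \<forall>\<epsilon>>0. \<exists>\<delta>>0. \<forall>(n::nat) a b.
        (\<forall>i<n. 0 \<le> a i \<and> a i \<le> b i \<and> b i \<le> T) \<and>
        disjoint_family_on (\<lambda>i. {a i<..<b i}) {..<n} \<and>
        (\<Sum>i<n. b i - a i) < \<delta> \<longrightarrow>
        (\<Sum>i<n. l2norm \<mu> (\<lambda>y. X (b i) y - X (a i) y)) < \<epsilon>)"

definition monotone_transport :: "real measure \<Rightarrow> (real \<Rightarrow> real) \<Rightarrow> bool" where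
  "monotone_transport \<mu> N \<longleftrightarrow>
     mono_on {0<..<1} N \<and> (\<forall>m\<in>{0<..<1}. continuous (at_right m) N) \<and>
     distr (restrict_space lborel {0<..<1}) borel N = \<mu>"

text \<open>For \<open>C = UNIV\<close> the frontier is empty, so the boundary clauses of \<open>SPS_conditions\<close> are void.\<close>

definition lagrangian_map ::
  "real measure \<Rightarrow> (real \<Rightarrow> real) \<Rightarrow> (real \<Rightarrow> real \<Rightarrow> real) \<Rightarrow> (real \<Rightarrow> real \<Rightarrow> real) \<Rightarrow> bool" where
  "lagrangian_map \<mu>0 w0 X v \<longleftrightarrow>
     (\<lambda>(t, y). X t y) \<in> borel_measurable (restrict_space borel ({0..} \<times> UNIV)) \<and>
     L2_abs_continuous \<mu>0 X \<and>
     (\<forall>y. X 0 y = y) \<and>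
     (\<forall>t\<ge>0. cond_exp_rep \<mu>0 w0 (X t) (v t)) \<and>
     (AE t in lborel. t \<ge> 0 \<longrightarrow>
        ((\<lambda>s. l2norm \<mu>0 (\<lambda>y. (X s y - X t y) / (s - t) - v t (X t y))) \<longlongrightarrow> 0)
          (at t within {0..})) \<and>
     SPS_conditions UNIV \<mu>0 w0 (\<lambda>t. distr \<mu>0 borel (X t)) v \<and>
     (AE y in \<mu>0.
        (\<forall>T\<ge>0. \<exists>L. L-lipschitz_on {0..T} (\<lambda>t. X t y)) \<and>
        (\<forall>s t. 0 \<le> s \<and> s < t \<longrightarrow>
           set_integrable lborel {s..t} (\<lambda>\<tau>. v \<tau> (X \<tau> y)) \<and>
           X t y - X s y = (LINT \<tau>:{s..t}|lborel. v \<tau> (X \<tau> y)))) \<and>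
     (\<exists>N. \<forall>t\<ge>0. monotone_transport (distr \<mu>0 borel (X t)) (N t) \<and>
        (\<forall>m\<in>{0<..<1}. X t (N 0 m) = N t m))"

section \<open>Modified flow map and velocity\<close>

text \<open>\<open>X I\<close> and \<open>v I\<close> are the Lagrangian map and velocity for the component \<open>I\<close>. Only the
  components selected by \<open>moving_component\<close> matter. The endpoints of such an \<open>I\<close> are the points of
  \<open>frontier I\<close>.\<close>

definition moving_component :: "real set \<Rightarrow> real measure \<Rightarrow> real set \<Rightarrow> bool" where
  "moving_component C \<rho>0 I \<longleftrightarrow> I \<in> components C \<and> \<not> is_singleton I \<and> emeasure \<rho>0 I > 0"

definition stopped_path :: "real set \<Rightarrow> (real \<Rightarrow> real) \<Rightarrow> real \<Rightarrow> real" where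
  "stopped_path I x t =
     (if \<exists>s\<in>{0..t}. x s \<in> frontier I then x (Inf {s. 0 \<le> s \<and> x s \<in> frontier I}) else x t)"

definition modified_flow ::
  "real set \<Rightarrow> real measure \<Rightarrow> (real set \<Rightarrow> real \<Rightarrow> real \<Rightarrow> real) \<Rightarrow> real \<Rightarrow> real \<Rightarrow> real" where
  "modified_flow C \<rho>0 X t y =
     (let I = connected_component_set C y in
      if moving_component C \<rho>0 I \<and> continuous_on {0..} (\<lambda>s. X I s y)
      then stopped_path I (\<lambda>s. X I s y) t else y)"

definition modified_velocity ::
  "real set \<Rightarrow> real measure \<Rightarrow> (real set \<Rightarrow> real \<Rightarrow> real \<Rightarrow> real) \<Rightarrow> real \<Rightarrow> real \<Rightarrow> real" where
  "modified_velocity C \<rho>0 v t y =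
     (let I = connected_component_set C y in
      if moving_component C \<rho>0 I \<and> y \<in> interior I then v I t y else 0)"

text \<open>The set of points with a continuous trajectory need not be Borel, so the modified flow is in
  general only \<open>\<rho>0\<close>-measurable. Push-forwards along it are therefore taken from the completion,
  which does not change them for Borel maps.\<close>

definition push_forward :: "real measure \<Rightarrow> (real \<Rightarrow> real) \<Rightarrow> real measure" where
  "push_forward \<mu> f = distr (completion \<mu>) borel f"

end

theory Submission
  imports Defs
begin

text \<open>
  The unstopped flow of a component knows nothing about the boundary of \<open>C\<close>, and the theorem rests on
  one fact about it: a particle that has reached an endpoint of its interval never re-enters the
  interior.

  Let \<open>I\<close> be a nondegenerate component of \<open>C\<close> that carries mass, \<open>P\<close> the projection onto \<open>I\<close>, and
  \<open>X\<close>, \<open>v\<close> the Lagrangian map and the velocity of the Cauchy problem on the line. By the Oleinik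
  condition, trajectories that meet at a positive time stay together (\<open>order_preserved\<close>), so for
  \<open>0 < s \<le> t\<close> the position \<open>X t\<close> is almost surely a Borel function of \<open>X s\<close>. Since \<open>X t - y\<close> is the
  time integral of \<open>v (s, X s) = E[v0 | X s]\<close>, conditioning on \<open>X t\<close> gives \<open>E[y | X t] = X t - t v (t, X t)\<close>. The
  initial positions \<open>y\<close> lie in the interval \<open>I\<close>, hence so does \<open>X t - t v (t, X t)\<close>, almost everywhere
  (\<open>free_transport_origin_in_I\<close>). If \<open>c\<close> is the right endpoint, this yields
  \<open>v (t, X t) \<ge> (X t - c) / t\<close>. A Gronwall argument then shows that a particle at or beyond \<open>c\<close> stays
  there (\<open>AE_absorbed\<close>); a particle that starts at \<open>c\<close> needs in addition that its velocity tends to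
  \<open>v0 c = 0\<close>. The left endpoint is symmetric. Consequently the stopped path is simply \<open>P (X t)\<close>, and
  it has been stopped by time \<open>t\<close> exactly if \<open>X t\<close> is outside the interior of \<open>I\<close>.

  That \<open>X t - t v (t, X t)\<close> lies in \<open>I\<close> also repairs the Oleinik condition at the endpoints. This
  condition says that \<open>x - t v (t, x)\<close> is nondecreasing in \<open>x\<close>. Replacing this function by \<open>P (x - t v (t, x))\<close> in the
  interior changes \<open>v\<close> on a null set only, keeps monotonicity, and is compatible with the fixed
  endpoints, that is, with velocity zero there (\<open>regularised_oleinik\<close>).

  Each component thus carries a bounded flow along trajectories \<open>Y\<close>, with a velocity \<open>v\<close> that
  satisfies \<open>E[v (t, Y t) \<zeta> (Y t)] = E[v0 \<zeta> (Y t)]\<close> for test functions \<open>\<zeta>\<close> that vanish on the frontier,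
  because such \<open>\<zeta>\<close> see the unstopped particles only. These properties are collected in the locale
  \<open>sticky_flow\<close>. They are passed on from the countably many components with mass to \<open>C\<close>
  (\<open>sticky_flow_of_components\<close>), the remaining mass resting on the frontier, and they imply all
  conditions for a solution (\<open>SPS_conditions_of_flow\<close>): the continuity equation is the chain rule
  along trajectories; in the momentum equation \<open>\<zeta> = \<phi>t + v \<phi>y\<close> vanishes on the frontier, so that
  \<open>v (t, Y t)\<close> may be replaced by \<open>v0\<close> before the chain rule is applied; and the convergence of the
  energy follows from two more choices of \<open>\<zeta>\<close>.
\<close>

section \<open>Projection onto a closed interval\<close>

text \<open>The projection onto a convex set is a monotone operator, and monotone operators on the line are
  nondecreasing functions.\<close>

lemma closest_point_mono_real:
  fixes I :: "real set"
  assumes "closed I" "convex I" "I \<noteq> {}" "x \<le> y"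
  shows "closest_point I x \<le> closest_point I y"
proof -
  let ?p = "closest_point I x" and ?q = "closest_point I y"
  have pq: "?p \<in> I" "?q \<in> I"
    using closest_point_in_set assms by auto
  have "(x - ?p) * (?q - ?p) \<le> 0" "(y - ?q) * (?p - ?q) \<le> 0"
    using closest_point_dot[OF assms(2,1) pq(2), of x] closest_point_dot[OF assms(2,1) pq(1), of y]
    by auto
  then have *: "(?q - ?p)\<^sup>2 \<le> (y - x) * (?q - ?p)"
    by (simp add: power2_eq_square algebra_simps)
  show ?thesis
  proof (rule ccontr)
    assume "\<not> ?thesis"
    then have "(?q - ?p)\<^sup>2 > 0" "(y - x) * (?q - ?p) \<le> 0"
      using assms(4) by (auto simp: mult_nonneg_nonpos)
    with * show False by simp
  qed
qed

text \<open>The sign \<open>\<sigma>\<close> serves to treat both endpoints at once: \<open>\<sigma> = 1\<close> for a right endpoint \<open>c\<close> and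
  \<open>\<sigma> = -1\<close> for a left one.\<close>

lemma closest_point_beyond_real:
  fixes I :: "real set"
  assumes I: "closed I" "convex I" and c: "c \<in> I" "\<And>z. z \<in> I \<Longrightarrow> \<sigma> * z \<le> \<sigma> * c"
    and x: "\<sigma> * c \<le> \<sigma> * x" and \<sigma>: "\<sigma> \<noteq> 0"
  shows "closest_point I x = c"
proof (rule ccontr)
  let ?p = "closest_point I x"
  assume ne: "?p \<noteq> c"
  have p: "?p \<in> I" using closest_point_in_set[OF I(1)] c by auto
  have "\<sigma> * ?p < \<sigma> * c" using c(2)[OF p] ne \<sigma> by (simp add: order_le_less)
  then have "(\<sigma> * x - \<sigma> * ?p) * (\<sigma> * c - \<sigma> * ?p) > 0"
    using x by (intro mult_pos_pos) auto
  moreover have "(\<sigma> * x - \<sigma> * ?p) * (\<sigma> * c - \<sigma> * ?p) = \<sigma>\<^sup>2 * ((x - ?p) * (c - ?p))"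
    by (simp add: power2_eq_square algebra_simps)
  moreover have "(x - ?p) * (c - ?p) \<le> 0"
    using closest_point_dot[OF I(2,1) c(1), of x] by simp
  then have "\<sigma>\<^sup>2 * ((x - ?p) * (c - ?p)) \<le> 0" by (simp add: mult_nonneg_nonpos)
  ultimately show False by simp
qed

lemma interval_frontier_extremal:
  fixes I :: "real set"
  assumes I: "convex I" and c: "c \<notin> interior I"
  shows "(\<forall>z\<in>I. z \<le> c) \<or> (\<forall>z\<in>I. c \<le> z)"
proof (rule ccontr)
  assume "\<not> ?thesis"
  then obtain a b where ab: "a \<in> I" "b \<in> I" "a < c" "c < b" by (auto simp: not_le)
  then have "{a<..<b} \<subseteq> I"
    using I mem_is_interval_1_I[of I a b] by (auto simp: is_interval_convex_1)
  then have "c \<in> interior I"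
    using ab interior_maximal[of "{a<..<b}" I] by auto
  with c show False by simp
qed

text \<open>If the projection of \<open>x\<close> is an interior point, then it can be moved to both sides within \<open>I\<close>, and
  its optimality forces \<open>x\<close> to coincide with it.\<close>

lemma closest_point_interior_iff:
  fixes I :: "real set"
  assumes I: "closed I" "convex I" "I \<noteq> {}"
  shows "closest_point I x \<in> interior I \<longleftrightarrow> x \<in> interior I"
proof
  let ?p = "closest_point I x"
  assume p: "?p \<in> interior I"
  then obtain e where e: "0 < e" "ball ?p e \<subseteq> I" by (auto simp: mem_interior)
  have "?p + e/2 \<in> I" "?p - e/2 \<in> I" using e by (auto simp: subset_iff dist_real_def)
  then have "(x - ?p) * (e/2) \<le> 0" "(x - ?p) * - (e/2) \<le> 0"
    using closest_point_dot[OF I(2,1), of "?p + e/2" x] closest_point_dot[OF I(2,1), of "?p - e/2" x] by auto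
  then have "(x - ?p) * (e/2) = 0" by linarith
  then have "x = ?p" using e by simp
  then show "x \<in> interior I" using p by simp
next
  assume "x \<in> interior I"
  then show "closest_point I x \<in> interior I"
    by (simp add: closest_point_self[OF subsetD[OF interior_subset]])
qed

lemma outside_interval:
  fixes I :: "real set"
  assumes I: "closed I" "convex I" "I \<noteq> {}" and z: "z \<notin> I"
  shows "(bdd_below I \<and> z < Inf I) \<or> (bdd_above I \<and> Sup I < z)"
proof -
  have "z \<notin> interior I" using z interior_subset by blast
  from interval_frontier_extremal[OF I(2) this] show ?thesis
  proof
    assume *: "\<forall>y\<in>I. y \<le> z"
    then have b: "bdd_above I" by (auto simp: bdd_above_def)
    then have "Sup I \<in> I" using closed_contains_Sup I by blast
    with * z b show ?thesis by (metis order_le_less)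
  next
    assume *: "\<forall>y\<in>I. z \<le> y"
    then have b: "bdd_below I" by (auto simp: bdd_below_def)
    then have "Inf I \<in> I" using closed_contains_Inf I by blast
    with * z b show ?thesis by (metis order_le_less)
  qed
qed

lemma finite_interval_frontier:
  fixes I :: "real set"
  assumes I: "closed I" "convex I"
  shows "finite (frontier I)"
proof (rule finite_subset)
  show "frontier I \<subseteq> {Inf I, Sup I}"
  proof
    fix c assume c: "c \<in> frontier I"
    then have "c \<in> I" "c \<notin> interior I" using I(1) by (auto simp: frontier_def)
    with interval_frontier_extremal[OF I(2), of c] show "c \<in> {Inf I, Sup I}"
      by (auto intro!: cInf_eq_minimum[symmetric] cSup_eq_maximum[symmetric])
  qed
qed simp

section \<open>Paths driven by a bounded velocity\<close>

text \<open>The velocity along a path is merely measurable in time, so the differential equation is used in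
  its integrated form.\<close>

definition integral_path :: "(real \<Rightarrow> real) \<Rightarrow> (real \<Rightarrow> real) \<Rightarrow> bool" where
  "integral_path u x \<longleftrightarrow> (\<forall>s t. 0 \<le> s \<longrightarrow> s \<le> t \<longrightarrow> x t - x s = (LINT \<tau>:{s..t}|lborel. u \<tau>))"

lemma set_integrable_bounded_Icc:
  fixes f :: "real \<Rightarrow> real"
  assumes "f \<in> borel_measurable borel" "\<And>\<tau>. \<tau> \<in> {s..t} \<Longrightarrow> \<bar>f \<tau>\<bar> \<le> M"
  shows "set_integrable lborel {s..t} f"
proof -
  have "integrable lborel (\<lambda>\<tau>. indicator {s..t} \<tau> * M)"
    by (intro integrable_mult_left integrable_real_indicator) (auto simp: emeasure_lborel_Icc_eq)
  then show ?thesis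
    unfolding set_integrable_def
  proof (rule Bochner_Integration.integrable_bound)
    show "AE \<tau> in lborel. norm (indicator {s..t} \<tau> *\<^sub>R f \<tau>) \<le> norm (indicator {s..t} \<tau> * M)"
      using assms(2) by (intro AE_I2) (force simp: indicator_def)
  qed (use assms(1) in simp)
qed

lemma set_integral_bound_Icc:
  fixes f :: "real \<Rightarrow> real"
  assumes "f \<in> borel_measurable borel" "\<And>\<tau>. \<tau> \<in> {s..t} \<Longrightarrow> \<bar>f \<tau>\<bar> \<le> M" "s \<le> t"
  shows "\<bar>LINT \<tau>:{s..t}|lborel. f \<tau>\<bar> \<le> M * (t - s)"
proof -
  have f: "set_integrable lborel {s..t} f" using set_integrable_bounded_Icc assms by blast
  have c: "set_integrable lborel {s..t} (\<lambda>_. k)" for k :: real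
    by (rule set_integrable_bounded_Icc[of _ _ _ "\<bar>k\<bar>"]) auto
  have bd: "- M \<le> f \<tau>" "f \<tau> \<le> M" if "\<tau> \<in> {s..t}" for \<tau>
    using assms(2)[OF that] by auto
  have "(LINT \<tau>:{s..t}|lborel. f \<tau>) \<le> (LINT \<tau>:{s..t}|lborel. M)"
    by (rule set_integral_mono[OF f c bd(2)])
  moreover have "(LINT \<tau>:{s..t}|lborel. - M) \<le> (LINT \<tau>:{s..t}|lborel. f \<tau>)"
    by (rule set_integral_mono[OF c f bd(1)])
  ultimately show ?thesis using assms(3)
    by (simp add: set_lebesgue_integral_def mult.commute abs_le_iff)
qed

lemma set_integral_Icc_split:
  fixes f :: "real \<Rightarrow> real"
  assumes "set_integrable lborel {a..c} f" "a \<le> b" "b \<le> c"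
  shows "(LINT \<tau>:{a..c}|lborel. f \<tau>) = (LINT \<tau>:{a..b}|lborel. f \<tau>) + (LINT \<tau>:{b..c}|lborel. f \<tau>)"
proof -
  have "{a..b} \<union> {b..c} = {a..c}" using assms by auto
  moreover have "(LINT \<tau>:({a..b} \<union> {b..c})|lborel. f \<tau>) = (LINT \<tau>:{a..b}|lborel. f \<tau>) + (LINT \<tau>:{b..c}|lborel. f \<tau>)"
  proof (rule set_integral_Un_AE)
    show "AE x in lborel. \<not> (x \<in> {a..b} \<and> x \<in> {b..c})"
      using AE_lborel_singleton[of b] by eventually_elim auto
  qed (use assms in \<open>auto intro: set_integrable_subset\<close>)
  ultimately show ?thesis by simp
qed

lemma integral_path_lipschitz:
  assumes "integral_path u x" "u \<in> borel_measurable borel" "\<And>\<tau>. \<bar>u \<tau>\<bar> \<le> M" "0 \<le> s" "s \<le> t"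
  shows "\<bar>x t - x s\<bar> \<le> M * (t - s)"
  using assms set_integral_bound_Icc[of u s t M] by (auto simp: integral_path_def)

lemma integral_path_continuous:
  assumes "integral_path u x" "u \<in> borel_measurable borel" "\<And>\<tau>. \<bar>u \<tau>\<bar> \<le> M"
  shows "continuous_on {0..} x"
proof (rule lipschitz_on_continuous_on)
  have M: "0 \<le> M" using assms(3)[of 0] by linarith
  show "M-lipschitz_on {0..} x"
  proof (rule lipschitz_onI[OF _ M])
    fix s t :: real assume "s \<in> {0..}" "t \<in> {0..}"
    then show "dist (x s) (x t) \<le> M * dist s t"
      using integral_path_lipschitz[OF assms, of s t] integral_path_lipschitz[OF assms, of t s]
      by (cases "s \<le> t") (auto simp: dist_real_def abs_minus_commute)
  qed
qed

text \<open>After the last time \<open>r\<close> with \<open>g r \<le> 0\<close> the growth rate of \<open>g\<close> is at most its maximum divided by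
  \<open>r\<close>, and on a time window of length \<open>r/2\<close> this rate produces no more than half of the maximum.
  The bound on the rate is assumed only where \<open>g\<close> is positive: for the distance between two
  trajectories, a one-sided Lipschitz bound says something about the rate only while they are
  ordered in one way.\<close>

lemma gronwall_vanish:
  fixes g u :: "real \<Rightarrow> real"
  assumes st: "0 < s" "s \<le> t" and cont: "continuous_on {s..t} g" and gs: "g s \<le> 0"
    and int: "set_integrable lborel {s..t} u"
    and inc: "\<And>a b. s \<le> a \<Longrightarrow> a \<le> b \<Longrightarrow> b \<le> t \<Longrightarrow> g b - g a = (LINT \<tau>:{a..b}|lborel. u \<tau>)"
    and ode: "AE \<tau> in lborel. \<tau> \<in> {s..t} \<longrightarrow> 0 < g \<tau> \<longrightarrow> u \<tau> \<le> g \<tau> / \<tau>"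
  shows "g t \<le> 0"
proof (rule ccontr)
  assume "\<not> g t \<le> 0"
  then have gt: "0 < g t" by simp
  define A where "A = {\<tau>\<in>{s..t}. g \<tau> \<le> 0}"
  have "A = {s..t} \<inter> g -` {..0}" by (auto simp: A_def)
  then have "closed A"
    using continuous_closed_preimage[OF cont closed_atLeastAtMost closed_atMost[of 0]] by simp
  moreover have "bounded A" unfolding A_def by (rule bounded_subset[of "{s..t}"]) auto
  ultimately have "compact A" by (simp add: compact_eq_bounded_closed)
  moreover have "s \<in> A" using st gs by (auto simp: A_def)
  ultimately obtain r where r: "r \<in> A" "\<And>\<tau>. \<tau> \<in> A \<Longrightarrow> \<tau> \<le> r"
    using compact_attains_sup[of A] by auto
  have r': "s \<le> r" "r < t" "g r \<le> 0"
    using r(1) gt by (auto simp: A_def order_le_less)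
  have pos: "0 < g \<tau>" if "r < \<tau>" "\<tau> \<le> t" for \<tau>
    using that r(2)[of \<tau>] r' by (auto simp: A_def not_le[symmetric])
  \<comment> \<open>A time window after \<open>r\<close> in which \<open>g\<close> can gain at most half of its maximum.\<close>
  define e where "e = min t (r + r/2)"
  have e: "r < e" "e \<le> t" "e - r \<le> r/2" using r' st by (auto simp: e_def)
  have "\<exists>m\<in>{r..e}. \<forall>y\<in>{r..e}. g y \<le> g m"
    using e r' by (intro continuous_attains_sup continuous_on_subset[OF cont]) auto
  then obtain m where m: "m \<in> {r..e}" "\<And>y. y \<in> {r..e} \<Longrightarrow> g y \<le> g m" by auto
  have gm: "0 < g m" using m(2)[of e] pos[of e] e by auto
  have "g m \<le> g m - g r" using r' by simp
  also have "\<dots> = (LINT \<tau>:{r..m}|lborel. u \<tau>)"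
    using inc[of r m] r' m e by auto
  also have "\<dots> \<le> (LINT \<tau>:{r..m}|lborel. g m / r)"
  proof (rule set_integral_mono_AE)
    show "set_integrable lborel {r..m} u"
      using r' m e by (intro set_integrable_subset[OF int]) auto
    show "set_integrable lborel {r..m} (\<lambda>\<tau>. g m / r)"
      by (rule set_integrable_bounded_Icc[of _ _ _ "\<bar>g m / r\<bar>"]) auto
    show "AE \<tau>\<in>{r..m} in lborel. u \<tau> \<le> g m / r"
      using ode AE_lborel_singleton[of r]
    proof eventually_elim
      case (elim \<tau>)
      show ?case
      proof
        assume \<tau>: "\<tau> \<in> {r..m}"
        then have \<tau>': "r < \<tau>" "\<tau> \<le> t" "s \<le> \<tau>" "\<tau> \<in> {r..e}" using elim m e r' by auto
        then have "u \<tau> \<le> g \<tau> / \<tau>" using elim pos by auto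
        also have "\<dots> \<le> g m / r"
          using m(2)[OF \<tau>'(4)] pos[OF \<tau>'(1,2)] \<tau>' r' st by (intro frac_le) auto
        finally show "u \<tau> \<le> g m / r" .
      qed
    qed
  qed
  also have "\<dots> = (m - r) / r * g m" using m by (simp add: set_lebesgue_integral_def mult.commute)
  also have "\<dots> \<le> 1/2 * g m"
    using m e gm r' st by (intro mult_right_mono) (auto simp: field_simps)
  finally show False using gm by simp
qed

text \<open>Subtract from \<open>g\<close> the linear function that vanishes at time \<open>0\<close> and agrees with \<open>g\<close> at time
  \<open>s\<close>. It satisfies the differential inequality with equality, so the difference satisfies the
  inequality, too.\<close>

lemma gronwall_ratio:
  fixes g u :: "real \<Rightarrow> real"
  assumes st: "0 < s" "s \<le> t" and cont: "continuous_on {s..t} g"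
    and int: "set_integrable lborel {s..t} u"
    and inc: "\<And>a b. s \<le> a \<Longrightarrow> a \<le> b \<Longrightarrow> b \<le> t \<Longrightarrow> g b - g a = (LINT \<tau>:{a..b}|lborel. u \<tau>)"
    and ode: "AE \<tau> in lborel. \<tau> \<in> {s..t} \<longrightarrow> u \<tau> \<le> g \<tau> / \<tau>"
  shows "g t \<le> g s / s * t"
proof -
  define k where "k = g s / s"
  have k_int: "set_integrable lborel {a..b} (\<lambda>_. k)" for a b :: real
    by (rule set_integrable_bounded_Icc[of _ _ _ "\<bar>k\<bar>"]) auto
  have "g t - k * t \<le> 0"
  proof (rule gronwall_vanish[OF st, where u = "\<lambda>\<tau>. u \<tau> - k"])
    show "continuous_on {s..t} (\<lambda>t. g t - k * t)" by (intro continuous_intros cont)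
    show "g s - k * s \<le> 0" using st by (simp add: k_def)
    show "set_integrable lborel {s..t} (\<lambda>\<tau>. u \<tau> - k)" using int k_int by (rule set_integral_diff)
    show "g b - k * b - (g a - k * a) = (LINT \<tau>:{a..b}|lborel. u \<tau> - k)"
      if "s \<le> a" "a \<le> b" "b \<le> t" for a b
    proof -
      have "set_integrable lborel {a..b} u" using that by (intro set_integrable_subset[OF int]) auto
      then have "(LINT \<tau>:{a..b}|lborel. u \<tau> - k) = (g b - g a) - (LINT \<tau>:{a..b}|lborel. k)"
        using inc[OF that] k_int by simp
      then show ?thesis using that by (simp add: set_lebesgue_integral_def algebra_simps)
    qed
    show "AE \<tau> in lborel. \<tau> \<in> {s..t} \<longrightarrow> 0 < g \<tau> - k * \<tau> \<longrightarrow> u \<tau> - k \<le> (g \<tau> - k * \<tau>) / \<tau>"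
      using ode by eventually_elim (use st in \<open>auto simp: field_simps\<close>)
  qed
  then show ?thesis by (simp add: k_def)
qed

section \<open>Stopping a path\<close>

text \<open>A path of the Cauchy problem on the line need not stay at the endpoint \<open>c\<close> that it reaches: it may
  leave \<open>I\<close> through \<open>c\<close>. Since it does not come back, its projection onto \<open>I\<close> stays at \<open>c\<close>.\<close>

definition absorbed :: "real set \<Rightarrow> (real \<Rightarrow> real) \<Rightarrow> bool" where
  "absorbed I x \<longleftrightarrow> (\<forall>c\<in>frontier I. \<forall>s t. 0 \<le> s \<longrightarrow> s \<le> t \<longrightarrow> x s = c \<longrightarrow> closest_point I (x t) = c)"

lemma path_before_hitting:
  fixes I :: "real set" and x :: "real \<Rightarrow> real"
  assumes cont: "continuous_on {0..} x" and x0: "x 0 \<in> I" and t: "0 \<le> t"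
    and nohit: "\<And>s. 0 \<le> s \<Longrightarrow> s \<le> t \<Longrightarrow> x s \<notin> frontier I"
  shows "x t \<in> interior I"
proof -
  have "connected (x ` {0..t})"
    by (intro connected_continuous_image continuous_on_subset[OF cont]) auto
  moreover have "x 0 \<in> x ` {0..t} \<inter> I" using x0 t by auto
  then have "x ` {0..t} \<inter> I \<noteq> {}" by blast
  moreover have "x ` {0..t} \<inter> frontier I = {}" using nohit by auto
  ultimately have "x ` {0..t} \<subseteq> I" using connected_Int_frontier by blast
  then have "x t \<in> I" using t by auto
  then show ?thesis using nohit[of t] t closure_subset[of I] by (auto simp: frontier_def)
qed

text \<open>The time \<open>T\<close> is the first hitting time of the frontier, or \<open>t\<close> if there is none up to \<open>t\<close>.
  Absorption makes the stopped path at time \<open>t\<close> a function of \<open>x t\<close> alone, without reference to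
  the past. This is what makes the modified flow jointly Borel measurable.\<close>

lemma stopping_time:
  fixes I :: "real set"
  assumes I: "closed I" and cont: "continuous_on {0..} x" and x0: "x 0 \<in> I"
    and abs: "absorbed I x" and t: "0 \<le> t"
  obtains T where "0 \<le> T" "T \<le> t" "x T = stopped_path I x t" "closest_point I (x t) = stopped_path I x t"
    "\<And>s. 0 \<le> s \<Longrightarrow> s < T \<Longrightarrow> x s \<in> interior I" "\<And>s. T < s \<Longrightarrow> s \<le> t \<Longrightarrow> x s \<notin> interior I"
proof (cases "\<exists>s\<in>{0..t}. x s \<in> frontier I")
  case True
  define H where "H = {s. 0 \<le> s \<and> x s \<in> frontier I}"
  have "H = {0..} \<inter> x -` frontier I" by (auto simp: H_def)
  then have H: "closed H"
    using continuous_closed_preimage[OF cont closed_atLeast frontier_closed] by simp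
  obtain s0 where s0: "s0 \<in> H" "s0 \<le> t" using True by (auto simp: H_def)
  have bdd: "bdd_below H" by (auto simp: H_def intro!: bdd_belowI[of _ 0])
  define T where "T = Inf H"
  have T: "T \<in> H" unfolding T_def using closed_contains_Inf[OF _ bdd H] s0 by auto
  have Tle: "T \<le> s" if "s \<in> H" for s unfolding T_def using that bdd by (rule cInf_lower)
  have stop: "stopped_path I x t = x T"
    using True by (simp add: stopped_path_def T_def H_def)
  have xT: "x T \<in> frontier I" "0 \<le> T" using T by (auto simp: H_def)
  have after: "closest_point I (x s) = x T" if "T \<le> s" for s
    using abs xT that by (auto simp: absorbed_def)
  show thesis
  proof (rule that[of T])
    show "T \<le> t" using Tle s0 by force
    then show "closest_point I (x t) = stopped_path I x t" using after stop by simp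
    show "x s \<in> interior I" if "0 \<le> s" "s < T" for s
      using that Tle by (intro path_before_hitting[OF cont x0]) (force simp: H_def)+
    show "x s \<notin> interior I" if s: "T < s" "s \<le> t" for s
    proof
      assume "x s \<in> interior I"
      then have "closest_point I (x s) = x s" using interior_subset closest_point_self by blast
      then have "x s = x T" using after s by simp
      with \<open>x s \<in> interior I\<close> xT show False by (simp add: frontier_def)
    qed
  qed (use xT stop in auto)
next
  case False
  then have stop: "stopped_path I x t = x t" by (auto simp: stopped_path_def)
  have inI: "x s \<in> interior I" if "0 \<le> s" "s \<le> t" for s
    using that False by (intro path_before_hitting[OF cont x0]) auto
  show thesis
  proof (rule that[of t])
    show "closest_point I (x t) = stopped_path I x t"
      using stop inI[of t] t interior_subset by (auto intro!: closest_point_self)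
  qed (use stop inI t in auto)
qed

section \<open>Test functions\<close>

lemma continuous_on_compact_abs_bound:
  fixes f :: "'a::topological_space \<Rightarrow> real"
  assumes "compact S" "continuous_on S f"
  shows "\<exists>B. \<forall>x\<in>S. \<bar>f x\<bar> \<le> B"
  using compact_imp_bounded[OF compact_continuous_image[OF assms(2,1)]] by (auto simp: bounded_iff)

text \<open>This is the chain rule along a path that is only Lipschitz continuous. The increments of
  \<open>\<phi> (t, x t)\<close> and of the integral over a time step \<open>h\<close> from \<open>t\<close> both equal
  \<open>\<phi>t h + \<phi>y (x (t + h) - x t)\<close> up to \<open>o(h)\<close>, with \<open>\<phi>t\<close> and \<open>\<phi>y\<close> taken at \<open>(t, x t)\<close>. Hence
  their difference has derivative zero at every time, even where the path is not differentiable.\<close>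

lemma test_function_along_path:
  fixes \<phi> \<phi>t \<phi>y :: "real \<times> real \<Rightarrow> real"
  assumes test: "C1c_test \<phi> \<phi>t \<phi>y"
    and path: "integral_path u x" "u \<in> borel_measurable borel" "\<And>\<tau>. \<bar>u \<tau>\<bar> \<le> M"
    and T: "0 \<le> T"
  shows "(LINT \<tau>:{0..T}|lborel. \<phi>t (\<tau>, x \<tau>) + u \<tau> * \<phi>y (\<tau>, x \<tau>)) = \<phi> (T, x T) - \<phi> (0, x 0)"
proof -
  have der: "(\<phi> has_derivative (\<lambda>(h, k). \<phi>t p * h + \<phi>y p * k)) (at p within {0..} \<times> UNIV)"
    if "p \<in> {0..} \<times> UNIV" for p
    using test that unfolding C1c_test_def by blast
  have M: "0 \<le> M" using path(3)[of 0] by linarith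
  define K where "K = 1 + M"
  have K: "0 < K" using M by (simp add: K_def)
  define ft where "ft \<tau> = \<phi>t (max 0 \<tau>, x (max 0 \<tau>))" for \<tau>
  define fy where "fy \<tau> = \<phi>y (max 0 \<tau>, x (max 0 \<tau>))" for \<tau>
  have xc: "continuous_on UNIV (\<lambda>\<tau>. x (max 0 \<tau>))"
    by (rule continuous_on_compose2[OF integral_path_continuous[OF path]]) (auto intro!: continuous_intros)
  have pc: "continuous_on UNIV (\<lambda>\<tau>. (max 0 \<tau>, x (max 0 \<tau>)))"
    by (intro continuous_intros xc)
  have ftc: "continuous_on UNIV ft" and fyc: "continuous_on UNIV fy"
    unfolding ft_def fy_def using test
    by (auto simp: C1c_test_def intro!: continuous_on_compose2[OF _ pc])
  have [measurable]: "ft \<in> borel_measurable borel" "fy \<in> borel_measurable borel" "u \<in> borel_measurable borel"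
    using ftc fyc path(2) by (auto intro: borel_measurable_continuous_onI)
  define G where "G \<tau> = ft \<tau> + u \<tau> * fy \<tau>" for \<tau>
  have [measurable]: "G \<in> borel_measurable borel" unfolding G_def by measurable
  have Gint: "set_integrable lborel {a..b} G" for a b
  proof -
    obtain B1 where B1: "\<And>\<tau>. \<tau> \<in> {a..b} \<Longrightarrow> \<bar>ft \<tau>\<bar> \<le> B1"
      using continuous_on_compact_abs_bound[OF compact_Icc continuous_on_subset[OF ftc subset_UNIV]] by blast
    obtain B2 where B2: "\<And>\<tau>. \<tau> \<in> {a..b} \<Longrightarrow> \<bar>fy \<tau>\<bar> \<le> B2"
      using continuous_on_compact_abs_bound[OF compact_Icc continuous_on_subset[OF fyc subset_UNIV]] by blast
    show ?thesis
    proof (rule set_integrable_bounded_Icc)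
      fix \<tau> assume \<tau>: "\<tau> \<in> {a..b}"
      have "\<bar>u \<tau> * fy \<tau>\<bar> \<le> M * B2"
        unfolding abs_mult using path(3) B2[OF \<tau>] M by (intro mult_mono) auto
      then show "\<bar>G \<tau>\<bar> \<le> B1 + M * B2" using B1[OF \<tau>] unfolding G_def by linarith
    qed simp
  qed
  have cint: "set_integrable lborel {a..b} (\<lambda>_. k)" for a b k :: real
    by (rule set_integrable_bounded_Icc[of _ _ _ "\<bar>k\<bar>"]) auto
  have uint: "set_integrable lborel {a..b} (\<lambda>\<tau>. k * u \<tau>)" for a b k :: real
    using set_integrable_bounded_Icc[OF path(2,3)] by (rule set_integrable_mult_right)
  have local: "\<exists>d>0. \<forall>a b. 0 \<le> a \<longrightarrow> a \<le> b \<longrightarrow> (a = t \<or> b = t) \<longrightarrow> b - a < d \<longrightarrow>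
      \<bar>\<phi> (b, x b) - \<phi> (a, x a) - (LINT \<tau>:{a..b}|lborel. G \<tau>)\<bar> \<le> e * (b - a)"
    if t: "0 \<le> t" and e: "0 < e" for t e
  proof -
    define e' where "e' = e / (2 * K)"
    have e': "0 < e'" using e K by (simp add: e'_def)
    let ?p = "(t, x t)"
    obtain d1 where d1: "0 < d1" "\<And>q. q \<in> {0..} \<times> UNIV \<Longrightarrow> norm (q - ?p) < d1 \<Longrightarrow>
        norm (\<phi> q - \<phi> ?p - (\<lambda>(h, k). \<phi>t ?p * h + \<phi>y ?p * k) (q - ?p)) \<le> e' * norm (q - ?p)"
      using der[of ?p] t e' unfolding has_derivative_within_alt by (auto simp del: norm_Pair)
    have "isCont ft t" "isCont fy t" using ftc fyc by (auto simp: continuous_on_eq_continuous_at)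
    then have "(ft \<longlongrightarrow> ft t) (nhds t)" "(fy \<longlongrightarrow> fy t) (nhds t)"
      by (simp_all add: isCont_def tendsto_at_iff_tendsto_nhds)
    then have "\<forall>\<^sub>F \<tau> in nhds t. dist (ft \<tau>) (ft t) < e'" "\<forall>\<^sub>F \<tau> in nhds t. dist (fy \<tau>) (fy t) < e'"
      using e' by (auto dest: tendstoD)
    then have "\<forall>\<^sub>F \<tau> in nhds t. \<bar>ft \<tau> - ft t\<bar> < e' \<and> \<bar>fy \<tau> - fy t\<bar> < e'"
      by eventually_elim (auto simp: dist_real_def)
    then obtain d2 where d2: "0 < d2" "\<And>\<tau>. dist \<tau> t < d2 \<Longrightarrow> \<bar>ft \<tau> - ft t\<bar> < e' \<and> \<bar>fy \<tau> - fy t\<bar> < e'"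
      unfolding eventually_nhds_metric by auto
    show ?thesis
    proof (intro exI[of _ "min (d1 / K) d2"] conjI allI impI)
      show "0 < min (d1 / K) d2" using d1 d2 K by simp
      fix a b assume ab: "0 \<le> a" "a \<le> b" "a = t \<or> b = t" "b - a < min (d1 / K) d2"
      have E: "\<bar>\<phi> (s, x s) - \<phi> ?p - (ft t * (s - t) + fy t * (x s - x t))\<bar> \<le> e' * K * (b - a)"
        if s: "0 \<le> s" "\<bar>s - t\<bar> = b - a" for s
      proof -
        have "\<bar>x s - x t\<bar> \<le> M * \<bar>s - t\<bar>"
          using integral_path_lipschitz[OF path, of s t] integral_path_lipschitz[OF path, of t s] s t
          by (cases "s \<le> t") (auto simp: abs_minus_commute)
        then have n: "norm ((s, x s) - ?p) \<le> K * (b - a)"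
          using norm_Pair_le[of "s - t" "x s - x t"] s(2) by (simp add: K_def algebra_simps)
        also have "K * (b - a) < d1" using ab(4) K by (simp add: field_simps)
        finally have "norm (\<phi> (s, x s) - \<phi> ?p - (\<lambda>(h, k). \<phi>t ?p * h + \<phi>y ?p * k) ((s, x s) - ?p)) \<le> e' * norm ((s, x s) - ?p)"
          using d1(2)[of "(s, x s)"] s by auto
        also have "\<dots> \<le> e' * (K * (b - a))" using n e' by (intro mult_left_mono) auto
        finally show ?thesis using t by (simp add: ft_def fy_def)
      qed
      have 1: "\<bar>\<phi> (b, x b) - \<phi> (a, x a) - (ft t * (b - a) + fy t * (x b - x a))\<bar> \<le> e' * K * (b - a)"
        using ab(3) E[of a] E[of b] ab(1,2) by (auto simp: algebra_simps abs_le_iff)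
      have xd: "x b - x a = (LINT \<tau>:{a..b}|lborel. u \<tau>)" using path(1) ab by (auto simp: integral_path_def)
      have "(LINT \<tau>:{a..b}|lborel. (ft \<tau> - ft t) + u \<tau> * (fy \<tau> - fy t))
          = (LINT \<tau>:{a..b}|lborel. G \<tau> - (ft t + fy t * u \<tau>))"
        by (rule set_lebesgue_integral_cong) (auto simp: G_def algebra_simps)
      also have "\<dots> = (LINT \<tau>:{a..b}|lborel. G \<tau>) - ((LINT \<tau>:{a..b}|lborel. ft t) + (LINT \<tau>:{a..b}|lborel. fy t * u \<tau>))"
        using set_integral_diff(2)[OF Gint set_integral_add(1)[OF cint uint]] set_integral_add(2)[OF cint uint] by simp
      also have "\<dots> = (LINT \<tau>:{a..b}|lborel. G \<tau>) - (ft t * (b - a) + fy t * (x b - x a))"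
        using ab by (simp add: xd) (simp add: set_lebesgue_integral_def)
      finally have eq: "(LINT \<tau>:{a..b}|lborel. (ft \<tau> - ft t) + u \<tau> * (fy \<tau> - fy t))
          = (LINT \<tau>:{a..b}|lborel. G \<tau>) - (ft t * (b - a) + fy t * (x b - x a))" .
      have "\<bar>LINT \<tau>:{a..b}|lborel. (ft \<tau> - ft t) + u \<tau> * (fy \<tau> - fy t)\<bar> \<le> e' * K * (b - a)"
      proof (rule set_integral_bound_Icc)
        fix \<tau> assume "\<tau> \<in> {a..b}"
        then have "dist \<tau> t < d2" using ab by (auto simp: dist_real_def)
        note d = d2(2)[OF this]
        have "\<bar>u \<tau> * (fy \<tau> - fy t)\<bar> \<le> M * e'"
          unfolding abs_mult using path(3) d M e' by (intro mult_mono) auto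
        then show "\<bar>ft \<tau> - ft t + u \<tau> * (fy \<tau> - fy t)\<bar> \<le> e' * K"
          using d distrib_left[of e' 1 M] unfolding K_def by (simp add: mult.commute) linarith
      qed (use ab in auto)
      with 1 eq have "\<bar>\<phi> (b, x b) - \<phi> (a, x a) - (LINT \<tau>:{a..b}|lborel. G \<tau>)\<bar> \<le> 2 * (e' * K * (b - a))"
        by linarith
      also have "\<dots> = e * (b - a)" using K by (simp add: e'_def)
      finally show "\<bar>\<phi> (b, x b) - \<phi> (a, x a) - (LINT \<tau>:{a..b}|lborel. G \<tau>)\<bar> \<le> e * (b - a)" .
    qed
  qed
  \<comment> \<open>The defect in the chain rule; by the local estimate it has derivative zero.\<close>
  define D where "D \<tau> = \<phi> (\<tau>, x \<tau>) - (LINT \<sigma>:{0..\<tau>}|lborel. G \<sigma>)" for \<tau>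
  have Ddiff: "D b - D a = \<phi> (b, x b) - \<phi> (a, x a) - (LINT \<tau>:{a..b}|lborel. G \<tau>)" if "0 \<le> a" "a \<le> b" for a b
    using set_integral_Icc_split[OF Gint that] by (simp add: D_def)
  have "(D has_derivative (\<lambda>_. 0)) (at t within {0..T})" if t: "t \<in> {0..T}" for t
    unfolding has_derivative_within_alt
  proof (intro conjI allI impI)
    fix e :: real assume "0 < e"
    then obtain d where d: "0 < d" "\<And>a b. 0 \<le> a \<Longrightarrow> a \<le> b \<Longrightarrow> (a = t \<or> b = t) \<Longrightarrow> b - a < d \<Longrightarrow>
      \<bar>\<phi> (b, x b) - \<phi> (a, x a) - (LINT \<tau>:{a..b}|lborel. G \<tau>)\<bar> \<le> e * (b - a)"
      using local[of t e] t by auto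
    show "\<exists>d>0. \<forall>y\<in>{0..T}. norm (y - t) < d \<longrightarrow> norm (D y - D t - 0) \<le> e * norm (y - t)"
    proof (intro exI[of _ d] conjI ballI impI d(1))
      fix y assume "y \<in> {0..T}" "norm (y - t) < d"
      then show "norm (D y - D t - 0) \<le> e * norm (y - t)"
        using d(2)[of y t] d(2)[of t y] Ddiff[of y t] Ddiff[of t y] t
        by (cases "y \<le> t") (auto simp: abs_minus_commute)
    qed
  qed simp
  then obtain c where c: "\<And>t. t \<in> {0..T} \<Longrightarrow> D t = c"
    using has_derivative_zero_constant[of "{0..T}" D] by auto
  have "D T = D 0" using c[of 0] c[of T] T by simp
  moreover have "(LINT \<tau>:{0..0}|lborel. G \<tau>) = 0"
    using set_integral_bound_Icc[of G 0 0 "\<bar>G 0\<bar>"] by simp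
  moreover have "(LINT \<tau>:{0..T}|lborel. \<phi>t (\<tau>, x \<tau>) + u \<tau> * \<phi>y (\<tau>, x \<tau>)) = (LINT \<tau>:{0..T}|lborel. G \<tau>)"
    by (rule set_lebesgue_integral_cong) (auto simp: G_def ft_def fy_def)
  ultimately show ?thesis by (simp add: D_def)
qed

lemma frechet_derivative_half_plane_unique:
  fixes f :: "real \<times> real \<Rightarrow> real"
  assumes "(f has_derivative f') (at p within {0..} \<times> UNIV)" "(f has_derivative f'') (at p within {0..} \<times> UNIV)"
    and "p \<in> {0..} \<times> UNIV"
  shows "f' = f''"
  using assms(1,2)
proof (rule frechet_derivative_unique_within)
  fix e :: real and i :: "real \<times> real" assume "0 < e" "i \<in> Basis"
  then show "\<exists>d. 0 < \<bar>d\<bar> \<and> \<bar>d\<bar> < e \<and> p + d *\<^sub>R i \<in> {0..} \<times> UNIV"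
    using assms(3) by (intro exI[of _ "e/2"]) (auto simp: Basis_prod_def)
qed

lemma test_function_bounds:
  assumes test: "C1c_test \<phi> \<phi>t \<phi>y"
  obtains B K where "0 < B" "0 \<le> K"
    "\<And>t y. B \<le> t \<Longrightarrow> \<phi> (t, y) = 0 \<and> \<phi>t (t, y) = 0 \<and> \<phi>y (t, y) = 0"
    "\<And>t y. 0 \<le> t \<Longrightarrow> \<bar>\<phi>t (t, y)\<bar> \<le> K \<and> \<bar>\<phi>y (t, y)\<bar> \<le> K"
proof -
  let ?D = "{0..} \<times> (UNIV :: real set) :: (real \<times> real) set"
  have der: "(\<phi> has_derivative (\<lambda>(h, k). \<phi>t p * h + \<phi>y p * k)) (at p within ?D)"
    if "p \<in> ?D" for p
    using test that unfolding C1c_test_def by blast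
  have "compact (closure {p \<in> ?D. \<phi> p \<noteq> 0})" using test unfolding C1c_test_def by blast
  then have "bounded {p \<in> ?D. \<phi> p \<noteq> 0}"
    by (rule bounded_subset[OF compact_imp_bounded closure_subset])
  then obtain R where R0: "0 < R" "\<And>p. p \<in> {p \<in> ?D. \<phi> p \<noteq> 0} \<Longrightarrow> norm p \<le> R"
    unfolding bounded_pos by blast
  have outside: "\<phi> p = 0" if "p \<in> ?D" "R < norm p" for p
    using R0(2)[of p] that by fastforce
  have zero: "\<phi>t p = 0 \<and> \<phi>y p = 0" if p: "p \<in> ?D" "R < norm p" for p
  proof -
    have near: "0 = \<phi> q" if "q \<in> ?D" "dist q p < norm p - R" for q
    proof -
      have "norm p \<le> norm q + dist q p" using norm_triangle_sub[of p q] by (simp add: dist_norm norm_minus_commute)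
      then show ?thesis using outside[of q] that by simp
    qed
    have "(\<phi> has_derivative (\<lambda>_. 0)) (at p within ?D)"
      by (rule has_derivative_transform_within[OF has_derivative_const, of "norm p - R" p _ "0::real"])
         (use p near in auto)
    then have "(\<lambda>(h, k). \<phi>t p * h + \<phi>y p * k) = (\<lambda>_. 0)"
      using frechet_derivative_half_plane_unique[OF der[OF p(1)] _ p(1)] by blast
    then have "\<phi>t p * h + \<phi>y p * k = 0" for h k
      by (metis case_prod_conv)
    from this[of 1 0] this[of 0 1] show ?thesis by simp
  qed
  have c: "compact (?D \<inter> cball 0 R)" by (intro closed_Int_compact closed_Times) auto
  have "continuous_on ?D \<phi>t" "continuous_on ?D \<phi>y" using test by (simp_all add: C1c_test_def)
  then have "continuous_on (?D \<inter> cball 0 R) \<phi>t" "continuous_on (?D \<inter> cball 0 R) \<phi>y"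
    by (meson continuous_on_subset inf_le1)+
  then obtain K1 K2 where K: "\<And>p. p \<in> ?D \<inter> cball 0 R \<Longrightarrow> \<bar>\<phi>t p\<bar> \<le> K1" "\<And>p. p \<in> ?D \<inter> cball 0 R \<Longrightarrow> \<bar>\<phi>y p\<bar> \<le> K2"
    using continuous_on_compact_abs_bound[OF c] by metis
  have K': "\<bar>\<phi>t p\<bar> \<le> \<bar>K1\<bar> + \<bar>K2\<bar> \<and> \<bar>\<phi>y p\<bar> \<le> \<bar>K1\<bar> + \<bar>K2\<bar>" if "p \<in> ?D" for p
  proof (cases "norm p \<le> R")
    case True
    then have "p \<in> ?D \<inter> cball 0 R" using that by auto
    from K(1)[OF this] K(2)[OF this] show ?thesis by linarith
  next
    case False
    then show ?thesis using zero[OF that] by simp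
  qed
  have far: "R < norm (t, y)" if "R + 1 \<le> t" for t y :: real
  proof -
    have "R < \<bar>t\<bar>" using that R0(1) by simp
    also have "\<bar>t\<bar> \<le> norm (t, y)" using norm_fst_le[of t y] by simp
    finally show ?thesis .
  qed
  show thesis
  proof (rule that[of "R + 1" "\<bar>K1\<bar> + \<bar>K2\<bar>"])
    show "\<phi> (t, y) = 0 \<and> \<phi>t (t, y) = 0 \<and> \<phi>y (t, y) = 0" if "R + 1 \<le> t" for t y
      using that R0(1) outside[of "(t, y)"] zero[of "(t, y)"] far[OF that, of y] by auto
    show "\<bar>\<phi>t (t, y)\<bar> \<le> \<bar>K1\<bar> + \<bar>K2\<bar> \<and> \<bar>\<phi>y (t, y)\<bar> \<le> \<bar>K1\<bar> + \<bar>K2\<bar>" if "0 \<le> t" for t y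
      using K'[of "(t, y)"] that by auto
  qed (use R0 in auto)
qed

text \<open>In the momentum equation this makes \<open>\<phi>t + v \<phi>y\<close> vanish on the frontier, where \<open>v\<close> and \<open>\<phi>\<close> do.\<close>

lemma test_function_time_derivative_zero:
  assumes test: "C1c_test \<phi> \<phi>t \<phi>y" and zero: "\<And>s. 0 \<le> s \<Longrightarrow> \<phi> (s, c) = 0" and t: "0 \<le> t"
  shows "\<phi>t (t, c) = 0"
proof -
  have der: "(\<phi> has_derivative (\<lambda>(h, k). \<phi>t (t, c) * h + \<phi>y (t, c) * k)) (at (t, c) within {0..} \<times> UNIV)"
    using test t unfolding C1c_test_def by blast
  have "((\<lambda>s. (s, c)) has_derivative (\<lambda>h. (h, 0))) (at t within {0..})"
    by (auto intro!: derivative_eq_intros)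
  from has_derivative_in_compose[OF this has_derivative_subset[OF der]]
  have "((\<lambda>s. \<phi> (s, c)) has_derivative (\<lambda>h. \<phi>t (t, c) * h)) (at t within {0..})"
    by auto
  moreover have "((\<lambda>s. \<phi> (s, c)) has_derivative (\<lambda>h. 0)) (at t within {0..})"
    by (rule has_derivative_transform_within[OF has_derivative_const[of 0], of 1]) (use t zero in auto)
  ultimately have "(\<lambda>h. \<phi>t (t, c) * h) = (\<lambda>h. 0)"
  proof (rule frechet_derivative_unique_within)
    fix e i :: real assume "0 < e" "i \<in> Basis"
    then show "\<exists>d. 0 < \<bar>d\<bar> \<and> \<bar>d\<bar> < e \<and> t + d *\<^sub>R i \<in> {0..}"
      using t by (intro exI[of _ "e/2"]) auto
  qed
  from fun_cong[OF this, of 1] show ?thesis by simp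
qed

section \<open>Flows that solve the sticky particle system\<close>

lemma (in finite_measure) continuous_integral_of_continuous_paths:
  fixes F :: "real \<Rightarrow> 'a \<Rightarrow> real"
  assumes [measurable]: "\<And>t. F t \<in> borel_measurable M"
    and bound: "\<And>t y. \<bar>F t y\<bar> \<le> K"
    and cont: "AE y in M. continuous_on {0..} (\<lambda>t. F t y)"
  shows "continuous_on {0..} (\<lambda>t. LINT y|M. F t y)"
  unfolding continuous_on_sequentially comp_def
proof (intro ballI allI impI)
  fix X :: "nat \<Rightarrow> real" and a assume X: "a \<in> {0..}" "(\<forall>n. X n \<in> {0..}) \<and> X \<longlonglongrightarrow> a"
  show "(\<lambda>n. LINT y|M. F (X n) y) \<longlonglongrightarrow> (LINT y|M. F a y)"
  proof (rule integral_dominated_convergence[where w = "\<lambda>_. K"])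
    show "AE y in M. (\<lambda>n. F (X n) y) \<longlonglongrightarrow> F a y"
      using cont by eventually_elim (use X in \<open>auto simp: continuous_on_sequentially comp_def\<close>)
  qed (use bound in auto)
qed

text \<open>Time ranges over all reals so that joint measurability can be stated on the whole plane; the
  equation of motion concerns \<open>t \<ge> 0\<close>.\<close>

locale bounded_flow = prob_space \<rho>0 for \<rho>0 :: "real measure" +
  fixes C :: "real set" and Y v :: "real \<Rightarrow> real \<Rightarrow> real" and M :: real
  assumes sets_initial [measurable_cong]: "sets \<rho>0 = sets borel"
    and closed_C: "closed C"
    and flow_measurable: "(\<lambda>(t, y). Y t y) \<in> borel_measurable borel"
    and velocity_measurable: "(\<lambda>(t, y). v t y) \<in> borel_measurable borel"
    and velocity_bound: "\<And>t y. \<bar>v t y\<bar> \<le> M"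
    and trajectories: "AE y in \<rho>0. Y 0 y = y \<and> (\<forall>t\<ge>0. Y t y \<in> C) \<and>
      integral_path (\<lambda>\<tau>. v \<tau> (Y \<tau> y)) (\<lambda>t. Y t y)"
begin

lemma flow_measurable' [measurable (raw)]:
  assumes "f \<in> borel_measurable N" "g \<in> borel_measurable N"
  shows "(\<lambda>x. Y (f x) (g x)) \<in> borel_measurable N"
proof -
  have "(\<lambda>x. (f x, g x)) \<in> N \<rightarrow>\<^sub>M borel" using assms by measurable
  from measurable_compose[OF this flow_measurable] show ?thesis by simp
qed

lemma velocity_measurable' [measurable (raw)]:
  assumes "f \<in> borel_measurable N" "g \<in> borel_measurable N"
  shows "(\<lambda>x. v (f x) (g x)) \<in> borel_measurable N"
proof -
  have "(\<lambda>x. (f x, g x)) \<in> N \<rightarrow>\<^sub>M borel" using assms by measurable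
  from measurable_compose[OF this velocity_measurable] show ?thesis by simp
qed

lemma trajectories_continuous: "AE y in \<rho>0. continuous_on {0..} (\<lambda>t. Y t y)"
  using trajectories
proof eventually_elim
  case (elim y)
  have "(\<lambda>\<tau>. Y \<tau> y) \<in> borel_measurable borel" "(\<lambda>\<tau>. v \<tau> (Y \<tau> y)) \<in> borel_measurable borel"
    by measurable
  with elim show ?case by (auto intro: integral_path_continuous velocity_bound)
qed

lemma integral_along_flow:
  fixes h :: "real \<Rightarrow> real"
  assumes h [measurable]: "h \<in> borel_measurable borel" and t: "0 \<le> t"
  shows "(LINT y:C|distr \<rho>0 borel (Y t). h y) = (LINT y|\<rho>0. h (Y t y))"
proof -
  have [measurable]: "C \<in> sets borel" using closed_C by simp
  have "(LINT y:C|distr \<rho>0 borel (Y t). h y) = (LINT y|\<rho>0. indicator C (Y t y) *\<^sub>R h (Y t y))"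
    unfolding set_lebesgue_integral_def by (rule integral_distr[of "Y t" \<rho>0 borel "\<lambda>y. indicator C y *\<^sub>R h y"]) measurable
  also have "\<dots> = (LINT y|\<rho>0. h (Y t y))"
    using trajectories by (intro integral_cong_AE) (measurable, auto simp: t)
  finally show ?thesis .
qed

lemma time_space_integral:
  fixes H :: "real \<Rightarrow> real \<Rightarrow> real"
  assumes [measurable]: "(\<lambda>(t, y). H t y) \<in> borel_measurable borel"
    and bound: "\<And>t y. \<bar>H t y\<bar> \<le> K" and B: "0 \<le> B" "\<And>t y. B < t \<Longrightarrow> H t y = 0"
  shows "(LINT t:{0..}|lborel. LINT y|\<rho>0. H t y) = (LINT y|\<rho>0. (LINT t:{0..B}|lborel. H t y))"
proof -
  interpret P: pair_sigma_finite lborel \<rho>0 ..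
  have H0: "H t = (\<lambda>_. 0)" if "B < t" for t using B(2)[of t] that by auto
  have [measurable]: "(\<lambda>x. H (f x) (g x)) \<in> borel_measurable N"
    if "f \<in> borel_measurable N" "g \<in> borel_measurable N" for f g and N :: "'b measure"
  proof -
    have "(\<lambda>x. (f x, g x)) \<in> N \<rightarrow>\<^sub>M borel" using that by measurable
    from measurable_compose[OF this assms(1)] show ?thesis by simp
  qed
  have "integrable (lborel \<Otimes>\<^sub>M \<rho>0) (\<lambda>p. indicator ({0..B} \<times> space \<rho>0) p * K)"
    using B by (intro integrable_mult_left integrable_real_indicator)
       (auto simp: emeasure_pair_measure_Times emeasure_space_1)
  then have int: "integrable (lborel \<Otimes>\<^sub>M \<rho>0) (\<lambda>(t, y). indicator {0..B} t * H t y)"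
  proof (rule Bochner_Integration.integrable_bound)
    show "AE p in lborel \<Otimes>\<^sub>M \<rho>0. norm (case p of (t, y) \<Rightarrow> indicator {0..B} t * H t y) \<le> norm (indicator ({0..B} \<times> space \<rho>0) p * K)"
      using bound by (intro AE_I2) (auto simp: indicator_def space_pair_measure intro: order_trans[OF _ abs_ge_self])
  qed measurable
  have "(LINT t:{0..}|lborel. LINT y|\<rho>0. H t y) = (LINT t|lborel. LINT y|\<rho>0. indicator {0..B} t * H t y)"
    unfolding set_lebesgue_integral_def
    by (intro Bochner_Integration.integral_cong refl) (auto simp: indicator_def H0 not_le)
  also have "\<dots> = (LINT y|\<rho>0. LINT t|lborel. indicator {0..B} t * H t y)"
    by (rule P.Fubini_integral[OF int, symmetric])
  finally show ?thesis by (simp add: set_lebesgue_integral_def)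
qed

end

text \<open>The assumption \<open>velocity_mean\<close> is the conditional expectation property
  \<open>v (t, Y t) = E[v0 | Y t]\<close>, restricted to test functions that vanish on the frontier: particles
  that sit at the boundary may have lost their momentum there.\<close>

locale sticky_flow = bounded_flow +
  fixes v0 :: "real \<Rightarrow> real"
  assumes initial_measurable [measurable]: "v0 \<in> borel_measurable borel"
    and initial_bound: "\<And>y. \<bar>v0 y\<bar> \<le> M"
    and initial_continuous: "continuous_on C v0"
    and initial_frontier: "\<And>y. y \<in> frontier C \<Longrightarrow> v0 y = 0"
    and velocity_frontier: "\<And>t y. y \<in> frontier C \<Longrightarrow> v t y = 0"
    and velocity_oleinik: "oleinik C v"
    and velocity_mean: "\<And>t \<zeta> K. 0 \<le> t \<Longrightarrow> \<zeta> \<in> borel_measurable borel \<Longrightarrow> (\<And>y. \<bar>\<zeta> y\<bar> \<le> K) \<Longrightarrow>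
      (\<And>y. y \<in> frontier C \<Longrightarrow> \<zeta> y = 0) \<Longrightarrow>
      (LINT y|\<rho>0. v t (Y t y) * \<zeta> (Y t y)) = (LINT y|\<rho>0. v0 y * \<zeta> (Y t y))"
begin

lemma bound_nonneg: "0 \<le> M"
  using velocity_bound[of 0 0] by linarith

text \<open>By Fubini it is enough to integrate along one trajectory, where the chain rule applies. The weight
  \<open>a = 1\<close> yields the continuity equation; the weight \<open>a = v0\<close> yields the momentum equation, since
  \<open>v (t, Y t)\<close> may be replaced by \<open>v0\<close> against functions of \<open>Y t\<close> that vanish on the frontier.\<close>

lemma integral_of_test_function_along_flow:
  assumes test: "C1c_test \<phi> \<phi>t \<phi>y"
    and a [measurable]: "a \<in> borel_measurable borel" and aK: "\<And>y. \<bar>a y\<bar> \<le> A"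
  shows "(LINT t:{0..}|lborel. LINT y|\<rho>0. a y * (\<phi>t (t, Y t y) + v t (Y t y) * \<phi>y (t, Y t y)))
      = - (LINT y|\<rho>0. a y * \<phi> (0, y))"
proof -
  obtain B K where BK: "0 < B" "0 \<le> K"
    "\<And>t y. B \<le> t \<Longrightarrow> \<phi> (t, y) = 0 \<and> \<phi>t (t, y) = 0 \<and> \<phi>y (t, y) = 0"
    "\<And>t y. 0 \<le> t \<Longrightarrow> \<bar>\<phi>t (t, y)\<bar> \<le> K \<and> \<bar>\<phi>y (t, y)\<bar> \<le> K"
    using test_function_bounds[OF test] by blast
  define ft where "ft = (\<lambda>(t, y). \<phi>t (max 0 t, y))"
  define fy where "fy = (\<lambda>(t, y). \<phi>y (max 0 t, y))"
  define f0 where "f0 = (\<lambda>y. \<phi> (0, y))"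
  have mc: "continuous_on UNIV (\<lambda>p :: real \<times> real. (max 0 (fst p), snd p))"
    by (intro continuous_intros)
  have dcont: "continuous_on ({0..} \<times> UNIV) \<phi>t" "continuous_on ({0..} \<times> UNIV) \<phi>y"
    using test unfolding C1c_test_def by blast+
  have "continuous_on UNIV (\<lambda>p. \<phi>t (max 0 (fst p), snd p))" "continuous_on UNIV (\<lambda>p. \<phi>y (max 0 (fst p), snd p))"
    by (auto intro!: continuous_on_compose2[OF dcont(1) mc] continuous_on_compose2[OF dcont(2) mc])
  then have fm [measurable]: "ft \<in> borel_measurable (borel \<Otimes>\<^sub>M borel)" "fy \<in> borel_measurable (borel \<Otimes>\<^sub>M borel)"
    unfolding ft_def fy_def borel_prod by (auto intro!: borel_measurable_continuous_onI simp: case_prod_beta')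
  have "continuous_on ({0..} \<times> UNIV) \<phi>"
    using test unfolding C1c_test_def continuous_on_eq_continuous_within
    by (blast intro: has_derivative_continuous)
  then have "continuous_on UNIV f0"
    unfolding f0_def by (rule continuous_on_compose2) (auto intro!: continuous_intros)
  then have [measurable]: "f0 \<in> borel_measurable borel" by (rule borel_measurable_continuous_onI)
  define G where "G t y = ft (t, Y t y) + v t (Y t y) * fy (t, Y t y)" for t y
  have A: "0 \<le> A" using aK[of 0] by linarith
  have Gb: "\<bar>G t y\<bar> \<le> K + M * K" for t y
  proof -
    have "\<bar>v t (Y t y) * fy (t, Y t y)\<bar> \<le> M * K"
      unfolding abs_mult using velocity_bound BK(4)[of "max 0 t"] bound_nonneg by (intro mult_mono) (auto simp: fy_def)
    moreover have "\<bar>ft (t, Y t y)\<bar> \<le> K" using BK(4)[of "max 0 t"] by (auto simp: ft_def)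
    ultimately show ?thesis unfolding G_def by linarith
  qed
  have "(LINT t:{0..}|lborel. LINT y|\<rho>0. a y * (\<phi>t (t, Y t y) + v t (Y t y) * \<phi>y (t, Y t y)))
      = (LINT t:{0..}|lborel. LINT y|\<rho>0. a y * G t y)"
    by (rule set_lebesgue_integral_cong) (auto simp: G_def ft_def fy_def)
  also have "\<dots> = (LINT y|\<rho>0. (LINT t:{0..B}|lborel. a y * G t y))"
  proof (rule time_space_integral)
    show "(\<lambda>(t, y). a y * G t y) \<in> borel_measurable borel"
      unfolding G_def borel_prod[symmetric] by measurable
    show "\<bar>a y * G t y\<bar> \<le> A * (K + M * K)" for t y
      unfolding abs_mult using aK Gb A by (intro mult_mono) auto
    show "a y * G t y = 0" if "B < t" for t y
      using that BK by (auto simp: G_def ft_def fy_def)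
  qed (use BK in auto)
  also have "\<dots> = (LINT y|\<rho>0. - (a y * f0 y))"
  proof (rule integral_cong_AE)
    show "AE y in \<rho>0. (LINT t:{0..B}|lborel. a y * G t y) = - (a y * f0 y)"
      using trajectories
    proof eventually_elim
      case (elim y)
      have m: "(\<lambda>\<tau>. v \<tau> (Y \<tau> y)) \<in> borel_measurable borel" by measurable
      have "(LINT t:{0..B}|lborel. G t y) = (LINT t:{0..B}|lborel. \<phi>t (t, Y t y) + v t (Y t y) * \<phi>y (t, Y t y))"
        by (rule set_lebesgue_integral_cong) (auto simp: G_def ft_def fy_def)
      also have "\<dots> = \<phi> (B, Y B y) - \<phi> (0, Y 0 y)"
        using elim BK by (intro test_function_along_path[OF test _ m velocity_bound]) auto
      also have "\<dots> = - f0 y" using elim BK by (simp add: f0_def)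
      finally show ?case by simp
    qed
    show "(\<lambda>y. LINT t:{0..B}|lborel. a y * G t y) \<in> borel_measurable \<rho>0"
      unfolding set_lebesgue_integral_def G_def by measurable
  qed measurable
  finally show ?thesis by (simp add: f0_def)
qed

text \<open>Two uses of \<open>velocity_mean\<close> suffice. With the test function \<open>v \<phi>\<close> the energy becomes the
  integral of \<open>v0 v \<phi>\<close>; with the test function \<open>v0 \<phi>\<close> the integral of \<open>v v0(Y t) \<phi>\<close> becomes that
  of \<open>v0 v0(Y t) \<phi>\<close>, which has the right limit. The two intermediate integrals differ by at most a
  constant times the mean of \<open>|v0 - v0(Y t)|\<close>, which tends to zero.\<close>

lemma initial_energy_along_flow:
  assumes \<phi>: "\<phi> \<in> (bcontfun :: (real \<Rightarrow> real) set)"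
  shows "((\<lambda>t. LINT y|\<rho>0. (v t (Y t y))\<^sup>2 * \<phi> (Y t y)) \<longlongrightarrow> (LINT y|\<rho>0. (v0 y)\<^sup>2 * \<phi> y)) (at_right 0)"
proof -
  have \<phi>c: "continuous_on UNIV \<phi>" and "bounded (range \<phi>)" using \<phi> by (auto simp: bcontfun_def)
  then obtain K where K: "\<And>y. \<bar>\<phi> y\<bar> \<le> K" by (auto simp: bounded_iff)
  have [measurable]: "\<phi> \<in> borel_measurable borel" using \<phi>c by (rule borel_measurable_continuous_onI)
  have K0: "0 \<le> K" using K[of 0] by linarith
  have M0: "0 \<le> M" by (rule bound_nonneg)
  have w\<phi>: "\<bar>w y * \<phi> y\<bar> \<le> M * K" if "\<bar>w y\<bar> \<le> M" for w :: "real \<Rightarrow> real" and y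
    unfolding abs_mult using that K K0 M0 by (intro mult_mono) auto
  define P where "P t = (LINT y|\<rho>0. v0 y * (v0 (Y t y) * \<phi> (Y t y)))" for t
  define Q where "Q t = (LINT y|\<rho>0. \<bar>v0 y - v0 (Y t y)\<bar>)" for t
  have v0Y: "AE y in \<rho>0. continuous_on {0..} (\<lambda>t. v0 (Y t y)) \<and> continuous_on {0..} (\<lambda>t. \<phi> (Y t y))"
    using trajectories trajectories_continuous
  proof eventually_elim
    case (elim y)
    then have "continuous_on {0..} (\<lambda>t. Y t y)" "(\<lambda>t. Y t y) ` {0..} \<subseteq> C" by auto
    then show ?case
      by (auto intro: continuous_on_compose2[OF initial_continuous] continuous_on_compose2[OF \<phi>c])
  qed
  have "continuous_on {0..} P"
    unfolding P_def
  proof (rule continuous_integral_of_continuous_paths)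
    show "\<bar>v0 y * (v0 (Y t y) * \<phi> (Y t y))\<bar> \<le> M * (M * K)" for t y
      unfolding abs_mult[of "v0 y"] using initial_bound w\<phi>[of v0] M0 by (intro mult_mono) auto
    show "AE y in \<rho>0. continuous_on {0..} (\<lambda>t. v0 y * (v0 (Y t y) * \<phi> (Y t y)))"
      using v0Y by eventually_elim (auto intro!: continuous_intros)
  qed measurable
  then have P: "(P \<longlongrightarrow> P 0) (at_right 0)"
    by (auto simp: continuous_on_def intro: tendsto_within_subset)
  have "continuous_on {0..} Q"
    unfolding Q_def
  proof (rule continuous_integral_of_continuous_paths)
    show "\<bar>\<bar>v0 y - v0 (Y t y)\<bar>\<bar> \<le> M + M" for t y
      using initial_bound[of y] initial_bound[of "Y t y"] by linarith
    show "AE y in \<rho>0. continuous_on {0..} (\<lambda>t. \<bar>v0 y - v0 (Y t y)\<bar>)"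
      using v0Y by eventually_elim (auto intro!: continuous_intros)
  qed measurable
  then have "(Q \<longlongrightarrow> Q 0) (at_right 0)"
    by (auto simp: continuous_on_def intro: tendsto_within_subset)
  moreover have "Q 0 = (LINT y|\<rho>0. 0)"
    unfolding Q_def using trajectories by (intro integral_cong_AE) (measurable, auto)
  ultimately have "(Q \<longlongrightarrow> 0) (at_right 0)" by simp
  then have Q: "((\<lambda>t. M * K * Q t) \<longlongrightarrow> M * K * 0) (at_right 0)" by (rule tendsto_mult_left)
  define R where "R t = (LINT y|\<rho>0. (v t (Y t y) * \<phi> (Y t y)) * (v0 y - v0 (Y t y)))" for t
  have intb: "integrable \<rho>0 f" if "f \<in> borel_measurable borel" "\<And>y. \<bar>f y\<bar> \<le> c" for f :: "real \<Rightarrow> real" and c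
    by (rule integrable_const_bound[of _ c]) (use that in auto)
  have R_le: "norm (R t) \<le> M * K * Q t" for t
  proof -
    have "norm (R t) \<le> (LINT y|\<rho>0. norm ((v t (Y t y) * \<phi> (Y t y)) * (v0 y - v0 (Y t y))))"
      unfolding R_def by (rule integral_norm_bound)
    also have "\<dots> \<le> (LINT y|\<rho>0. M * K * \<bar>v0 y - v0 (Y t y)\<bar>)"
    proof (rule integral_mono')
      show "integrable \<rho>0 (\<lambda>y. M * K * \<bar>v0 y - v0 (Y t y)\<bar>)"
      proof (intro integrable_mult_right intb[of _ "M + M"])
        show "\<bar>\<bar>v0 y - v0 (Y t y)\<bar>\<bar> \<le> M + M" for y
          using initial_bound[of y] initial_bound[of "Y t y"] by linarith
      qed measurable
      show "norm (v t (Y t y) * \<phi> (Y t y) * (v0 y - v0 (Y t y))) \<le> M * K * \<bar>v0 y - v0 (Y t y)\<bar>" for y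
        using w\<phi>[of "v t" "Y t y"] velocity_bound by (simp add: abs_mult[of "v t (Y t y) * \<phi> (Y t y)"] mult_right_mono)
    qed (use K0 M0 in simp)
    finally show ?thesis by (simp add: Q_def)
  qed
  have R: "(R \<longlongrightarrow> 0) (at_right 0)"
    by (rule Lim_null_comparison[OF always_eventually[OF allI[OF R_le]]]) (use Q in simp)
  have eq: "(LINT y|\<rho>0. (v t (Y t y))\<^sup>2 * \<phi> (Y t y)) = P t + R t" if t: "0 \<le> t" for t
  proof -
    have 1: "(LINT y|\<rho>0. v t (Y t y) * (v t (Y t y) * \<phi> (Y t y))) = (LINT y|\<rho>0. v0 y * (v t (Y t y) * \<phi> (Y t y)))"
      using velocity_mean[OF t, of "\<lambda>y. v t y * \<phi> y" "M * K"] w\<phi>[of "v t"] velocity_bound velocity_frontier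
      by simp
    have 2: "(LINT y|\<rho>0. v t (Y t y) * (v0 (Y t y) * \<phi> (Y t y))) = P t"
      using velocity_mean[OF t, of "\<lambda>y. v0 y * \<phi> y" "M * K"] w\<phi>[of v0] initial_bound initial_frontier
      by (simp add: P_def)
    have i: "integrable \<rho>0 (\<lambda>y. w y * (w' (Y t y) * \<phi> (Y t y)))"
      if "\<And>y. \<bar>w y\<bar> \<le> M" "\<And>y. \<bar>w' y\<bar> \<le> M" "w \<in> borel_measurable borel" "w' \<in> borel_measurable borel" for w w'
    proof (rule intb[of _ "M * (M * K)"])
      show "\<bar>w y * (w' (Y t y) * \<phi> (Y t y))\<bar> \<le> M * (M * K)" for y
        unfolding abs_mult[of "w y"] using that w\<phi>[of w'] M0 by (intro mult_mono) auto
    qed (use that in measurable)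
    have "R t = (LINT y|\<rho>0. v0 y * (v t (Y t y) * \<phi> (Y t y)) - v t (Y t y) * (v0 (Y t y) * \<phi> (Y t y)))"
      unfolding R_def by (rule Bochner_Integration.integral_cong) (auto simp: algebra_simps)
    also have "\<dots> = (LINT y|\<rho>0. v0 y * (v t (Y t y) * \<phi> (Y t y))) - (LINT y|\<rho>0. v t (Y t y) * (v0 (Y t y) * \<phi> (Y t y)))"
      by (intro Bochner_Integration.integral_diff i initial_bound velocity_bound) measurable
    finally show ?thesis using 1 2 by (simp add: power2_eq_square mult.assoc)
  qed
  have "P 0 = (LINT y|\<rho>0. (v0 y)\<^sup>2 * \<phi> y)"
    unfolding P_def using trajectories
    by (intro integral_cong_AE) (measurable, auto simp: power2_eq_square mult.assoc)
  then have "((\<lambda>t. P t + R t) \<longlongrightarrow> (LINT y|\<rho>0. (v0 y)\<^sup>2 * \<phi> y)) (at_right 0)"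
    using tendsto_add[OF P R] by simp
  then show ?thesis
    by (rule Lim_transform_eventually) (auto simp: eventually_at_right_less eq intro!: eventually_at_rightI[of 0 1])
qed

lemma SPS_conditions_of_flow:
  assumes \<rho>: "\<And>t. 0 \<le> t \<Longrightarrow> \<rho> t = distr \<rho>0 borel (Y t)"
  shows "SPS_conditions C \<rho>0 v0 \<rho> v"
  unfolding SPS_conditions_def
proof (intro conjI allI impI)
  have [measurable]: "C \<in> sets borel" using closed_C by simp
  have start: "AE y in \<rho>0. y \<in> C" using trajectories by eventually_elim force
  have initial_integral: "(LINT y:C|\<rho>0. h y) = (LINT y|\<rho>0. h y)" if "h \<in> borel_measurable borel" for h :: "real \<Rightarrow> real"
    unfolding set_lebesgue_integral_def using start that
    by (intro integral_cong_AE) (auto elim!: eventually_mono)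
  show "\<rho> t \<in> prob_on C" if t: "0 \<le> t" for t
  proof -
    have "prob_space (\<rho> t)" using t by (simp add: \<rho> prob_space_distr)
    moreover have "msupport (\<rho> t) \<subseteq> C"
    proof
      fix x assume x: "x \<in> msupport (\<rho> t)"
      show "x \<in> C"
      proof (rule ccontr)
        assume "x \<notin> C"
        then have "emeasure (\<rho> t) (- C) > 0" using x closed_C by (auto simp: msupport_def)
        moreover have "emeasure (\<rho> t) (- C) = emeasure \<rho>0 {y \<in> space \<rho>0. Y t y \<notin> C}"
          using t by (simp add: \<rho> emeasure_distr vimage_def Int_def conj_commute)
        moreover have "\<dots> = 0"
          by (rule emeasure_eq_0_AE, use trajectories in eventually_elim) (simp add: t)
        ultimately show False by simp
      qed
    qed
    ultimately show ?thesis using t by (simp add: prob_on_def \<rho>)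
  qed
  show "narrowly_continuous \<rho>"
    unfolding narrowly_continuous_def
  proof
    fix \<phi> :: "real \<Rightarrow> real" assume "\<phi> \<in> bcontfun"
    then have \<phi>c: "continuous_on UNIV \<phi>" and "bounded (range \<phi>)" by (auto simp: bcontfun_def)
    then obtain K where K: "\<And>y. \<bar>\<phi> y\<bar> \<le> K" by (auto simp: bounded_iff)
    have [measurable]: "\<phi> \<in> borel_measurable borel" using \<phi>c by (rule borel_measurable_continuous_onI)
    have "continuous_on {0..} (\<lambda>t. LINT y|\<rho>0. \<phi> (Y t y))"
    proof (rule continuous_integral_of_continuous_paths)
      show "AE y in \<rho>0. continuous_on {0..} (\<lambda>t. \<phi> (Y t y))"
        using trajectories_continuous by eventually_elim (auto intro: continuous_on_compose2[OF \<phi>c])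
    qed (use K in auto)
    moreover have "(LINT y|\<rho> t. \<phi> y) = (LINT y|\<rho>0. \<phi> (Y t y))" if "0 \<le> t" for t
      using that by (simp add: \<rho> integral_distr)
    ultimately show "continuous_on {0..} (\<lambda>t. LINT y|\<rho> t. \<phi> y)"
      by (subst continuous_on_cong[OF refl]) auto
  qed
  show "(\<lambda>(t, y). v t y) \<in> borel_measurable (restrict_space borel ({0..} \<times> C))"
    using velocity_measurable by (rule measurable_restrict_space1)
  show "finite_energy C \<rho> v"
    unfolding finite_energy_def
  proof (intro allI impI)
    fix T :: real assume "0 < T"
    have "(\<integral>\<^sup>+y\<in>C. ennreal ((v t y)\<^sup>2) \<partial>\<rho> t) \<le> ennreal (M\<^sup>2)" if t: "0 \<le> t" for t
    proof -
      interpret D: prob_space "\<rho> t" using t by (simp add: \<rho> prob_space_distr)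
      have "(\<integral>\<^sup>+y\<in>C. ennreal ((v t y)\<^sup>2) \<partial>\<rho> t) \<le> (\<integral>\<^sup>+y. ennreal (M\<^sup>2) \<partial>\<rho> t)"
        using velocity_bound by (intro nn_integral_mono) (auto simp: indicator_def intro!: ennreal_leI abs_le_square_iff[THEN iffD1] order_trans[OF _ abs_ge_self])
      then show ?thesis by (simp add: D.emeasure_space_1)
    qed
    then have "(\<integral>\<^sup>+t\<in>{0..T}. (\<integral>\<^sup>+y\<in>C. ennreal ((v t y)\<^sup>2) \<partial>\<rho> t) \<partial>lborel) \<le> (\<integral>\<^sup>+t. ennreal (M\<^sup>2) * indicator {0..T} t \<partial>lborel)"
      by (intro nn_integral_mono) (auto simp: indicator_def)
    also have "\<dots> < \<infinity>"
      using \<open>0 < T\<close> by (simp add: nn_integral_cmult ennreal_mult_less_top)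
    finally show "(\<integral>\<^sup>+t\<in>{0..T}. (\<integral>\<^sup>+y\<in>C. ennreal ((v t y)\<^sup>2) \<partial>\<rho> t) \<partial>lborel) < \<infinity>" .
  qed
  have inner: "(LINT y:C|\<rho> t. h y) = (LINT y|\<rho>0. h (Y t y))" if "0 \<le> t" "h \<in> borel_measurable borel" for t and h :: "real \<Rightarrow> real"
    using integral_along_flow[OF that(2,1)] that(1) by (simp add: \<rho>)
  have slice: "(\<lambda>y. f (t, y)) \<in> borel_measurable borel" if "continuous_on ({0..} \<times> UNIV) f" "0 \<le> t" for f :: "real \<times> real \<Rightarrow> real" and t
    by (rule borel_measurable_continuous_onI, rule continuous_on_compose2[OF that(1)]) (use that in \<open>auto intro!: continuous_intros\<close>)
  have test_cont: "continuous_on ({0..} \<times> UNIV) \<phi>" if "C1c_test \<phi> \<phi>t \<phi>y" for \<phi> \<phi>t \<phi>y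
    using that unfolding C1c_test_def continuous_on_eq_continuous_within
    by (blast intro: has_derivative_continuous)
  show "continuity_eq C \<rho>0 \<rho> v"
    unfolding continuity_eq_def
  proof (intro allI impI)
    fix \<phi> \<phi>t \<phi>y assume test: "C1c_test \<phi> \<phi>t \<phi>y"
    then have c: "continuous_on ({0..} \<times> UNIV) \<phi>t" "continuous_on ({0..} \<times> UNIV) \<phi>y" by (simp_all add: C1c_test_def)
    have "(LINT t:{0..}|lborel. LINT y:C|\<rho> t. \<phi>t (t, y) + v t y * \<phi>y (t, y))
        = (LINT t:{0..}|lborel. LINT y|\<rho>0. 1 * (\<phi>t (t, Y t y) + v t (Y t y) * \<phi>y (t, Y t y)))"
      using slice[OF c(1)] slice[OF c(2)]
      by (intro set_lebesgue_integral_cong) (auto intro!: inner borel_measurable_add borel_measurable_times)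
    also have "\<dots> = - (LINT y|\<rho>0. 1 * \<phi> (0, y))"
      by (rule integral_of_test_function_along_flow[OF test, of _ 1]) auto
    also have "\<dots> = - (LINT y:C|\<rho>0. \<phi> (0, y))"
      using slice[OF test_cont[OF test]] by (simp add: initial_integral)
    finally show "(LINT t:{0..}|lborel. LINT y:C|\<rho> t. \<phi>t (t, y) + v t y * \<phi>y (t, y)) + (LINT y:C|\<rho>0. \<phi> (0, y)) = 0"
      by simp
  qed
  show "momentum_eq C \<rho>0 v0 \<rho> v"
    unfolding momentum_eq_def
  proof (intro allI impI)
    fix \<phi> \<phi>t \<phi>y assume test: "C1c_test \<phi> \<phi>t \<phi>y" and zero: "\<forall>t\<ge>0. \<forall>y\<in>frontier C. \<phi> (t, y) = 0"
    then have c: "continuous_on ({0..} \<times> UNIV) \<phi>t" "continuous_on ({0..} \<times> UNIV) \<phi>y" by (simp_all add: C1c_test_def)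
    obtain B K where BK: "0 < B" "0 \<le> K"
      "\<And>t y. B \<le> t \<Longrightarrow> \<phi> (t, y) = 0 \<and> \<phi>t (t, y) = 0 \<and> \<phi>y (t, y) = 0"
      "\<And>t y. 0 \<le> t \<Longrightarrow> \<bar>\<phi>t (t, y)\<bar> \<le> K \<and> \<bar>\<phi>y (t, y)\<bar> \<le> K"
      using test_function_bounds[OF test] by blast
    have "(LINT y:C|\<rho> t. v t y * \<phi>t (t, y) + (v t y)\<^sup>2 * \<phi>y (t, y))
        = (LINT y|\<rho>0. v0 y * (\<phi>t (t, Y t y) + v t (Y t y) * \<phi>y (t, Y t y)))" if t: "0 \<le> t" for t
    proof -
      have [measurable]: "(\<lambda>y. \<phi>t (t, y)) \<in> borel_measurable borel" "(\<lambda>y. \<phi>y (t, y)) \<in> borel_measurable borel"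
        using slice c t by auto
      define \<zeta> where "\<zeta> y = \<phi>t (t, y) + v t y * \<phi>y (t, y)" for y
      have [measurable]: "\<zeta> \<in> borel_measurable borel" unfolding \<zeta>_def by measurable
      have "(LINT y:C|\<rho> t. v t y * \<phi>t (t, y) + (v t y)\<^sup>2 * \<phi>y (t, y)) = (LINT y:C|\<rho> t. v t y * \<zeta> y)"
        by (simp add: \<zeta>_def algebra_simps power2_eq_square)
      also have "\<dots> = (LINT y|\<rho>0. v t (Y t y) * \<zeta> (Y t y))"
        by (rule inner[OF t]) measurable
      also have "\<dots> = (LINT y|\<rho>0. v0 y * \<zeta> (Y t y))"
      proof (rule velocity_mean[OF t])
        show "\<bar>\<zeta> y\<bar> \<le> K + M * K" for y
        proof -
          have "\<bar>v t y * \<phi>y (t, y)\<bar> \<le> M * K"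
            unfolding abs_mult using velocity_bound BK(4)[OF t] bound_nonneg by (intro mult_mono) auto
          then show ?thesis unfolding \<zeta>_def using BK(4)[OF t, of y] by linarith
        qed
        show "\<zeta> y = 0" if "y \<in> frontier C" for y
          using that zero t test_function_time_derivative_zero[OF test, of y t] velocity_frontier by (auto simp: \<zeta>_def)
      qed simp
      finally show ?thesis by (simp add: \<zeta>_def)
    qed
    then have "(LINT t:{0..}|lborel. LINT y:C|\<rho> t. v t y * \<phi>t (t, y) + (v t y)\<^sup>2 * \<phi>y (t, y))
        = (LINT t:{0..}|lborel. LINT y|\<rho>0. v0 y * (\<phi>t (t, Y t y) + v t (Y t y) * \<phi>y (t, Y t y)))"
      by (intro set_lebesgue_integral_cong) auto
    also have "\<dots> = - (LINT y|\<rho>0. v0 y * \<phi> (0, y))"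
      by (rule integral_of_test_function_along_flow[OF test _ initial_bound]) measurable
    also have "\<dots> = - (LINT y:C|\<rho>0. \<phi> (0, y) * v0 y)"
      using slice[OF test_cont[OF test]] by (simp add: initial_integral mult.commute)
    finally show "(LINT t:{0..}|lborel. LINT y:C|\<rho> t. v t y * \<phi>t (t, y) + (v t y)\<^sup>2 * \<phi>y (t, y)) + (LINT y:C|\<rho>0. \<phi> (0, y) * v0 y) = 0"
      by simp
  qed
  show "oleinik C v" by (rule velocity_oleinik)
  show "initial_energy C \<rho>0 v0 \<rho> v"
    unfolding initial_energy_def
  proof (intro conjI ballI)
    have "set_integrable (\<rho> t) C (\<lambda>y. (v t y)\<^sup>2)" if t: "0 \<le> t" for t
    proof -
      interpret D: prob_space "\<rho> t" using t by (simp add: \<rho> prob_space_distr)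
      have "\<bar>(v t y)\<^sup>2\<bar> \<le> M\<^sup>2" for y
        using velocity_bound[of t y] abs_le_square_iff[of "v t y" M] bound_nonneg by simp
      then show ?thesis
        unfolding set_integrable_def using t
        by (intro D.integrable_const_bound[of _ "M\<^sup>2"] AE_I2) (auto simp: indicator_def \<rho>)
    qed
    then show "\<forall>\<^sub>F t in at_right 0. set_integrable (\<rho> t) C (\<lambda>y. (v t y)\<^sup>2)"
      by (intro eventually_at_rightI[of 0 1]) auto
    fix \<phi> :: "real \<Rightarrow> real" assume \<phi>: "\<phi> \<in> bcontfun"
    then have [measurable]: "\<phi> \<in> borel_measurable borel" by (auto simp: bcontfun_def intro: borel_measurable_continuous_onI)
    have eq: "(LINT y:C|\<rho>0. (v0 y)\<^sup>2 * \<phi> y) = (LINT y|\<rho>0. (v0 y)\<^sup>2 * \<phi> y)"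
      by (rule initial_integral) measurable
    have ev: "\<forall>\<^sub>F t in at_right 0. (LINT y|\<rho>0. (v t (Y t y))\<^sup>2 * \<phi> (Y t y)) = (LINT y:C|\<rho> t. (v t y)\<^sup>2 * \<phi> y)"
      by (intro eventually_at_rightI[of 0 1] inner[symmetric]) (auto, measurable)
    show "((\<lambda>t. LINT y:C|\<rho> t. (v t y)\<^sup>2 * \<phi> y) \<longlongrightarrow> (LINT y:C|\<rho>0. (v0 y)\<^sup>2 * \<phi> y)) (at_right 0)"
      unfolding eq by (rule Lim_transform_eventually[OF initial_energy_along_flow[OF \<phi>] ev])
  qed
  show "boundary_condition C v" by (simp add: boundary_condition_def velocity_frontier)
qed

end

section \<open>The Cauchy problem on the line for data living on an interval\<close>

text \<open>The averaging property is tested on the event that the bound fails, where it would be violated.\<close>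

lemma (in prob_space) conditional_mean_ge:
  fixes f :: "real \<Rightarrow> real" and g Z :: "'a \<Rightarrow> real"
  assumes [measurable]: "Z \<in> borel_measurable M" "f \<in> borel_measurable borel"
    and int: "integrable M (\<lambda>y. f (Z y))" "integrable M g"
    and mean: "\<And>A. A \<in> sets borel \<Longrightarrow> (LINT y|M. f (Z y) * indicator A (Z y)) = (LINT y|M. g y * indicator A (Z y))"
    and ge: "AE y in M. \<beta> \<le> g y"
  shows "AE y in M. \<beta> \<le> f (Z y)"
proof -
  define A where "A = {x. f x < \<beta>}"
  have A [measurable]: "A \<in> sets borel" unfolding A_def by measurable
  have iA: "integrable M (\<lambda>y. h y * indicator A (Z y))" if h: "integrable M h" for h :: "'a \<Rightarrow> real"
  proof (rule Bochner_Integration.integrable_bound[OF h])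
    show "(\<lambda>y. h y * indicator A (Z y)) \<in> borel_measurable M" using h by measurable
  qed (auto simp: indicator_def)
  have ic: "integrable M (\<lambda>y. \<beta> * indicator A (Z y))" by (rule iA) simp
  have "(LINT y|M. \<beta> * indicator A (Z y) - f (Z y) * indicator A (Z y)) = (LINT y|M. \<beta> * indicator A (Z y) - g y * indicator A (Z y))"
    using iA[OF int(1)] iA[OF int(2)] ic mean[OF A] by simp
  also have "\<dots> \<le> (LINT y|M. 0)"
  proof (rule integral_mono_AE)
    show "AE y in M. \<beta> * indicator A (Z y) - g y * indicator A (Z y) \<le> 0"
      using ge by eventually_elim (auto simp: indicator_def)
  qed (use iA[OF int(2)] ic in auto)
  finally have le: "(LINT y|M. \<beta> * indicator A (Z y) - f (Z y) * indicator A (Z y)) \<le> 0" by simp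
  have nn: "AE y in M. 0 \<le> \<beta> * indicator A (Z y) - f (Z y) * indicator A (Z y)"
    by (auto simp: indicator_def A_def)
  with le have "(LINT y|M. \<beta> * indicator A (Z y) - f (Z y) * indicator A (Z y)) = 0"
    using integral_nonneg_AE[OF nn] by simp
  then have "AE y in M. \<beta> * indicator A (Z y) - f (Z y) * indicator A (Z y) = 0"
    using integral_nonneg_eq_0_iff_AE[OF _ nn] iA[OF int(1)] ic by simp
  then show ?thesis by eventually_elim (auto simp: indicator_def A_def split: if_splits)
qed

text \<open>The Cauchy problem on the line with velocity datum \<open>w\<close>, for an initial measure on an interval \<open>I\<close>
  at whose endpoints \<open>w\<close> vanishes; \<open>one_sided_lipschitz\<close> is the Oleinik condition. The velocity is
  an average of \<open>w\<close>, which is why one constant \<open>M\<close> bounds both.\<close>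

locale line_flow = bounded_flow \<mu> UNIV X u M
  for \<mu> :: "real measure" and X u :: "real \<Rightarrow> real \<Rightarrow> real" and M :: real +
  fixes w :: "real \<Rightarrow> real" and I :: "real set"
  assumes closed_I: "closed I" and convex_I: "convex I" and start: "AE y in \<mu>. y \<in> I"
    and mean_finite: "integrable \<mu> (\<lambda>y. y)"
    and datum_bound: "\<And>y. \<bar>w y\<bar> \<le> M" and datum_continuous: "continuous_on UNIV w"
    and datum_frontier: "\<And>y. y \<in> frontier I \<Longrightarrow> w y = 0"
    and one_sided_lipschitz: "\<And>t x y. 0 < t \<Longrightarrow> x \<le> y \<Longrightarrow> u t y - u t x \<le> (y - x) / t"
    and mean: "\<And>t \<zeta> K. 0 \<le> t \<Longrightarrow> \<zeta> \<in> borel_measurable borel \<Longrightarrow> (\<And>y. \<bar>\<zeta> y\<bar> \<le> K) \<Longrightarrow>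
      (LINT y|\<mu>. u t (X t y) * \<zeta> (X t y)) = (LINT y|\<mu>. w y * \<zeta> (X t y))"
begin

lemma I_nonempty: "I \<noteq> {}"
  using start AE_False by auto

lemma datum_measurable [measurable]: "w \<in> borel_measurable borel"
  using datum_continuous by (rule borel_measurable_continuous_onI)

definition good :: "real set" where
  "good = {y. X 0 y = y \<and> integral_path (\<lambda>\<tau>. u \<tau> (X \<tau> y)) (\<lambda>t. X t y)}"

lemma AE_good: "AE y in \<mu>. y \<in> good"
  using trajectories by eventually_elim (simp add: good_def)

lemma velocity_along_path_measurable: "(\<lambda>\<tau>. u \<tau> (X \<tau> y)) \<in> borel_measurable borel"
  by measurable

lemma good_path:
  assumes "y \<in> good"
  shows "continuous_on {0..} (\<lambda>t. X t y)"
    and "0 \<le> s \<Longrightarrow> s \<le> t \<Longrightarrow> X t y - X s y = (LINT \<tau>:{s..t}|lborel. u \<tau> (X \<tau> y))"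
    and "0 \<le> s \<Longrightarrow> s \<le> t \<Longrightarrow> \<bar>X t y - X s y\<bar> \<le> M * (t - s)"
    and "X 0 y = y"
proof -
  have p: "integral_path (\<lambda>\<tau>. u \<tau> (X \<tau> y)) (\<lambda>t. X t y)" and "X 0 y = y"
    using assms by (simp_all add: good_def)
  show "continuous_on {0..} (\<lambda>t. X t y)"
    by (rule integral_path_continuous[OF p velocity_along_path_measurable velocity_bound])
  show "0 \<le> s \<Longrightarrow> s \<le> t \<Longrightarrow> X t y - X s y = (LINT \<tau>:{s..t}|lborel. u \<tau> (X \<tau> y))"
    using p by (simp add: integral_path_def)
  show "0 \<le> s \<Longrightarrow> s \<le> t \<Longrightarrow> \<bar>X t y - X s y\<bar> \<le> M * (t - s)"
    by (rule integral_path_lipschitz[OF p velocity_along_path_measurable velocity_bound])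
qed (use assms in \<open>simp add: good_def\<close>)

lemma velocity_integrable: "set_integrable lborel {s..t} (\<lambda>\<tau>. u \<tau> (X \<tau> y))"
  by (rule set_integrable_bounded_Icc[OF velocity_along_path_measurable velocity_bound])

text \<open>As long as the gap is positive, the Oleinik condition bounds its growth rate by the gap divided by
  time, so a nonpositive gap stays nonpositive. In particular, trajectories that meet at a positive
  time stay together.\<close>

lemma order_preserved:
  assumes y: "y1 \<in> good" "y2 \<in> good" and st: "0 < s" "s \<le> t" and le: "X s y1 \<le> X s y2"
  shows "X t y1 \<le> X t y2"
proof -
  have "X t y1 - X t y2 \<le> 0"
  proof (rule gronwall_vanish[OF st, where u = "\<lambda>\<tau>. u \<tau> (X \<tau> y1) - u \<tau> (X \<tau> y2)"])
    show "continuous_on {s..t} (\<lambda>t. X t y1 - X t y2)"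
      using st by (intro continuous_intros continuous_on_subset[OF good_path(1)] y) auto
    show "X b y1 - X b y2 - (X a y1 - X a y2) = (LINT \<tau>:{a..b}|lborel. u \<tau> (X \<tau> y1) - u \<tau> (X \<tau> y2))"
      if "s \<le> a" "a \<le> b" "b \<le> t" for a b
      using good_path(2)[OF y(1), of a b] good_path(2)[OF y(2), of a b] that st velocity_integrable by simp
    show "AE \<tau> in lborel. \<tau> \<in> {s..t} \<longrightarrow> 0 < X \<tau> y1 - X \<tau> y2 \<longrightarrow>
        u \<tau> (X \<tau> y1) - u \<tau> (X \<tau> y2) \<le> (X \<tau> y1 - X \<tau> y2) / \<tau>"
      using st one_sided_lipschitz by auto
  qed (use le velocity_integrable in auto)
  then show ?thesis by simp
qed

text \<open>By order preservation the later position is a nondecreasing function of the earlier one, and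
  nondecreasing functions are Borel.\<close>

lemma later_position_determined:
  assumes st: "0 < s" "s \<le> t"
  obtains F where "F \<in> borel_measurable borel" "\<And>y. y \<in> good \<Longrightarrow> X t y = F (X s y)"
proof -
  \<comment> \<open>Speeds are at most \<open>M\<close>, so the inserted point is a lower bound for the position at time \<open>t\<close> of a
    particle that is at \<open>x\<close> at time \<open>s\<close>; it makes the set nonempty without changing the supremum there.\<close>
  define S where "S x = insert (x - M * (t - s)) {X t y |y. y \<in> good \<and> X s y \<le> x}" for x
  define F where "F x = Sup (S x)" for x
  have M: "0 \<le> M" using velocity_bound[of 0 0] by linarith
  have up: "z \<le> x + M * (t - s)" if "z \<in> S x" for z x
    using that good_path(3)[of _ s t] st M unfolding S_def by (force simp: abs_le_iff)
  have bdd: "bdd_above (S x)" for x using up by (auto simp: bdd_above_def)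
  have "mono F"
  proof
    fix x x' :: real assume "x \<le> x'"
    show "F x \<le> F x'"
      unfolding F_def
    proof (rule cSup_least)
      fix z assume "z \<in> S x"
      then have "z \<in> S x' \<or> z \<le> x' - M * (t - s)" using \<open>x \<le> x'\<close> by (auto simp: S_def)
      moreover have "x' - M * (t - s) \<in> S x'" by (simp add: S_def)
      ultimately show "z \<le> Sup (S x')" using cSup_upper[OF _ bdd, of _ x'] by (meson order_trans)
    qed (simp add: S_def)
  qed
  then have "F \<in> borel_measurable borel" by (rule borel_measurable_mono)
  moreover have "X t y = F (X s y)" if y: "y \<in> good" for y
    unfolding F_def
  proof (rule cSup_eq_maximum[symmetric])
    show "X t y \<in> S (X s y)" using y by (auto simp: S_def)
    show "z \<le> X t y" if "z \<in> S (X s y)" for z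
      using that order_preserved[OF _ y st] good_path(3)[OF y, of s t] st by (auto simp: S_def abs_le_iff)
  qed
  ultimately show thesis by (rule that)
qed

text \<open>For \<open>0 < s \<le> t\<close> the event \<open>X t y \<in> A\<close> depends on \<open>X s y\<close> only, so the conditional expectation
  property at time \<open>s\<close> can be tested against it. This gives the same value for each such \<open>s\<close>, and the
  displacement is the integral of the velocities over the time interval.\<close>

lemma mean_displacement:
  assumes t: "0 < t" and A [measurable]: "A \<in> sets borel"
  shows "(LINT y|\<mu>. (X t y - y) * indicator A (X t y)) = t * (LINT y|\<mu>. w y * indicator A (X t y))"
proof -
  define m where "m = (LINT y|\<mu>. w y * indicator A (X t y))"
  have M: "0 \<le> M" using velocity_bound[of 0 0] by linarith
  define H where "H s y = indicator {0..t} s * (u s (X s y) * indicator A (X t y))" for s y :: real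
  have "(LINT y|\<mu>. (X t y - y) * indicator A (X t y)) = (LINT y|\<mu>. (LINT s:{0..t}|lborel. H s y))"
  proof (rule integral_cong_AE)
    show "AE y in \<mu>. (X t y - y) * indicator A (X t y) = (LINT s:{0..t}|lborel. H s y)"
      using AE_good
    proof eventually_elim
      case (elim y)
      have "(LINT s:{0..t}|lborel. H s y) = (LINT s:{0..t}|lborel. u s (X s y) * indicator A (X t y))"
        by (rule set_lebesgue_integral_cong) (auto simp: H_def)
      also have "\<dots> = (X t y - X 0 y) * indicator A (X t y)"
        using good_path(2)[OF elim, of 0 t] t by simp
      finally show ?case using good_path(4)[OF elim] by simp
    qed
    show "(\<lambda>y. LINT s:{0..t}|lborel. H s y) \<in> borel_measurable \<mu>"
      unfolding set_lebesgue_integral_def H_def by measurable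
  qed measurable
  also have "\<dots> = (LINT s:{0..}|lborel. LINT y|\<mu>. H s y)"
  proof (rule time_space_integral[symmetric])
    show "(\<lambda>(s, y). H s y) \<in> borel_measurable borel"
      unfolding H_def borel_prod[symmetric] by measurable
    show "\<bar>H s y\<bar> \<le> M" for s y
      using velocity_bound M by (auto simp: H_def indicator_def)
    show "H s y = 0" if "t < s" for s y using that by (simp add: H_def)
  qed (use t in simp)
  also have "\<dots> = (LINT s:{0..t}|lborel. m)"
    unfolding set_lebesgue_integral_def
  proof (rule integral_cong_AE)
    show "AE s in lborel. indicator {0..} s *\<^sub>R (LINT y|\<mu>. H s y) = indicator {0..t} s *\<^sub>R m"
      using AE_lborel_singleton[of 0]
    proof eventually_elim
      case (elim s)
      show ?case
      proof (cases "0 < s \<and> s \<le> t")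
        case True
        then obtain F where F [measurable]: "F \<in> borel_measurable borel" and eq: "\<And>y. y \<in> good \<Longrightarrow> X t y = F (X s y)"
          using later_position_determined by blast
        define \<zeta> where "\<zeta> x = (indicator A (F x) :: real)" for x
        have [measurable]: "\<zeta> \<in> borel_measurable borel" unfolding \<zeta>_def by measurable
        have AE: "AE y in \<mu>. indicator A (X t y) = \<zeta> (X s y)"
          using AE_good by eventually_elim (simp add: \<zeta>_def eq)
        have "(LINT y|\<mu>. H s y) = (LINT y|\<mu>. u s (X s y) * \<zeta> (X s y))"
          using AE True by (intro integral_cong_AE) (simp_all add: H_def, measurable, auto)
        also have "\<dots> = (LINT y|\<mu>. w y * \<zeta> (X s y))"
          using True by (intro mean[of s \<zeta> 1]) (auto simp: \<zeta>_def indicator_def)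
        also have "\<dots> = m"
          unfolding m_def using AE by (intro integral_cong_AE) (measurable, auto)
        finally show ?thesis using True by simp
      next
        case False
        then show ?thesis using elim by (auto simp: indicator_def H_def)
      qed
    qed
    show "(\<lambda>s. indicator {0..} s *\<^sub>R (LINT y|\<mu>. H s y)) \<in> borel_measurable lborel"
      unfolding H_def by measurable
  qed measurable
  also have "\<dots> = t * m" using t by (simp add: set_lebesgue_integral_def)
  finally show ?thesis by (simp add: m_def)
qed

text \<open>By \<open>mean_displacement\<close>, \<open>X t - t u (t, X t)\<close>, the point from which free transport with the present
  velocity leads to the present position, is the conditional expectation of the initial position
  given \<open>X t\<close>. Initial positions lie in the interval \<open>I\<close>, hence so do their averages.\<close>

lemma free_transport_origin_in_I:
  assumes t: "0 < t"
  shows "AE y in \<mu>. X t y - t * u t (X t y) \<in> I"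
proof -
  define f where "f x = x - t * u t x" for x
  have [measurable]: "f \<in> borel_measurable borel" unfolding f_def by measurable
  have M: "0 \<le> M" using velocity_bound[of 0 0] by linarith
  have disp: "integrable \<mu> (\<lambda>y. X t y - y)"
  proof (rule integrable_const_bound[of _ "M * t"])
    show "AE y in \<mu>. norm (X t y - y) \<le> M * t"
      using AE_good by eventually_elim (use good_path(3)[of _ 0 t] good_path(4) t in auto)
  qed measurable
  have vel: "integrable \<mu> (\<lambda>y. u t (X t y))"
    by (rule integrable_const_bound[of _ M]) (use velocity_bound in auto)
  have "integrable \<mu> (\<lambda>y. (X t y - y) + (y - t * u t (X t y)))"
    by (intro Bochner_Integration.integrable_add Bochner_Integration.integrable_diff integrable_mult_right disp vel mean_finite)
  then have fint: "integrable \<mu> (\<lambda>y. f (X t y))" by (simp add: f_def)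
  have iA: "integrable \<mu> (\<lambda>y. h y * indicator A (X t y))" if "integrable \<mu> h" "A \<in> sets borel" for h :: "real \<Rightarrow> real" and A
  proof (rule Bochner_Integration.integrable_bound[OF that(1)])
    show "(\<lambda>y. h y * indicator A (X t y)) \<in> borel_measurable \<mu>" using that by measurable
  qed (auto simp: indicator_def)
  have mean_f: "(LINT y|\<mu>. f (X t y) * indicator A (X t y)) = (LINT y|\<mu>. y * indicator A (X t y))"
    if A: "A \<in> sets borel" for A
  proof -
    have "(LINT y|\<mu>. f (X t y) * indicator A (X t y))
        = (LINT y|\<mu>. ((X t y - y) * indicator A (X t y) + y * indicator A (X t y)) - t * (u t (X t y) * indicator A (X t y)))"
      by (rule Bochner_Integration.integral_cong) (auto simp: f_def algebra_simps)
    also have "\<dots> = (LINT y|\<mu>. (X t y - y) * indicator A (X t y)) + (LINT y|\<mu>. y * indicator A (X t y))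
        - t * (LINT y|\<mu>. u t (X t y) * indicator A (X t y))"
      using iA[OF disp A] iA[OF mean_finite A] iA[OF vel A] by simp
    also have "(LINT y|\<mu>. u t (X t y) * indicator A (X t y)) = (LINT y|\<mu>. w y * indicator A (X t y))"
      using t A by (intro mean[of t "indicator A" 1]) auto
    finally show ?thesis using mean_displacement[OF t A] by simp
  qed
  have lower: "AE y in \<mu>. bdd_below I \<longrightarrow> Inf I \<le> f (X t y)"
  proof (cases "bdd_below I")
    case True
    have "AE y in \<mu>. Inf I \<le> f (X t y)"
    proof (rule conditional_mean_ge[where f = f and Z = "X t" and g = "\<lambda>y. y"])
      show "AE y in \<mu>. Inf I \<le> y" using start by eventually_elim (rule cInf_lower[OF _ True])
      show "X t \<in> borel_measurable \<mu>" "f \<in> borel_measurable borel" by measurable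
    qed (use fint mean_finite mean_f in auto)
    then show ?thesis by simp
  qed simp
  have upper: "AE y in \<mu>. bdd_above I \<longrightarrow> f (X t y) \<le> Sup I"
  proof (cases "bdd_above I")
    case True
    have "AE y in \<mu>. - Sup I \<le> - f (X t y)"
    proof (rule conditional_mean_ge[where f = "\<lambda>x. - f x" and Z = "X t" and g = "\<lambda>y. - y"])
      show "AE y in \<mu>. - Sup I \<le> - y" using start by eventually_elim (simp add: cSup_upper[OF _ True])
      show "X t \<in> borel_measurable \<mu>" "(\<lambda>x. - f x) \<in> borel_measurable borel" by measurable
    qed (use fint mean_finite mean_f in auto)
    then show ?thesis by simp
  qed simp
  from lower upper show ?thesis
  proof eventually_elim
    case (elim y)
    then have "f (X t y) \<in> I"
      using outside_interval[OF closed_I convex_I I_nonempty, of "f (X t y)"] by fastforce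
    then show ?case by (simp add: f_def)
  qed
qed

lemma AE_free_transport_origin_in_I: "AE y in \<mu>. AE t in lborel. 0 < t \<longrightarrow> X t y - t * u t (X t y) \<in> I"
proof -
  interpret P: pair_sigma_finite lborel \<mu> ..
  have [measurable]: "I \<in> sets borel" using closed_I by simp
  have "AE t in lborel. AE y in \<mu>. 0 < t \<longrightarrow> X t y - t * u t (X t y) \<in> I"
  proof (rule AE_I2)
    show "AE y in \<mu>. 0 < t \<longrightarrow> X t y - t * u t (X t y) \<in> I" for t
      using free_transport_origin_in_I[of t] by (cases "0 < t") auto
  qed
  moreover have "{p \<in> space (lborel \<Otimes>\<^sub>M \<mu>). 0 < fst p \<longrightarrow> X (fst p) (snd p) - fst p * u (fst p) (X (fst p) (snd p)) \<in> I}
      \<in> sets (lborel \<Otimes>\<^sub>M \<mu>)"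
    by measurable
  ultimately show ?thesis
    using P.AE_commute[of "\<lambda>t y. 0 < t \<longrightarrow> X t y - t * u t (X t y) \<in> I"] by simp
qed

text \<open>All particles that share the position of \<open>c\<close> at time \<open>t\<close> started within distance \<open>2 M t\<close> of \<open>c\<close>,
  and their velocity is the average of \<open>w\<close> over them. The atom guarantees that this average is taken
  over a set of positive mass, so it holds at \<open>c\<close> itself.\<close>

lemma velocity_near_resting_atom:
  assumes c: "w c = 0" and atom: "measure \<mu> {c} > 0" and e: "0 < e"
  obtains d where "0 < d" "\<And>t. 0 \<le> t \<Longrightarrow> t \<le> d \<Longrightarrow> \<bar>u t (X t c)\<bar> \<le> e"
proof -
  have M: "0 \<le> M" using velocity_bound[of 0 0] by linarith
  have cgood: "c \<in> good"
  proof (rule ccontr)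
    assume "c \<notin> good"
    then have "AE y in \<mu>. y \<notin> {c}" using AE_good by (auto elim!: eventually_mono)
    then have "emeasure \<mu> {c} = 0" using AE_iff_measurable[of "{c}" \<mu> "\<lambda>y. y \<notin> {c}"] sets_initial sets_eq_imp_space_eq[OF sets_initial] by auto
    then show False using atom by (simp add: measure_def)
  qed
  have "isCont w c" using datum_continuous by (simp add: continuous_on_eq_continuous_at)
  then have "(w \<longlongrightarrow> w c) (nhds c)" by (simp add: isCont_def tendsto_at_iff_tendsto_nhds)
  then have "(w \<longlongrightarrow> 0) (nhds c)" using c by simp
  then have "\<forall>\<^sub>F y in nhds c. dist (w y) 0 < e" using e by (rule tendstoD)
  then obtain \<delta> where \<delta>: "0 < \<delta>" "\<And>y. \<bar>y - c\<bar> < \<delta> \<Longrightarrow> \<bar>w y\<bar> < e"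
    unfolding eventually_nhds_metric by (auto simp: dist_real_def)
  define d where "d = \<delta> / (4 * (M + 1))"
  have d: "0 < d" using \<delta> M by (simp add: d_def)
  show thesis
  proof (rule that[OF d])
    fix t assume t: "0 \<le> t" "t \<le> d"
    have Mt: "2 * (M * t) < \<delta>"
    proof -
      have "M * t \<le> (M + 1) * d" using t M by (intro mult_mono) auto
      also have "\<dots> = \<delta> / 4" using M by (simp add: d_def field_simps)
      finally show ?thesis using \<delta> by linarith
    qed
    define z where "z = X t c"
    define m where "m = (LINT y|\<mu>. indicator {z} (X t y) :: real)"
    have zi: "integrable \<mu> (\<lambda>y. indicator {z} (X t y) :: real)"
      by (rule integrable_const_bound[of _ 1]) (auto simp: indicator_def)
    have "measure \<mu> {c} = (LINT y|\<mu>. indicator {c} y)" by (simp add: sets_initial)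
    also have "\<dots> \<le> m"
      unfolding m_def by (rule integral_mono') (use zi in \<open>auto simp: indicator_def z_def\<close>)
    finally have m: "0 < m" using atom by simp
    have close: "AE y in \<mu>. X t y = z \<longrightarrow> \<bar>w y\<bar> \<le> e"
      using AE_good
    proof eventually_elim
      case (elim y)
      show ?case
      proof
        assume "X t y = z"
        then have "\<bar>y - c\<bar> \<le> 2 * (M * t)"
          using good_path(3)[OF elim, of 0 t] good_path(3)[OF cgood, of 0 t] good_path(4)[OF elim] good_path(4)[OF cgood] t
          by (simp add: z_def abs_le_iff)
        then show "\<bar>w y\<bar> \<le> e" using \<delta>(2)[of y] Mt by auto
      qed
    qed
    have "u t z * m = (LINT y|\<mu>. u t (X t y) * indicator {z} (X t y))"
      unfolding m_def integral_mult_right_zero[symmetric]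
      by (rule Bochner_Integration.integral_cong) (auto simp: indicator_def)
    also have "\<dots> = (LINT y|\<mu>. w y * indicator {z} (X t y))"
      by (rule mean[OF t(1), of _ 1]) (auto simp: indicator_def)
    finally have "\<bar>u t z * m\<bar> \<le> (LINT y|\<mu>. norm (w y * indicator {z} (X t y)))"
      using integral_norm_bound[of \<mu> "\<lambda>y. w y * indicator {z} (X t y)"] by simp
    also have "\<dots> \<le> (LINT y|\<mu>. e * indicator {z} (X t y))"
    proof (rule integral_mono_AE)
      show "integrable \<mu> (\<lambda>y. norm (w y * indicator {z} (X t y)))"
        by (rule integrable_const_bound[of _ M]) (use datum_bound M in \<open>auto simp: indicator_def\<close>)
      show "AE y in \<mu>. norm (w y * indicator {z} (X t y)) \<le> e * indicator {z} (X t y)"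
        using close by eventually_elim (auto simp: indicator_def)
    qed (use zi in auto)
    also have "\<dots> = e * m" by (simp add: m_def)
    finally show "\<bar>u t (X t c)\<bar> \<le> e" using m by (simp add: abs_mult z_def)
  qed
qed

lemma AE_boundary_start_at_rest:
  "AE y in \<mu>. y \<in> frontier I \<longrightarrow> (\<forall>e>0. \<exists>d>0. \<forall>t. 0 \<le> t \<longrightarrow> t \<le> d \<longrightarrow> \<bar>u t (X t y)\<bar> \<le> e)"
proof -
  have "AE y in \<mu>. \<forall>c\<in>frontier I. y = c \<longrightarrow> (\<forall>e>0. \<exists>d>0. \<forall>t. 0 \<le> t \<longrightarrow> t \<le> d \<longrightarrow> \<bar>u t (X t y)\<bar> \<le> e)"
  proof (rule AE_finite_allI[OF finite_interval_frontier[OF closed_I convex_I]])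
    fix c assume c: "c \<in> frontier I"
    show "AE y in \<mu>. y = c \<longrightarrow> (\<forall>e>0. \<exists>d>0. \<forall>t. 0 \<le> t \<longrightarrow> t \<le> d \<longrightarrow> \<bar>u t (X t y)\<bar> \<le> e)"
    proof (cases "measure \<mu> {c} > 0")
      case True
      then show ?thesis
        using velocity_near_resting_atom[OF datum_frontier[OF c] True] by (intro AE_I2) blast
    next
      case False
      then have "measure \<mu> {c} = 0" using measure_nonneg[of \<mu> "{c}"] by linarith
      then have "{c} \<in> null_sets \<mu>" using sets_initial by (auto simp: null_sets_def emeasure_eq_measure)
      from AE_not_in[OF this] show ?thesis by eventually_elim auto
    qed
  qed
  then show ?thesis by eventually_elim auto
qed

text \<open>For \<open>g = \<sigma> (c - X)\<close> the bound on the origin of free transport says \<open>g' \<le> g / t\<close>. From a positive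
  hitting time on, \<open>gronwall_vanish\<close> shows \<open>g \<le> 0\<close>: the particle stays at or beyond \<open>c\<close>. The
  inequality alone would allow a particle that starts at \<open>c\<close> to move inwards along \<open>g = k t\<close>; this
  is excluded because its velocity tends to zero as \<open>t\<close> does.\<close>

lemma AE_absorbed: "AE y in \<mu>. absorbed I (\<lambda>t. X t y)"
  using AE_good start AE_free_transport_origin_in_I AE_boundary_start_at_rest
proof eventually_elim
  case (elim y)
  note path = good_path[OF elim(1)]
  show ?case
    unfolding absorbed_def
  proof (intro ballI allI impI)
    fix c s t assume c: "c \<in> frontier I" and s: "0 \<le> s" and st: "s \<le> t" and xs: "X s y = c"
    have cI: "c \<in> I" "c \<notin> interior I" using c closed_I by (auto simp: frontier_def)
    obtain \<sigma> :: real where \<sigma>: "\<sigma> = 1 \<or> \<sigma> = -1" "\<And>z. z \<in> I \<Longrightarrow> \<sigma> * z \<le> \<sigma> * c"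
    proof -
      from interval_frontier_extremal[OF convex_I cI(2)] show thesis
        using that[of 1] that[of "-1"] by auto
    qed
    define g where "g \<tau> = \<sigma> * (c - X \<tau> y)" for \<tau>
    define h where "h \<tau> = (- \<sigma>) * u \<tau> (X \<tau> y)" for \<tau>
    have hint: "set_integrable lborel {a..b} h" for a b
      unfolding h_def by (rule set_integrable_mult_right[OF velocity_integrable])
    have ginc: "g b - g a = (LINT \<tau>:{a..b}|lborel. h \<tau>)" if "0 \<le> a" "a \<le> b" for a b
      unfolding g_def h_def set_integral_mult_right using path(2)[OF that] by (simp add: algebra_simps)
    have gcont: "continuous_on {a..b} g" if "0 \<le> a" for a b
      unfolding g_def using that by (intro continuous_intros continuous_on_subset[OF path(1)]) auto
    have ode: "AE \<tau> in lborel. 0 < \<tau> \<longrightarrow> h \<tau> \<le> g \<tau> / \<tau>"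
      using elim(3)
    proof eventually_elim
      case (elim \<tau>)
      show ?case
      proof
        assume \<tau>: "0 < \<tau>"
        then have "\<sigma> * (X \<tau> y - \<tau> * u \<tau> (X \<tau> y)) \<le> \<sigma> * c" using elim \<sigma>(2) by blast
        then show "h \<tau> \<le> g \<tau> / \<tau>" using \<tau> by (simp add: h_def g_def field_simps)
      qed
    qed
    have "g t \<le> 0"
    proof (cases "0 < s")
      case True
      have "AE \<tau> in lborel. \<tau> \<in> {s..t} \<longrightarrow> 0 < g \<tau> \<longrightarrow> h \<tau> \<le> g \<tau> / \<tau>"
        using ode by eventually_elim (use True in auto)
      then show ?thesis
        using True st xs by (intro gronwall_vanish[OF True st gcont _ hint ginc]) (auto simp: g_def)
    next
      case False
      then have s0: "s = 0" using s by simp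
      then have yc: "y = c" using xs path(4) by simp
      show ?thesis
      proof (cases "0 < t")
        case t: True
        show ?thesis
        proof (rule field_le_epsilon)
          fix e :: real assume e: "0 < e"
          then have "0 < e / t" using t by simp
          then obtain d where d: "0 < d" "\<And>\<tau>. 0 \<le> \<tau> \<Longrightarrow> \<tau> \<le> d \<Longrightarrow> \<bar>u \<tau> (X \<tau> y)\<bar> \<le> e / t"
            using elim(4) c yc by blast
          define r where "r = min d t"
          have r: "0 < r" "r \<le> t" "r \<le> d" using d t by (auto simp: r_def)
          have "g r = g r - g 0" using path(4) yc by (simp add: g_def)
          also have "\<dots> = (LINT \<tau>:{0..r}|lborel. h \<tau>)" using ginc r by simp
          also have "\<dots> \<le> \<bar>LINT \<tau>:{0..r}|lborel. h \<tau>\<bar>" by simp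
          also have "\<dots> \<le> e / t * (r - 0)"
          proof (rule set_integral_bound_Icc)
            show "h \<in> borel_measurable borel" unfolding h_def by measurable
            show "\<bar>h \<tau>\<bar> \<le> e / t" if "\<tau> \<in> {0..r}" for \<tau>
              using d(2)[of \<tau>] that r \<sigma>(1) by (auto simp: h_def abs_mult)
          qed (use r in simp)
          finally have gr: "g r / r \<le> e / t" using r by (simp add: field_simps)
          have "g t \<le> g r / r * t"
          proof (rule gronwall_ratio[OF r(1,2) gcont hint ginc])
            show "AE \<tau> in lborel. \<tau> \<in> {r..t} \<longrightarrow> h \<tau> \<le> g \<tau> / \<tau>"
              using ode by eventually_elim (use r in auto)
          qed (use r in auto)
          also have "\<dots> \<le> e / t * t" using gr t by (intro mult_right_mono) auto
          finally show "g t \<le> 0 + e" using t by simp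
        qed
      qed (use st s0 yc path(4) in \<open>auto simp: g_def\<close>)
    qed
    then have "\<sigma> * c \<le> \<sigma> * X t y" by (simp add: g_def algebra_simps)
    then show "closest_point I (X t y) = c"
      using \<sigma> by (intro closest_point_beyond_real[OF closed_I convex_I cI(1), of \<sigma>]) auto
  qed
qed

definition stopped :: "real \<Rightarrow> real \<Rightarrow> real" where
  "stopped t y = closest_point I (X t y)"

text \<open>On the interior and for \<open>t > 0\<close>, the point \<open>x - t u (t, x)\<close>, from which free transport leads to \<open>x\<close>, is
  moved into \<open>I\<close>. For almost every particle it already lies there, so the velocity is altered on a
  null set only; the Oleinik condition then extends to the endpoints, where the velocity is zero.\<close>

definition regularised :: "real \<Rightarrow> real \<Rightarrow> real" where
  "regularised t x =
     (if x \<notin> interior I then 0 else if t \<le> 0 then u t x else (x - closest_point I (x - t * u t x)) / t)"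

lemma closest_point_measurable: "closest_point I \<in> borel_measurable borel"
  by (rule borel_measurable_continuous_onI[OF continuous_on_closest_point[OF convex_I closed_I I_nonempty]])

lemma closest_point_compose_measurable [measurable (raw)]:
  "f \<in> borel_measurable N \<Longrightarrow> (\<lambda>x. closest_point I (f x)) \<in> borel_measurable N"
  by (rule measurable_compose[OF _ closest_point_measurable])

lemma interior_measurable [measurable]: "interior I \<in> sets borel"
  by simp

lemma stopped_measurable: "(\<lambda>(t, y). stopped t y) \<in> borel_measurable borel"
  unfolding stopped_def borel_prod[symmetric] by measurable

lemma regularised_measurable: "(\<lambda>(t, x). regularised t x) \<in> borel_measurable borel"
  unfolding regularised_def borel_prod[symmetric] by measurable

lemma regularised_bound: "\<bar>regularised t x\<bar> \<le> M"
proof (cases "x \<in> interior I \<and> 0 < t")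
  case True
  then have x: "closest_point I x = x" using interior_subset closest_point_self by blast
  have "\<bar>x - closest_point I (x - t * u t x)\<bar> \<le> \<bar>t * u t x\<bar>"
    using closest_point_lipschitz[OF convex_I closed_I I_nonempty, of x "x - t * u t x"] by (simp add: x dist_real_def)
  also have "\<dots> \<le> t * M" using True velocity_bound by (auto simp: abs_mult)
  finally show ?thesis using True by (simp add: regularised_def field_simps abs_divide)
next
  case False
  then show ?thesis using velocity_bound[of t x] by (auto simp: regularised_def)
qed

lemma regularised_eq:
  assumes "x \<in> interior I" "0 < t \<Longrightarrow> x - t * u t x \<in> I"
  shows "regularised t x = u t x"
  using assms by (auto simp: regularised_def closest_point_self)

text \<open>The Oleinik condition for a velocity \<open>v\<close> says that \<open>x - t v (t, x)\<close> is nondecreasing in \<open>x\<close>. The map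
  \<open>p\<close> below has this form; it sends \<open>I\<close> to itself, fixes the endpoints, and is nondecreasing on the
  interior as a composition of nondecreasing maps.\<close>

lemma regularised_oleinik:
  assumes t: "0 < t" and xy: "x \<in> I" "y \<in> I" "x < y"
  shows "(regularised t y - regularised t x) / (y - x) \<le> 1 / t"
proof -
  define p where "p z = (if z \<in> interior I then closest_point I (z - t * u t z) else z)" for z
  have reg: "regularised t z = (z - p z) / t" for z using t by (auto simp: regularised_def p_def)
  have pI: "closest_point I z \<in> I" for z using closest_point_in_set[OF closed_I I_nonempty] .
  have endpoint: "z \<notin> interior I \<Longrightarrow> (\<forall>a\<in>I. a \<le> z) \<or> (\<forall>a\<in>I. z \<le> a)" for z
    by (rule interval_frontier_extremal[OF convex_I])
  have "p x \<le> p y"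
  proof (cases "x \<in> interior I \<and> y \<in> interior I")
    case True
    have "x - t * u t x \<le> y - t * u t y"
      using one_sided_lipschitz[OF t, of x y] xy t by (simp add: field_simps)
    then show ?thesis using True closest_point_mono_real[OF closed_I convex_I I_nonempty] by (simp add: p_def)
  next
    case False
    have pI': "p x \<in> I" "p y \<in> I" using pI xy by (auto simp: p_def)
    from False consider "x \<notin> interior I" | "y \<notin> interior I" by blast
    then show ?thesis
    proof cases
      case 1
      then have "\<forall>a\<in>I. x \<le> a" using endpoint[of x] xy by (meson not_le)
      then show ?thesis using 1 pI' by (simp add: p_def)
    next
      case 2
      then have "\<forall>a\<in>I. a \<le> y" using endpoint[of y] xy by (meson not_le)
      then show ?thesis using 2 pI' by (simp add: p_def)
    qed
  qed
  then have "regularised t y - regularised t x \<le> (y - x) / t"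
    using t by (simp add: reg diff_divide_distrib[symmetric] divide_right_mono)
  then show ?thesis using xy t by (simp add: field_simps)
qed

lemma regularised_along_stopped:
  assumes "X t y \<in> interior I \<Longrightarrow> 0 < t \<Longrightarrow> X t y - t * u t (X t y) \<in> I"
  shows "regularised t (stopped t y) = (if X t y \<in> interior I then u t (X t y) else 0)"
proof (cases "X t y \<in> interior I")
  case True
  then have "stopped t y = X t y" unfolding stopped_def using interior_subset closest_point_self by blast
  then show ?thesis using True assms regularised_eq by simp
next
  case False
  then have "stopped t y \<notin> interior I"
    unfolding stopped_def using closest_point_interior_iff[OF closed_I convex_I I_nonempty] by simp
  then show ?thesis using False by (simp add: regularised_def)
qed

text \<open>Up to the stopping time the regularised velocity is that of the unstopped path; from then on the
  unstopped path stays outside the interior, and the stopped one is at an endpoint and at rest.\<close>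

lemma stopped_trajectories:
  "AE y in \<mu>. stopped 0 y = y \<and> (\<forall>t\<ge>0. stopped t y \<in> I) \<and>
     integral_path (\<lambda>\<tau>. regularised \<tau> (stopped \<tau> y)) (\<lambda>t. stopped t y)"
  using AE_good start AE_free_transport_origin_in_I AE_absorbed
proof eventually_elim
  case (elim y)
  note path = good_path[OF elim(1)]
  let ?r = "\<lambda>\<tau>. regularised \<tau> (stopped \<tau> y)"
  have [measurable]: "?r \<in> borel_measurable borel"
  proof -
    have "(\<lambda>\<tau>. (\<tau>, stopped \<tau> y)) \<in> borel \<rightarrow>\<^sub>M borel \<Otimes>\<^sub>M borel" unfolding stopped_def by measurable
    from measurable_compose[OF this regularised_measurable[unfolded borel_prod[symmetric]]] show ?thesis by simp
  qed
  have rint: "set_integrable lborel {a..b} ?r" for a b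
    by (rule set_integrable_bounded_Icc[OF _ regularised_bound]) measurable
  have s0: "stopped 0 y = y" using elim(2) path(4) by (simp add: stopped_def closest_point_self)
  have from0: "stopped t y - y = (LINT \<tau>:{0..t}|lborel. ?r \<tau>)" if t: "0 \<le> t" for t
  proof -
    obtain T where T: "0 \<le> T" "T \<le> t" "closest_point I (X t y) = X T y"
      "\<And>s. 0 \<le> s \<Longrightarrow> s < T \<Longrightarrow> X s y \<in> interior I" "\<And>s. T < s \<Longrightarrow> s \<le> t \<Longrightarrow> X s y \<notin> interior I"
    proof -
      have "X 0 y \<in> I" using elim(2) path(4) by simp
      from stopping_time[OF closed_I path(1) this elim(4) t] that show thesis by metis
    qed
    have "(LINT \<tau>:{0..T}|lborel. ?r \<tau>) = (LINT \<tau>:{0..T}|lborel. u \<tau> (X \<tau> y))"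
    proof (rule set_lebesgue_integral_cong_AE)
      show "AE \<tau>\<in>{0..T} in lborel. ?r \<tau> = u \<tau> (X \<tau> y)"
        using elim(3) AE_lborel_singleton[of T]
        by eventually_elim (use T(4) in \<open>auto simp: regularised_along_stopped\<close>)
    qed (use velocity_along_path_measurable in auto)
    moreover have "(LINT \<tau>:{T..t}|lborel. ?r \<tau>) = (LINT \<tau>:{T..t}|lborel. 0)"
    proof (rule set_lebesgue_integral_cong_AE)
      show "AE \<tau>\<in>{T..t} in lborel. ?r \<tau> = 0"
        using elim(3) AE_lborel_singleton[of T]
        by eventually_elim (use T(1,5) in \<open>auto simp: regularised_along_stopped\<close>)
    qed auto
    ultimately have "(LINT \<tau>:{0..t}|lborel. ?r \<tau>) = X T y - X 0 y"
      using set_integral_Icc_split[OF rint T(1,2)] path(2)[of 0 T] T(1) by simp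
    then show ?thesis using T(3) path(4) by (simp add: stopped_def)
  qed
  have "integral_path ?r (\<lambda>t. stopped t y)"
    unfolding integral_path_def
  proof (intro allI impI)
    fix s t :: real assume st: "0 \<le> s" "s \<le> t"
    then show "stopped t y - stopped s y = (LINT \<tau>:{s..t}|lborel. ?r \<tau>)"
      using from0[of s] from0[of t] set_integral_Icc_split[OF rint st] by simp
  qed
  then show ?case
    using s0 closest_point_in_set[OF closed_I I_nonempty] by (simp add: stopped_def)
qed

text \<open>A function that vanishes on the frontier sees only the particles with \<open>X t\<close> in the interior of
  \<open>I\<close>. These have not been stopped, so the property is inherited from the unstopped flow.\<close>

lemma stopped_mean:
  assumes t: "0 \<le> t" and \<zeta> [measurable]: "\<zeta> \<in> borel_measurable borel" and K: "\<And>y. \<bar>\<zeta> y\<bar> \<le> K"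
    and zero: "\<And>y. y \<in> frontier I \<Longrightarrow> \<zeta> y = 0"
  shows "(LINT y|\<mu>. regularised t (stopped t y) * \<zeta> (stopped t y)) = (LINT y|\<mu>. w y * \<zeta> (stopped t y))"
proof -
  define \<eta> where "\<eta> x = indicator (interior I) x * \<zeta> x" for x
  have [measurable]: "\<eta> \<in> borel_measurable borel" unfolding \<eta>_def by measurable
  have \<eta>: "\<zeta> (stopped t y) = \<eta> (X t y)" for y
  proof (cases "X t y \<in> interior I")
    case True
    then have "stopped t y = X t y" unfolding stopped_def using interior_subset closest_point_self by blast
    then show ?thesis using True by (simp add: \<eta>_def)
  next
    case False
    then have "stopped t y \<in> frontier I"
      using closest_point_interior_iff[OF closed_I convex_I I_nonempty, of "X t y"]
        closest_point_in_set[OF closed_I I_nonempty, of "X t y"] closure_subset[of I]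
      by (auto simp: stopped_def frontier_def)
    then show ?thesis using False zero by (simp add: \<eta>_def)
  qed
  have AE: "AE y in \<mu>. 0 < t \<longrightarrow> X t y - t * u t (X t y) \<in> I"
    using free_transport_origin_in_I by (cases "0 < t") auto
  have m: "(\<lambda>y. regularised t (stopped t y)) \<in> borel_measurable \<mu>"
  proof -
    have "(\<lambda>y. (t, stopped t y)) \<in> \<mu> \<rightarrow>\<^sub>M borel \<Otimes>\<^sub>M borel" unfolding stopped_def by measurable
    from measurable_compose[OF this regularised_measurable[unfolded borel_prod[symmetric]]] show ?thesis by simp
  qed
  have "(LINT y|\<mu>. regularised t (stopped t y) * \<zeta> (stopped t y)) = (LINT y|\<mu>. u t (X t y) * \<eta> (X t y))"
    unfolding \<eta>
  proof (rule integral_cong_AE)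
    show "AE y in \<mu>. regularised t (stopped t y) * \<eta> (X t y) = u t (X t y) * \<eta> (X t y)"
      using AE by eventually_elim (simp add: regularised_along_stopped, simp add: \<eta>_def)
  qed (use m in measurable)
  also have "\<dots> = (LINT y|\<mu>. w y * \<eta> (X t y))"
    using K abs_ge_zero[THEN order_trans, OF K] by (intro mean[OF t, of _ K]) (auto simp: \<eta>_def indicator_def)
  finally show ?thesis by (simp add: \<eta>)
qed

lemma sticky_flow_stopped: "sticky_flow \<mu> I stopped regularised M w"
proof unfold_locales
  show "oleinik I regularised"
    unfolding oleinik_def
  proof (intro allI impI)
    fix t x y :: real assume "0 < t" "x < y \<and> connected_component I x y"
    then show "(regularised t y - regularised t x) / (y - x) \<le> 1 / t"
      using connected_component_in[of I x y] by (intro regularised_oleinik) auto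
  qed
  show "w \<in> borel_measurable borel" by measurable
  show "continuous_on I w" using datum_continuous by (rule continuous_on_subset) simp
  show "regularised t y = 0" if "y \<in> frontier I" for t y
    using that by (simp add: regularised_def frontier_def)
qed (fact sets_initial closed_I stopped_measurable regularised_measurable regularised_bound
    stopped_trajectories datum_bound datum_frontier stopped_mean)+

end

section \<open>The modified flow on one component\<close>

lemma measurable_extend_time:
  fixes f :: "real \<Rightarrow> real \<Rightarrow> real"
  assumes "(\<lambda>(t, y). f t y) \<in> borel_measurable (restrict_space borel ({0..} \<times> UNIV))"
  shows "(\<lambda>(t, y). f (max 0 t) y) \<in> borel_measurable borel"
proof -
  have "(\<lambda>p :: real \<times> real. (max 0 (fst p), snd p)) \<in> borel \<rightarrow>\<^sub>M restrict_space borel ({0..} \<times> UNIV)"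
    by (intro measurable_restrict_space2 borel_measurable_continuous_onI continuous_intros) auto
  from measurable_compose[OF this assms] show ?thesis by (simp add: case_prod_beta')
qed

lemma stopped_path_cong:
  assumes "\<And>s. 0 \<le> s \<Longrightarrow> x s = x' s" and t: "0 \<le> t"
  shows "stopped_path I x t = stopped_path I x' t"
proof -
  let ?H = "{s. 0 \<le> s \<and> x s \<in> frontier I}"
  have H: "?H = {s. 0 \<le> s \<and> x' s \<in> frontier I}" using assms(1) by auto
  have "0 \<le> Inf ?H" if "s \<in> {0..t}" "x s \<in> frontier I" for s
    using that by (intro cInf_greatest) auto
  then show ?thesis using assms by (auto simp: stopped_path_def H[symmetric])
qed

lemma (in line_flow) AE_stopped_path:
  "AE y in \<mu>. continuous_on {0..} (\<lambda>s. X s y) \<and> (\<forall>t\<ge>0. stopped_path I (\<lambda>s. X s y) t = stopped t y)"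
  using AE_good start AE_absorbed
proof eventually_elim
  case (elim y)
  note path = good_path[OF elim(1)]
  have "X 0 y \<in> I" using elim(2) path(4) by simp
  then show ?case
    using stopping_time[OF closed_I path(1) _ elim(3)] path(1) unfolding stopped_def by metis
qed

text \<open>The velocity is an average of \<open>w\<close>, so truncating it at \<open>-M\<close> and \<open>M\<close> changes it on a null set only
  and keeps the one-sided Lipschitz bound.\<close>

lemma lagrangian_map_line_flow:
  assumes "prob_space \<mu>" and sets: "sets \<mu> = sets borel" and lag: "lagrangian_map \<mu> w X v"
    and I: "closed I" "convex I" "AE y in \<mu>. y \<in> I"
    and w: "\<And>y. \<bar>w y\<bar> \<le> M" "continuous_on UNIV w" "\<And>y. y \<in> frontier I \<Longrightarrow> w y = 0"
  shows "line_flow \<mu> (\<lambda>t. X (max 0 t)) (\<lambda>t x. max (- M) (min M (v (max 0 t) x))) M w I"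
    and "0 \<le> t \<Longrightarrow> AE y in \<mu>. \<bar>v t (X t y)\<bar> \<le> M"
proof -
  interpret prob_space \<mu> by fact
  interpret P: pair_sigma_finite lborel \<mu> ..
  note [measurable_cong] = sets
  have M: "0 \<le> M" using w(1)[of 0] by linarith
  have [measurable]: "w \<in> borel_measurable borel" using w(2) by (rule borel_measurable_continuous_onI)
  define XX where "XX t = X (max 0 t)" for t
  define vv where "vv t = v (max 0 t)" for t
  define u where "u t x = max (- M) (min M (vv t x))" for t x
  have XXm: "(\<lambda>(t, y). XX t y) \<in> borel_measurable borel"
    unfolding XX_def using lag by (intro measurable_extend_time) (simp add: lagrangian_map_def)
  have SPS: "SPS_conditions UNIV \<mu> w (\<lambda>t. distr \<mu> borel (X t)) v"
    using lag by (simp add: lagrangian_map_def)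
  have vvm: "(\<lambda>(t, x). vv t x) \<in> borel_measurable borel"
    unfolding vv_def using SPS by (intro measurable_extend_time) (simp add: SPS_conditions_def)
  have XX_comp [measurable (raw)]: "(\<lambda>x. XX (f x) (g x)) \<in> borel_measurable N"
    if "f \<in> borel_measurable N" "g \<in> borel_measurable N" for f g and N :: "'b measure"
  proof -
    have "(\<lambda>x. (f x, g x)) \<in> N \<rightarrow>\<^sub>M borel" using that by measurable
    from measurable_compose[OF this XXm] show ?thesis by simp
  qed
  have vv_comp [measurable (raw)]: "(\<lambda>x. vv (f x) (g x)) \<in> borel_measurable N"
    if "f \<in> borel_measurable N" "g \<in> borel_measurable N" for f g and N :: "'b measure"
  proof -
    have "(\<lambda>x. (f x, g x)) \<in> N \<rightarrow>\<^sub>M borel" using that by measurable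
    from measurable_compose[OF this vvm] show ?thesis by simp
  qed
  have X0: "XX 0 y = y" for y using lag by (simp add: XX_def lagrangian_map_def)
  have Xpos: "XX t = X t" "vv t = v t" if "0 \<le> t" for t using that by (auto simp: XX_def vv_def)
  have bounded_L2: "\<zeta> \<in> L2 (distr \<mu> borel (XX t))"
    if "\<zeta> \<in> borel_measurable borel" "\<And>y. \<bar>\<zeta> y\<bar> \<le> K" for \<zeta> t K
  proof -
    interpret D: prob_space "distr \<mu> borel (XX t)" by (rule prob_space_distr) measurable
    have "\<bar>(\<zeta> y)\<^sup>2\<bar> \<le> K\<^sup>2" for y
      using that(2)[of y] by (simp add: abs_le_square_iff[symmetric])
    then have "integrable (distr \<mu> borel (XX t)) (\<lambda>y. (\<zeta> y)\<^sup>2)"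
      using that(1) by (intro D.integrable_const_bound[of _ "K\<^sup>2"] AE_I2) simp_all
    then show ?thesis using that(1) by (simp add: L2_def)
  qed
  have rep: "vv t \<in> L2 (distr \<mu> borel (XX t))"
    "\<And>\<zeta>. \<zeta> \<in> L2 (distr \<mu> borel (XX t)) \<Longrightarrow> (LINT y|\<mu>. vv t (XX t y) * \<zeta> (XX t y)) = (LINT y|\<mu>. w y * \<zeta> (XX t y))" for t
  proof -
    have "\<forall>t\<ge>0. cond_exp_rep \<mu> w (X t) (v t)" using lag unfolding lagrangian_map_def by blast
    then have c: "cond_exp_rep \<mu> w (XX t) (vv t)" by (simp add: XX_def vv_def)
    show "vv t \<in> L2 (distr \<mu> borel (XX t))"
      by (rule conjunct1[OF c[unfolded cond_exp_rep_def]])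
    show "(LINT y|\<mu>. vv t (XX t y) * \<zeta> (XX t y)) = (LINT y|\<mu>. w y * \<zeta> (XX t y))"
      if "\<zeta> \<in> L2 (distr \<mu> borel (XX t))" for \<zeta>
      by (rule bspec[OF conjunct2[OF c[unfolded cond_exp_rep_def]] that])
  qed
  have vint: "integrable \<mu> (\<lambda>y. vv t (XX t y))" for t
  proof -
    interpret D: prob_space "distr \<mu> borel (XX t)" by (rule prob_space_distr) measurable
    have m: "XX t \<in> borel_measurable \<mu>" "vv t \<in> borel_measurable borel" by measurable
    have "integrable (distr \<mu> borel (XX t)) (\<lambda>y. (vv t y)\<^sup>2)"
      using rep(1)[of t] unfolding L2_def by blast
    then have "integrable (distr \<mu> borel (XX t)) (vv t)"
      using m(2) by (intro D.square_integrable_imp_integrable[of "vv t"]) simp_all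
    then show ?thesis using integrable_distr_eq[OF m] by blast
  qed
  have wint: "integrable \<mu> w" by (rule integrable_const_bound[of _ M]) (use w in auto)
  have mean: "(LINT y|\<mu>. vv t (XX t y) * indicator A (XX t y)) = (LINT y|\<mu>. w y * indicator A (XX t y))"
    if "A \<in> sets borel" for A t
    using that by (intro rep(2) bounded_L2[of _ 1]) auto
  have vbound: "AE y in \<mu>. \<bar>vv t (XX t y)\<bar> \<le> M" for t
  proof -
    have "AE y in \<mu>. - M \<le> vv t (XX t y)"
    proof (rule conditional_mean_ge[where f = "vv t" and Z = "XX t" and g = w])
      show "AE y in \<mu>. - M \<le> w y" using w(1) by (intro AE_I2) (auto simp: abs_le_iff minus_le_iff)
      show "XX t \<in> borel_measurable \<mu>" "vv t \<in> borel_measurable borel" by measurable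
    qed (use vint wint mean in auto)
    moreover have "AE y in \<mu>. - M \<le> - vv t (XX t y)"
    proof (rule conditional_mean_ge[where f = "\<lambda>x. - vv t x" and Z = "XX t" and g = "\<lambda>y. - w y"])
      show "AE y in \<mu>. - M \<le> - w y" using w(1) by (intro AE_I2) (auto simp: abs_le_iff)
      show "XX t \<in> borel_measurable \<mu>" "(\<lambda>x. - vv t x) \<in> borel_measurable borel" by measurable
    qed (use vint wint mean in auto)
    ultimately show ?thesis by eventually_elim auto
  qed
  then show "0 \<le> t \<Longrightarrow> AE y in \<mu>. \<bar>v t (X t y)\<bar> \<le> M"
    by (metis Xpos)
  have u_eq: "u t x = vv t x" if "\<bar>vv t x\<bar> \<le> M" for t x using that by (auto simp: u_def)
  have u_bound: "\<bar>u t x\<bar> \<le> M" for t x using M by (auto simp: u_def)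
  have um: "(\<lambda>(t, x). u t x) \<in> borel_measurable borel"
    unfolding u_def borel_prod[symmetric] by measurable
  have "AE t in lborel. AE y in \<mu>. \<bar>vv t (XX t y)\<bar> \<le> M" using vbound by simp
  moreover have "{p \<in> space (lborel \<Otimes>\<^sub>M \<mu>). \<bar>vv (fst p) (XX (fst p) (snd p))\<bar> \<le> M} \<in> sets (lborel \<Otimes>\<^sub>M \<mu>)"
    by measurable
  ultimately have vbound': "AE y in \<mu>. AE t in lborel. \<bar>vv t (XX t y)\<bar> \<le> M"
    using P.AE_commute[of "\<lambda>t y. \<bar>vv t (XX t y)\<bar> \<le> M"] by simp
  have lag_path: "AE y in \<mu>. \<forall>s t. 0 \<le> s \<and> s < t \<longrightarrow> X t y - X s y = (LINT \<tau>:{s..t}|lborel. v \<tau> (X \<tau> y))"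
  proof -
    have "AE y in \<mu>. (\<forall>T\<ge>0. \<exists>L. L-lipschitz_on {0..T} (\<lambda>t. X t y)) \<and>
        (\<forall>s t. 0 \<le> s \<and> s < t \<longrightarrow> set_integrable lborel {s..t} (\<lambda>\<tau>. v \<tau> (X \<tau> y)) \<and>
           X t y - X s y = (LINT \<tau>:{s..t}|lborel. v \<tau> (X \<tau> y)))"
      using lag unfolding lagrangian_map_def by (elim conjE) assumption
    then show ?thesis by eventually_elim blast
  qed
  have path: "AE y in \<mu>. XX 0 y = y \<and> (\<forall>t\<ge>0. XX t y \<in> UNIV) \<and> integral_path (\<lambda>\<tau>. u \<tau> (XX \<tau> y)) (\<lambda>t. XX t y)"
    using lag_path vbound'
  proof eventually_elim
    case (elim y)
    have "integral_path (\<lambda>\<tau>. u \<tau> (XX \<tau> y)) (\<lambda>t. XX t y)"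
      unfolding integral_path_def
    proof (intro allI impI)
      fix s t :: real assume st: "0 \<le> s" "s \<le> t"
      show "XX t y - XX s y = (LINT \<tau>:{s..t}|lborel. u \<tau> (XX \<tau> y))"
      proof (cases "s = t")
        case True
        have "(\<lambda>\<tau>. u \<tau> (XX \<tau> y)) \<in> borel_measurable borel" unfolding u_def by measurable
        from set_integral_bound_Icc[OF this u_bound, of s s] True show ?thesis by simp
      next
        case False
        have "(LINT \<tau>:{s..t}|lborel. u \<tau> (XX \<tau> y)) = (LINT \<tau>:{s..t}|lborel. vv \<tau> (XX \<tau> y))"
        proof (rule set_lebesgue_integral_cong_AE)
          show "AE \<tau>\<in>{s..t} in lborel. u \<tau> (XX \<tau> y) = vv \<tau> (XX \<tau> y)"
            using elim(2) by eventually_elim (simp add: u_eq)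
        qed (unfold u_def, measurable)
        also have "\<dots> = (LINT \<tau>:{s..t}|lborel. v \<tau> (X \<tau> y))"
          using st by (intro set_lebesgue_integral_cong) (auto simp: Xpos)
        also have "\<dots> = X t y - X s y" using elim(1) st False by (simp add: order_le_less)
        finally show ?thesis using st by (simp add: Xpos)
      qed
    qed
    then show ?case using X0 by simp
  qed
  have yint: "integrable \<mu> (\<lambda>y. y)"
  proof (rule square_integrable_imp_integrable)
    have "X 0 \<in> L2 \<mu>" using lag by (simp add: lagrangian_map_def L2_abs_continuous_def)
    then show "integrable \<mu> (\<lambda>y. y\<^sup>2)" using X0 by (simp add: L2_def Xpos)
  qed measurable
  have lip: "u t y - u t x \<le> (y - x) / t" if t: "0 < t" and xy: "x \<le> y" for t x y
  proof (cases "x = y")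
    case False
    have "oleinik UNIV v" using SPS by (simp add: SPS_conditions_def)
    moreover have "connected_component UNIV x y"
      unfolding connected_component_def by (rule exI[of _ UNIV]) simp
    ultimately have "(v t y - v t x) / (y - x) \<le> 1 / t"
      using t xy False unfolding oleinik_def by simp
    then have "v t y - v t x \<le> 1 / t * (y - x)"
      using False xy by (subst (asm) pos_divide_le_eq) auto
    then have "vv t y - vv t x \<le> (y - x) / t" using t by (simp add: Xpos)
    moreover have "0 \<le> (y - x) / t" using xy t by simp
    ultimately show ?thesis unfolding u_def by linarith
  qed simp
  have u_mean: "(LINT y|\<mu>. u t (XX t y) * \<zeta> (XX t y)) = (LINT y|\<mu>. w y * \<zeta> (XX t y))"
    if "0 \<le> t" and \<zeta>: "\<zeta> \<in> borel_measurable borel" "\<And>y. \<bar>\<zeta> y\<bar> \<le> K" for t \<zeta> K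
  proof -
    note [measurable] = \<zeta>(1)
    have "(LINT y|\<mu>. u t (XX t y) * \<zeta> (XX t y)) = (LINT y|\<mu>. vv t (XX t y) * \<zeta> (XX t y))"
    proof (rule integral_cong_AE)
      show "AE y in \<mu>. u t (XX t y) * \<zeta> (XX t y) = vv t (XX t y) * \<zeta> (XX t y)"
        using vbound[of t] by eventually_elim (simp add: u_eq)
    qed (unfold u_def, measurable)
    then show ?thesis using rep(2)[OF bounded_L2[OF \<zeta>]] by simp
  qed
  have "line_flow \<mu> XX u M w I"
    by unfold_locales (fact sets XXm um u_bound path I w yint lip u_mean closed_UNIV)+
  then show "line_flow \<mu> (\<lambda>t. X (max 0 t)) (\<lambda>t x. max (- M) (min M (v (max 0 t) x))) M w I"
    by (simp add: XX_def[abs_def] u_def[abs_def] vv_def[abs_def])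
qed

lemma lagrangian_map_sticky_flow:
  assumes prob: "prob_space \<mu>" "sets \<mu> = sets borel" and lag: "lagrangian_map \<mu> w X v"
    and I: "closed I" "convex I" "AE y in \<mu>. y \<in> I"
    and w: "\<And>y. \<bar>w y\<bar> \<le> M" "continuous_on UNIV w" "\<And>y. y \<in> frontier I \<Longrightarrow> w y = 0"
  obtains Y u where "sticky_flow \<mu> I Y u M w"
    "AE y in \<mu>. continuous_on {0..} (\<lambda>s. X s y) \<and> (\<forall>t\<ge>0. stopped_path I (\<lambda>s. X s y) t = Y t y)"
    "\<And>t. 0 \<le> t \<Longrightarrow> AE y in \<mu>. u t (Y t y) = (if Y t y \<in> interior I then v t (Y t y) else 0)"
proof -
  let ?X = "\<lambda>t. X (max 0 t)" and ?u = "\<lambda>t x. max (- M) (min M (v (max 0 t) x))"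
  interpret L: line_flow \<mu> ?X ?u M w I by (rule lagrangian_map_line_flow) fact+
  show thesis
  proof (rule that)
    show "sticky_flow \<mu> I L.stopped L.regularised M w" by (rule L.sticky_flow_stopped)
    show "AE y in \<mu>. continuous_on {0..} (\<lambda>s. X s y) \<and> (\<forall>t\<ge>0. stopped_path I (\<lambda>s. X s y) t = L.stopped t y)"
      using L.AE_stopped_path
    proof eventually_elim
      case (elim y)
      have "continuous_on {0..} (\<lambda>s. X s y)"
        using elim by (subst continuous_on_cong[OF refl, of _ _ "\<lambda>s. X (max 0 s) y"]) auto
      moreover have "stopped_path I (\<lambda>s. X s y) t = stopped_path I (\<lambda>s. X (max 0 s) y) t" if "0 \<le> t" for t
        by (rule stopped_path_cong[OF _ that]) simp
      ultimately show ?case using elim by simp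
    qed
    fix t :: real assume t: "0 \<le> t"
    have "AE y in \<mu>. 0 < t \<longrightarrow> X t y - t * ?u t (X t y) \<in> I"
      using L.free_transport_origin_in_I[of t] t by (cases "0 < t") auto
    moreover have "AE y in \<mu>. \<bar>v t (X t y)\<bar> \<le> M"
      by (rule lagrangian_map_line_flow(2)) fact+
    ultimately show "AE y in \<mu>. L.regularised t (L.stopped t y) = (if L.stopped t y \<in> interior I then v t (L.stopped t y) else 0)"
    proof eventually_elim
      case (elim y)
      have int: "L.stopped t y \<in> interior I \<longleftrightarrow> X t y \<in> interior I"
        unfolding L.stopped_def using closest_point_interior_iff[OF I(1,2) L.I_nonempty] t by simp
      have eq: "L.stopped t y = X t y" if "X t y \<in> interior I"
        unfolding L.stopped_def using t closest_point_self[OF subsetD[OF interior_subset that]] by simp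
      have "L.regularised t (L.stopped t y) = (if X t y \<in> interior I then ?u t (X t y) else 0)"
        using L.regularised_along_stopped[of t y] elim(1) t by (simp add: max_def)
      also have "?u t (X t y) = v t (X t y)" using elim(2) t by auto
      finally show ?case using int eq by simp
    qed
  qed
qed

section \<open>Gluing the components\<close>

lemma integral_path_cong:
  assumes "\<And>t. 0 \<le> t \<Longrightarrow> u t = u' t" "\<And>t. 0 \<le> t \<Longrightarrow> x t = x' t" "integral_path u x"
  shows "integral_path u' x'"
  unfolding integral_path_def
proof (intro allI impI)
  fix s t :: real assume st: "0 \<le> s" "s \<le> t"
  have "(LINT \<tau>:{s..t}|lborel. u' \<tau>) = (LINT \<tau>:{s..t}|lborel. u \<tau>)"
    using st assms(1) by (intro set_lebesgue_integral_cong) auto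
  then show "x' t - x' s = (LINT \<tau>:{s..t}|lborel. u' \<tau>)"
    using st assms(2,3) by (simp add: integral_path_def)
qed

lemma (in finite_measure) integral_uniform_measure:
  fixes f :: "'a \<Rightarrow> real"
  assumes [measurable]: "f \<in> borel_measurable M" "A \<in> sets M" and A: "emeasure M A > 0"
  shows "(LINT x|uniform_measure M A. f x) = (LINT x:A|M. f x) / measure M A"
proof -
  have pos: "0 < measure M A" using A by (simp add: emeasure_eq_measure)
  have "uniform_measure M A = density M (\<lambda>x. ennreal (indicator A x / measure M A))"
    unfolding uniform_measure_def
    using pos divide_ennreal[of 1 "measure M A"]
    by (intro density_cong) (auto simp: emeasure_eq_measure indicator_def)
  then have "(LINT x|uniform_measure M A. f x) = (LINT x|M. (indicator A x / measure M A) *\<^sub>R f x)"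
    using pos by (simp add: integral_density)
  also have "\<dots> = (LINT x:A|M. f x) / measure M A"
    unfolding set_lebesgue_integral_def by (simp flip: integral_divide_zero)
  finally show ?thesis .
qed

lemma set_integral_countable_Union_zero:
  fixes f :: "'a \<Rightarrow> real"
  assumes K: "countable K" "pairwise disjnt K" "\<And>A. A \<in> K \<Longrightarrow> A \<in> sets M"
    and f: "integrable M f" and zero: "\<And>A. A \<in> K \<Longrightarrow> (LINT x:A|M. f x) = 0"
  shows "(LINT x:\<Union>K|M. f x) = 0"
proof -
  define A where "A n = \<Union>{B \<in> K. to_nat_on K B = n}" for n
  have inj: "B = B'" if "B \<in> K" "B' \<in> K" "to_nat_on K B = to_nat_on K B'" for B B'
    using that K(1) by (simp add: inj_on_eq_iff[OF inj_on_to_nat_on])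
  have A: "A n = {} \<or> A n \<in> K" for n
  proof (cases "\<exists>B\<in>K. to_nat_on K B = n")
    case True
    then obtain B where B: "B \<in> K" "to_nat_on K B = n" by blast
    then have "{B' \<in> K. to_nat_on K B' = n} = {B}" using inj by auto
    then show ?thesis using B by (simp add: A_def)
  next
    case False
    then have "{B \<in> K. to_nat_on K B = n} = {}" by auto
    then have "A n = {}" by (simp only: A_def Union_empty)
    then show ?thesis by simp
  qed
  have U: "(\<Union>n. A n) = \<Union>K" by (auto simp: A_def)
  have "(LINT x:(\<Union>n. A n)|M. f x) = (\<Sum>n. (LINT x:A n|M. f x))"
  proof (rule lebesgue_integral_countable_add)
    show sA: "A n \<in> sets M" for n using A[of n] K(3) by auto
    show "A i \<inter> A j = {}" if "i \<noteq> j" for i j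
    proof -
      have "disjnt B B'" if "B \<in> K" "to_nat_on K B = i" "B' \<in> K" "to_nat_on K B' = j" for B B'
        using K(2) that \<open>i \<noteq> j\<close> by (metis pairwiseD)
      then show ?thesis by (auto simp: A_def disjnt_def)
    qed
    show "set_integrable M (\<Union>n. A n) f"
      unfolding set_integrable_def using integrable_mult_indicator[OF _ f] sA by blast
  qed
  also have "(LINT x:A n|M. f x) = 0" for n
    using A[of n] zero by (auto simp: set_lebesgue_integral_def)
  then have "(\<Sum>n. (LINT x:A n|M. f x)) = 0" by simp
  finally show ?thesis by (simp add: U)
qed

text \<open>The complement of the support is a union of open null sets, and by the Lindelof property countably
  many of them suffice.\<close>

lemma prob_on_AE:
  assumes "closed C" "\<mu> \<in> prob_on C"
  shows "AE y in \<mu>. y \<in> C"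
proof -
  have sets: "sets \<mu> = sets borel" and supp: "msupport \<mu> \<subseteq> C" using assms by (auto simp: prob_on_def)
  define \<B> where "\<B> = {U :: real set. open U \<and> emeasure \<mu> U = 0}"
  obtain \<B>' where B: "\<B>' \<subseteq> \<B>" "countable \<B>'" "\<Union>\<B>' = \<Union>\<B>"
    using Lindelof[of \<B>] by (auto simp: \<B>_def)
  have "AE y in \<mu>. \<forall>U\<in>\<B>'. y \<notin> U"
    unfolding AE_ball_countable[OF B(2)]
  proof
    fix U assume "U \<in> \<B>'"
    then have "U \<in> null_sets \<mu>" using B sets by (auto simp: \<B>_def null_sets_def)
    then show "AE y in \<mu>. y \<notin> U" by (rule AE_not_in)
  qed
  then show ?thesis
  proof eventually_elim
    case (elim y)
    then have "y \<notin> \<Union>\<B>" using B(3) by blast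
    then have "y \<in> msupport \<mu>" by (auto simp: \<B>_def msupport_def zero_less_iff_neq_zero)
    then show ?case using supp by blast
  qed
qed

lemma nondegenerate_interval_interior:
  fixes I :: "real set"
  assumes "connected I" "I \<noteq> {}" "\<not> is_singleton I"
  shows "interior I \<noteq> {}"
proof -
  obtain a where a: "a \<in> I" using assms by auto
  then obtain b where b: "b \<in> I" "b \<noteq> a" using assms(3) by (auto simp: is_singleton_def)
  have "min a b \<in> I" "max a b \<in> I" using a b by (simp_all add: min_def max_def)
  then have "{min a b<..<max a b} \<subseteq> I"
    using connected_contains_Icc[OF assms(1), of "min a b" "max a b"] greaterThanLessThan_subseteq_atLeastAtMost_iff by fastforce
  then have "{min a b<..<max a b} \<subseteq> interior I" by (rule interior_maximal) simp
  moreover have "(a + b) / 2 \<in> {min a b<..<max a b}" using b by (auto simp: min_def max_def)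
  ultimately show ?thesis by blast
qed

text \<open>A ball around a point of \<open>I\<close> that is contained in \<open>C\<close> is connected and therefore contained in \<open>I\<close>.\<close>

lemma component_frontier:
  fixes C :: "real set"
  assumes C: "closed C" and I: "I \<in> components C"
  shows "frontier I = I \<inter> frontier C"
proof -
  have cl: "closed I" using closed_components[OF C I] .
  have sub: "I \<subseteq> C" using I by (rule in_components_subset)
  have "y \<in> interior I" if y: "y \<in> I" "y \<in> interior C" for y
  proof -
    obtain e where e: "0 < e" "ball y e \<subseteq> C" using y(2) by (auto simp: mem_interior)
    have "ball y e \<subseteq> I"
      by (rule components_maximal[OF I _ e(2)]) (use e y in auto)
    then show ?thesis using e by (auto simp: mem_interior)
  qed
  then show ?thesis
    using interior_mono[OF sub] closure_closed[OF cl] closure_closed[OF C] sub by (auto simp: frontier_def)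
qed

lemma component_of_member:
  assumes "I \<in> components C" "y \<in> I"
  shows "connected_component_set C y = I"
  using assms by (metis components_iff connected_component_eq)

context
  fixes C :: "real set" and \<rho>0 :: "real measure"
  assumes C: "closed C" and \<rho>0: "\<rho>0 \<in> prob_on C"
begin

lemma moving_component_facts:
  assumes "moving_component C \<rho>0 I"
  shows "I \<in> components C" "closed I" "convex I" "I \<subseteq> C" "I \<in> sets borel" "0 < emeasure \<rho>0 I"
    "frontier I = I \<inter> frontier C"
    "prob_space (uniform_measure \<rho>0 I)" "sets (uniform_measure \<rho>0 I) = sets borel"
proof -
  show I: "I \<in> components C" and pos: "0 < emeasure \<rho>0 I" using assms by (auto simp: moving_component_def)
  show cl: "closed I" using closed_components[OF C I] .
  show "convex I" using in_components_connected[OF I] by (simp add: connected_convex_1)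
  show "I \<subseteq> C" using I by (rule in_components_subset)
  show "I \<in> sets borel" using cl by simp
  show "frontier I = I \<inter> frontier C" by (rule component_frontier[OF C I])
  interpret prob_space \<rho>0 using \<rho>0 by (simp add: prob_on_def)
  show "prob_space (uniform_measure \<rho>0 I)"
    using pos by (intro prob_space_uniform_measure) auto
  show "sets (uniform_measure \<rho>0 I) = sets borel" using \<rho>0 by (simp add: prob_on_def)
qed

lemma countable_nondegenerate_components: "countable {I \<in> components C. \<not> is_singleton I}"
proof (rule countable_disjoint_nonempty_interior_subsets)
  show "pairwise disjnt {I \<in> components C. \<not> is_singleton I}"
    using pairwise_disjoint_components[of C] unfolding disjnt_def by (rule pairwise_subset) auto
  show "S = {}" if "S \<in> {I \<in> components C. \<not> is_singleton I}" "interior S = {}" for S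
    using that nondegenerate_interval_interior[of S] in_components_connected[of S C] by auto
qed

lemma countable_moving_components: "countable {I. moving_component C \<rho>0 I}"
  by (rule countable_subset[OF _ countable_nondegenerate_components]) (auto simp: moving_component_def)

text \<open>Nondegenerate components have nonempty interior, so there are only countably many; those without
  mass form a null set. A degenerate component consists of a frontier point.\<close>

lemma AE_moving_or_frontier:
  "AE y in \<rho>0. moving_component C \<rho>0 (connected_component_set C y) \<or> y \<in> frontier C"
proof -
  have sets: "sets \<rho>0 = sets borel" using \<rho>0 by (simp add: prob_on_def)
  have "AE y in \<rho>0. \<forall>I\<in>{I \<in> components C. \<not> is_singleton I}. emeasure \<rho>0 I = 0 \<longrightarrow> y \<notin> I"
    unfolding AE_ball_countable[OF countable_nondegenerate_components]
  proof
    fix I assume "I \<in> {I \<in> components C. \<not> is_singleton I}"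
    then have "I \<in> sets borel" using closed_components[OF C, of I] by simp
    then have "emeasure \<rho>0 I = 0 \<Longrightarrow> I \<in> null_sets \<rho>0" using sets by (simp add: null_sets_def)
    then show "AE y in \<rho>0. emeasure \<rho>0 I = 0 \<longrightarrow> y \<notin> I"
      using AE_not_in by (cases "emeasure \<rho>0 I = 0") auto
  qed
  with prob_on_AE[OF C \<rho>0] show ?thesis
  proof eventually_elim
    case (elim y)
    let ?I = "connected_component_set C y"
    have I: "?I \<in> components C" "y \<in> ?I" using elim(1) by (auto simp: components_iff)
    show ?case
    proof (cases "is_singleton ?I")
      case True
      then obtain a where a: "?I = {a}" by (rule is_singletonE)
      then have "interior ?I = interior {a}" by (rule arg_cong)
      then have "interior ?I = {}" by simp
      then have "y \<in> frontier ?I" using I(2) closure_subset[of ?I] unfolding frontier_def by blast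
      then show ?thesis using component_frontier[OF C I(1)] by blast
    next
      case False
      then show ?thesis using elim(2) I by (auto simp: moving_component_def zero_less_iff_neq_zero)
    qed
  qed
qed

lemma AE_on_moving_components:
  assumes "\<And>I. moving_component C \<rho>0 I \<Longrightarrow> AE y in uniform_measure \<rho>0 I. P I y"
  shows "AE y in \<rho>0. moving_component C \<rho>0 (connected_component_set C y) \<longrightarrow> P (connected_component_set C y) y"
proof -
  interpret prob_space \<rho>0 using \<rho>0 by (simp add: prob_on_def)
  have "AE y in \<rho>0. \<forall>I\<in>{I. moving_component C \<rho>0 I}. y \<in> I \<longrightarrow> P I y"
    unfolding AE_ball_countable[OF countable_moving_components]
  proof
    fix I assume "I \<in> {I. moving_component C \<rho>0 I}"
    then show "AE y in \<rho>0. y \<in> I \<longrightarrow> P I y"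
      using assms[of I] moving_component_facts(6)[of I] AE_uniform_measure[of \<rho>0 I "P I"] by (simp add: less_top[symmetric])
  qed
  with prob_on_AE[OF C \<rho>0] show ?thesis
    by eventually_elim auto
qed

text \<open>Only countably many components carry a formula of their own, each on a Borel set.\<close>

lemma piecewise_measurable:
  fixes F :: "real set \<Rightarrow> real \<Rightarrow> real \<Rightarrow> real"
  assumes F: "\<And>I. moving_component C \<rho>0 I \<Longrightarrow> (\<lambda>(t, y). F I t y) \<in> borel_measurable borel"
    and G: "(\<lambda>(t, y). G t y) \<in> borel_measurable borel"
  shows "(\<lambda>(t, y). if moving_component C \<rho>0 (connected_component_set C y)
      then F (connected_component_set C y) t y else G t y) \<in> borel_measurable borel" (is "?f \<in> _")
proof -
  define K where "K = {I. moving_component C \<rho>0 I}"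
  have K: "countable K" using countable_moving_components by (simp add: K_def)
  have KB: "\<Union>K \<in> sets borel"
    using K moving_component_facts(5) by (intro sets.countable_Union) (auto simp: K_def)
  have comp: "connected_component_set C y = I" if "I \<in> K" "y \<in> I" for I y
    using that component_of_member[of I C y] by (simp add: K_def moving_component_def)
  have mem: "y \<in> \<Union>K" if "moving_component C \<rho>0 (connected_component_set C y)" for y
  proof -
    have "connected_component_set C y \<noteq> {}"
      using that unfolding moving_component_def by (intro in_components_nonempty) blast
    then have "y \<in> C" using connected_component_eq_empty by blast
    then show ?thesis using that by (auto simp: K_def intro!: bexI[of _ "connected_component_set C y"])
  qed
  have nonmem: "\<not> moving_component C \<rho>0 (connected_component_set C y)" if "\<forall>I\<in>K. y \<notin> I" for y
    using mem[of y] that by blast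
  let ?Cover = "insert (UNIV \<times> - \<Union>K) ((\<lambda>I. UNIV \<times> I) ` K) :: (real \<times> real) set set"
  show ?thesis
  proof (rule measurable_piecewise_restrict[of ?Cover])
    show "countable ?Cover" using K by simp
    show "space borel \<subseteq> \<Union>?Cover" by auto
    fix \<Omega> assume \<Omega>: "\<Omega> \<in> ?Cover"
    have "UNIV \<times> A \<in> sets (borel :: (real \<times> real) measure)" if "A \<in> sets borel" for A
      using that by (simp add: borel_prod[symmetric])
    moreover have "I \<in> sets borel" if "I \<in> K" for I using that moving_component_facts(5) by (simp add: K_def)
    ultimately show "\<Omega> \<inter> space borel \<in> sets borel" using \<Omega> KB by auto
    from \<Omega> consider "\<Omega> = UNIV \<times> - \<Union>K" | I where "I \<in> K" "\<Omega> = UNIV \<times> I" by blast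
    then show "?f \<in> borel_measurable (restrict_space borel \<Omega>)"
    proof cases
      case 1
      have "?f \<in> borel_measurable (restrict_space borel \<Omega>) \<longleftrightarrow> (\<lambda>(t, y). G t y) \<in> borel_measurable (restrict_space borel \<Omega>)"
        by (rule measurable_cong) (use nonmem 1 in \<open>auto simp: space_restrict_space\<close>)
      then show ?thesis using measurable_restrict_space1[OF G] by blast
    next
      case 2
      have "?f \<in> borel_measurable (restrict_space borel \<Omega>) \<longleftrightarrow> (\<lambda>(t, y). F I t y) \<in> borel_measurable (restrict_space borel \<Omega>)"
        by (rule measurable_cong) (use comp 2 in \<open>auto simp: space_restrict_space K_def\<close>)
      then show ?thesis using measurable_restrict_space1[OF F, of I \<Omega>] 2 by (auto simp: K_def)
    qed
  qed
qed

text \<open>Trajectories stay in their component and the Oleinik condition compares points of one component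
  only. The mean value property is integrated over the countably many components that carry mass;
  the remaining mass rests on the frontier, where the test function vanishes.\<close>

lemma sticky_flow_of_components:
  fixes Y u :: "real set \<Rightarrow> real \<Rightarrow> real \<Rightarrow> real" and w :: "real \<Rightarrow> real"
  assumes w: "w \<in> borel_measurable borel" "\<And>y. \<bar>w y\<bar> \<le> M" "continuous_on C w" "\<And>y. y \<in> frontier C \<Longrightarrow> w y = 0"
    and flow: "\<And>I. moving_component C \<rho>0 I \<Longrightarrow>
      sticky_flow (uniform_measure \<rho>0 I) I (Y I) (u I) M (\<lambda>y. if y \<in> I then w y else 0)"
  shows "sticky_flow \<rho>0 C
    (\<lambda>t y. if moving_component C \<rho>0 (connected_component_set C y) then Y (connected_component_set C y) t y else y)
    (\<lambda>t y. if moving_component C \<rho>0 (connected_component_set C y) then u (connected_component_set C y) t y else 0)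
    M w" (is "sticky_flow \<rho>0 C ?Y ?u M w")
proof -
  interpret prob_space \<rho>0 using \<rho>0 by (simp add: prob_on_def)
  have sets [measurable_cong]: "sets \<rho>0 = sets borel" using \<rho>0 by (simp add: prob_on_def)
  let ?c = "connected_component_set C"
  let ?mov = "moving_component C \<rho>0"
  note flow_bd = sticky_flow.axioms(1)[OF flow]
  have M: "0 \<le> M" using w(2)[of 0] by linarith
  have Ym: "(\<lambda>(t, y). ?Y t y) \<in> borel_measurable borel"
    using bounded_flow.flow_measurable[OF flow_bd]
    by (intro piecewise_measurable) (auto simp: case_prod_beta' intro!: borel_measurable_continuous_onI continuous_intros)
  have um: "(\<lambda>(t, y). ?u t y) \<in> borel_measurable borel"
    using bounded_flow.velocity_measurable[OF flow_bd] by (intro piecewise_measurable) auto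
  have ub: "\<bar>?u t y\<bar> \<le> M" for t y
    using bounded_flow.velocity_bound[OF flow_bd] M by auto
  have comp_traj: "AE y in \<rho>0. ?mov (?c y) \<longrightarrow> Y (?c y) 0 y = y \<and> (\<forall>t\<ge>0. Y (?c y) t y \<in> ?c y) \<and>
      integral_path (\<lambda>\<tau>. u (?c y) \<tau> (Y (?c y) \<tau> y)) (\<lambda>t. Y (?c y) t y)"
    by (rule AE_on_moving_components) (rule bounded_flow.trajectories[OF flow_bd])
  have traj: "AE y in \<rho>0. ?Y 0 y = y \<and> (\<forall>t\<ge>0. ?Y t y \<in> C) \<and> integral_path (\<lambda>\<tau>. ?u \<tau> (?Y \<tau> y)) (\<lambda>t. ?Y t y)"
    using prob_on_AE[OF C \<rho>0] comp_traj
  proof eventually_elim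
    case (elim y)
    show ?case
    proof (cases "?mov (?c y)")
      case True
      let ?I = "?c y"
      have Y: "Y ?I 0 y = y" "\<And>t. 0 \<le> t \<Longrightarrow> Y ?I t y \<in> ?I"
        "integral_path (\<lambda>\<tau>. u ?I \<tau> (Y ?I \<tau> y)) (\<lambda>t. Y ?I t y)"
        using elim(2) True by auto
      have c: "?c (Y ?I t y) = ?I" if "0 \<le> t" for t
        using component_of_member[OF moving_component_facts(1)[OF True] Y(2)[OF that]] .
      have "integral_path (\<lambda>\<tau>. ?u \<tau> (?Y \<tau> y)) (\<lambda>t. ?Y t y)"
        by (rule integral_path_cong[OF _ _ Y(3)]) (use True c in auto)
      then show ?thesis using True Y(1,2) moving_component_facts(4)[OF True] by auto
    next
      case False
      then show ?thesis using elim(1) by (auto simp: integral_path_def set_lebesgue_integral_def)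
    qed
  qed
  have uf: "?u t y = 0" if "y \<in> frontier C" for t y
  proof (cases "?mov (?c y)")
    case True
    have "y \<in> C" using that C by (auto simp: frontier_def)
    then have "y \<in> frontier (?c y)" using moving_component_facts(7)[OF True] that by simp
    then show ?thesis using sticky_flow.velocity_frontier[OF flow[OF True]] by simp
  qed simp
  have ol: "oleinik C ?u"
    unfolding oleinik_def
  proof (intro allI impI)
    fix t y1 y2 :: real assume t: "0 < t" and y: "y1 < y2 \<and> connected_component C y1 y2"
    then have c: "?c y2 = ?c y1" by (metis connected_component_eq mem_Collect_eq)
    show "(?u t y2 - ?u t y1) / (y2 - y1) \<le> 1 / t"
    proof (cases "?mov (?c y1)")
      case True
      obtain S where S: "connected S" "S \<subseteq> C" "y1 \<in> S" "y2 \<in> S"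
        using y unfolding connected_component_def by blast
      have "S \<subseteq> ?c y1" using S by (intro connected_component_maximal) auto
      then have "connected_component (?c y1) y1 y2"
        unfolding connected_component_def[of "?c y1"] using S by blast
      then show ?thesis
        using sticky_flow.velocity_oleinik[OF flow[OF True]] t y True c by (auto simp: oleinik_def)
    qed (use c t in simp)
  qed
  have mean: "(LINT y|\<rho>0. ?u t (?Y t y) * \<zeta> (?Y t y)) = (LINT y|\<rho>0. w y * \<zeta> (?Y t y))"
    if t: "0 \<le> t" and \<zeta>: "\<zeta> \<in> borel_measurable borel" "\<And>y. \<bar>\<zeta> y\<bar> \<le> K" "\<And>y. y \<in> frontier C \<Longrightarrow> \<zeta> y = 0" for t \<zeta> K
  proof -
    note [measurable] = w(1) \<zeta>(1)
    have K0: "0 \<le> K" using \<zeta>(2)[of 0] by linarith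
    define y' where "y' = ?Y t"
    define u' where "u' = ?u t"
    have [measurable]: "y' \<in> borel_measurable borel" "u' \<in> borel_measurable borel"
    proof -
      have "(\<lambda>y. (t, y)) \<in> borel \<rightarrow>\<^sub>M borel" by (intro borel_measurable_continuous_onI continuous_intros)
      from measurable_compose[OF this Ym] measurable_compose[OF this um]
      show "y' \<in> borel_measurable borel" "u' \<in> borel_measurable borel" by (simp_all add: y'_def u'_def)
    qed
    have ib: "integrable \<rho>0 (\<lambda>y. a y * \<zeta> (y' y))" if "a \<in> borel_measurable borel" "\<And>y. \<bar>a y\<bar> \<le> M" for a
    proof (rule integrable_const_bound[of _ "M * K"])
      show "AE y in \<rho>0. norm (a y * \<zeta> (y' y)) \<le> M * K"
        using that \<zeta>(2) M by (intro AE_I2) (auto simp: abs_mult intro!: mult_mono)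
    qed (use that in measurable)
    have iu: "integrable \<rho>0 (\<lambda>y. u' (y' y) * \<zeta> (y' y))"
    proof (rule ib)
      show "(\<lambda>y. u' (y' y)) \<in> borel_measurable borel" by measurable
      show "\<bar>u' (y' y)\<bar> \<le> M" for y unfolding u'_def by (rule ub)
    qed
    have iw: "integrable \<rho>0 (\<lambda>y. w y * \<zeta> (y' y))" by (rule ib[OF w(1,2)])
    define h where "h y = u' (y' y) * \<zeta> (y' y) - w y * \<zeta> (y' y)" for y
    have ih: "integrable \<rho>0 h" unfolding h_def using iu iw by (rule Bochner_Integration.integrable_diff)
    have [measurable]: "h \<in> borel_measurable borel" unfolding h_def by measurable
    have onI: "(LINT y:I|\<rho>0. h y) = 0" if I: "?mov I" for I
    proof -
      interpret S: sticky_flow "uniform_measure \<rho>0 I" I "Y I" "u I" M "\<lambda>y. if y \<in> I then w y else 0" by (rule flow[OF I])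
      note facts = moving_component_facts[OF I]
      define \<eta> where "\<eta> y = (if y \<in> I then \<zeta> y else 0)" for y
      have [measurable]: "I \<in> sets borel" by (rule facts(5))
      have \<eta>m [measurable]: "\<eta> \<in> borel_measurable borel" unfolding \<eta>_def by measurable
      have \<eta>b: "\<bar>\<eta> y\<bar> \<le> K" for y using \<zeta>(2) K0 by (simp add: \<eta>_def)
      have AE: "AE y in uniform_measure \<rho>0 I. y \<in> I \<and> Y I t y \<in> I"
        using S.trajectories
      proof eventually_elim
        case (elim y)
        then have "Y I 0 y \<in> I" "Y I t y \<in> I" using t by auto
        then show ?case using elim by simp
      qed
      have "(LINT y|uniform_measure \<rho>0 I. h y)
          = (LINT y|uniform_measure \<rho>0 I. u I t (Y I t y) * \<eta> (Y I t y) - (if y \<in> I then w y else 0) * \<eta> (Y I t y))"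
      proof (rule integral_cong_AE)
        show "AE y in uniform_measure \<rho>0 I. h y = u I t (Y I t y) * \<eta> (Y I t y) - (if y \<in> I then w y else 0) * \<eta> (Y I t y)"
          using AE
        proof eventually_elim
          case (elim y)
          then have "?c y = I" "?c (Y I t y) = I" using component_of_member[OF facts(1)] by auto
          then show ?case using elim I by (simp add: h_def u'_def y'_def \<eta>_def)
        qed
      qed measurable
      also have "\<dots> = (LINT y|uniform_measure \<rho>0 I. u I t (Y I t y) * \<eta> (Y I t y)) - (LINT y|uniform_measure \<rho>0 I. (if y \<in> I then w y else 0) * \<eta> (Y I t y))"
      proof (rule Bochner_Integration.integral_diff)
        show "integrable (uniform_measure \<rho>0 I) (\<lambda>y. u I t (Y I t y) * \<eta> (Y I t y))"
          by (rule S.integrable_const_bound[of _ "M * K"])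
             (auto simp: abs_mult intro!: mult_mono AE_I2 S.velocity_bound \<eta>b M)
        show "integrable (uniform_measure \<rho>0 I) (\<lambda>y. (if y \<in> I then w y else 0) * \<eta> (Y I t y))"
          by (rule S.integrable_const_bound[of _ "M * K"])
             (auto simp: abs_mult intro!: mult_mono mult_nonneg_nonneg AE_I2 w(2) \<eta>b M K0)
      qed
      also have "\<dots> = 0"
      proof -
        have "\<eta> y = 0" if "y \<in> frontier I" for y
          using that facts(7) \<zeta>(3) by (simp add: \<eta>_def)
        from S.velocity_mean[OF t \<eta>m \<eta>b this] show ?thesis by (rule right_minus_eq[THEN iffD2])
      qed
      finally have "(LINT y:I|\<rho>0. h y) / measure \<rho>0 I = 0"
        using integral_uniform_measure[of h I] facts(6) by simp
      then show ?thesis using facts(6) by (simp add: emeasure_eq_measure)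
    qed
    let ?K = "{I. ?mov I}"
    have "(LINT y:\<Union>?K|\<rho>0. h y) = 0"
    proof (rule set_integral_countable_Union_zero[OF countable_moving_components _ _ ih])
      show "pairwise disjnt ?K"
        using pairwise_disjoint_components[of C] unfolding disjnt_def by (rule pairwise_subset) (auto simp: moving_component_def)
    qed (use onI moving_component_facts(5) in \<open>auto simp: sets\<close>)
    also have "(LINT y:\<Union>?K|\<rho>0. h y) = (LINT y|\<rho>0. h y)"
      unfolding set_lebesgue_integral_def
    proof (rule integral_cong_AE)
      have [measurable]: "\<Union>?K \<in> sets borel"
        using countable_moving_components moving_component_facts(5) by (intro sets.countable_Union) auto
      show "(\<lambda>y. indicator (\<Union>?K) y *\<^sub>R h y) \<in> borel_measurable \<rho>0" by measurable
      show "AE y in \<rho>0. indicator (\<Union>?K) y *\<^sub>R h y = h y"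
        using prob_on_AE[OF C \<rho>0] AE_moving_or_frontier
      proof eventually_elim
        case (elim y)
        show ?case
        proof (cases "?mov (?c y)")
          case True
          then have "y \<in> \<Union>?K" using elim(1) by (auto intro!: exI[of _ "?c y"])
          then show ?thesis by simp
        next
          case False
          then have "y \<in> frontier C" "y' y = y" using elim by (auto simp: y'_def)
          then have "h y = 0" using \<zeta>(3) by (simp add: h_def)
          then show ?thesis by simp
        qed
      qed
    qed measurable
    finally have "(LINT y|\<rho>0. h y) = 0" by simp
    then have "(LINT y|\<rho>0. u' (y' y) * \<zeta> (y' y)) = (LINT y|\<rho>0. w y * \<zeta> (y' y))"
      using iu iw by (simp add: h_def)
    then show ?thesis by (simp add: u'_def y'_def)
  qed
  show ?thesis
    by unfold_locales (fact sets C Ym um ub traj w uf ol mean)+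
qed

end

section \<open>The modified flow solves the sticky particle system\<close>

lemma SPS_conditions_cong_initial:
  assumes "\<And>y. y \<in> C \<Longrightarrow> w y = v0 y"
  shows "SPS_conditions C \<rho>0 w \<rho> v \<longleftrightarrow> SPS_conditions C \<rho>0 v0 \<rho> v"
proof -
  have 1: "(\<lambda>y. indicator C y *\<^sub>R (f y * w y)) = (\<lambda>y. indicator C y *\<^sub>R (f y * v0 y))" for f :: "real \<Rightarrow> real"
    using assms by (auto simp: indicator_def)
  have 2: "(\<lambda>y. indicator C y *\<^sub>R ((w y)\<^sup>2 * f y)) = (\<lambda>y. indicator C y *\<^sub>R ((v0 y)\<^sup>2 * f y))" for f :: "real \<Rightarrow> real"
    using assms by (auto simp: indicator_def)
  show ?thesis
    unfolding SPS_conditions_def momentum_eq_def initial_energy_def set_lebesgue_integral_def 1 2 ..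
qed

lemma push_forward_eq_distr:
  assumes g: "g \<in> borel_measurable \<mu>" and eq: "AE y in \<mu>. f y = g y"
  shows "push_forward \<mu> f = distr \<mu> borel g"
proof -
  have gc: "g \<in> borel_measurable (completion \<mu>)" using g by (rule measurable_completion)
  have eqc: "AE y in completion \<mu>. f y = g y" using eq by (rule AE_completion)
  have fc: "f \<in> borel_measurable (completion \<mu>)"
  proof (rule measurableI)
    fix A :: "real set" assume "A \<in> sets borel"
    then have "g -` A \<inter> space (completion \<mu>) \<in> sets (completion \<mu>)" using gc by (rule measurable_sets[rotated])
    then show "f -` A \<inter> space (completion \<mu>) \<in> sets (completion \<mu>)"
    proof (rule completion.in_sets_AE[rotated])
      show "AE y in completion \<mu>. y \<in> g -` A \<inter> space (completion \<mu>) \<longleftrightarrow> y \<in> f -` A \<inter> space (completion \<mu>)"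
        using eqc by eventually_elim auto
    qed auto
  qed simp
  show ?thesis
    unfolding push_forward_def distr_completion[OF g, symmetric]
    by (rule distr_cong_AE[OF refl refl eqc fc gc])
qed

theorem theorem2p1:
  fixes C :: "real set" and \<rho>0 :: "real measure" and v0 :: "real \<Rightarrow> real"
    and X v :: "real set \<Rightarrow> real \<Rightarrow> real \<Rightarrow> real"
  assumes "closed C" and "C \<noteq> {}"
    and "\<rho>0 \<in> prob2_on C" and "v0 \<in> C0_on C"
    and "\<And>I. moving_component C \<rho>0 I \<Longrightarrow>
           lagrangian_map (uniform_measure \<rho>0 I) (\<lambda>y. if y \<in> I then v0 y else 0) (X I) (v I)"
  shows "is_SPS C \<rho>0 v0 (\<lambda>t. push_forward \<rho>0 (modified_flow C \<rho>0 X t))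
           (modified_velocity C \<rho>0 v)"
proof -
  note C = assms(1)
  have \<rho>0: "\<rho>0 \<in> prob_on C" using assms(3) by (simp add: prob2_on_def)
  interpret prob_space \<rho>0 using \<rho>0 by (simp add: prob_on_def)
  have sets [measurable_cong]: "sets \<rho>0 = sets borel" using \<rho>0 by (simp add: prob_on_def)
  let ?c = "connected_component_set C"
  let ?mov = "moving_component C \<rho>0"
  have v0c: "continuous_on C v0" and v0f: "\<And>y. y \<in> frontier C \<Longrightarrow> v0 y = 0" and "bounded (v0 ` C)"
    using assms(4) by (auto simp: C0_on_def)
  then obtain M0 where "\<And>y. y \<in> C \<Longrightarrow> \<bar>v0 y\<bar> \<le> M0" by (auto simp: bounded_iff)
  then have v0b: "\<bar>v0 y\<bar> \<le> \<bar>M0\<bar>" if "y \<in> C" for y using that by fastforce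
  \<comment> \<open>The values of \<open>v0\<close> off \<open>C\<close> are arbitrary, so \<open>v0\<close> itself may fail to be measurable.\<close>
  define w where "w y = (if y \<in> C then v0 y else 0)" for y
  have wb: "\<bar>w y\<bar> \<le> \<bar>M0\<bar>" for y using v0b by (simp add: w_def)
  have wc: "continuous_on C w" using v0c by (rule continuous_on_eq) (simp add: w_def)
  have wm: "w \<in> borel_measurable borel"
  proof -
    have "w = (\<lambda>y. indicator C y *\<^sub>R v0 y)" by (auto simp: w_def indicator_def)
    then show ?thesis using borel_measurable_continuous_on_indicator[OF _ v0c] C by simp
  qed
  have wf: "w y = 0" if "y \<in> frontier C" for y using v0f[OF that] by (simp add: w_def)
  define component_solution where "component_solution I Y u \<longleftrightarrow>
      sticky_flow (uniform_measure \<rho>0 I) I Y u \<bar>M0\<bar> (\<lambda>y. if y \<in> I then w y else 0) \<and>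
      (AE y in uniform_measure \<rho>0 I. continuous_on {0..} (\<lambda>s. X I s y) \<and> (\<forall>t\<ge>0. stopped_path I (\<lambda>s. X I s y) t = Y t y)) \<and>
      (\<forall>t\<ge>0. AE y in uniform_measure \<rho>0 I. u t (Y t y) = (if Y t y \<in> interior I then v I t (Y t y) else 0))"
    for I Y u
  have ex: "\<exists>p. component_solution I (fst p) (snd p)" if I: "?mov I" for I
  proof -
    note facts = moving_component_facts[OF C \<rho>0 I]
    have eq: "(\<lambda>y. if y \<in> I then v0 y else 0) = (\<lambda>y. if y \<in> I then w y else 0)"
      using facts(4) by (intro ext) (auto simp: w_def)
    have front: "(if y \<in> I then w y else 0) = 0" if "y \<in> frontier I" for y
      using that facts(7) wf by auto
    have cont: "continuous_on UNIV (\<lambda>y. if y \<in> I then w y else 0)"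
    proof -
      \<comment> \<open>The two closed sets \<open>I\<close> and \<open>- interior I\<close> meet in the frontier, where both pieces vanish.\<close>
      have 1: "continuous_on I (\<lambda>y. if y \<in> I then w y else 0)"
        by (rule continuous_on_eq[OF continuous_on_subset[OF wc facts(4)]]) simp
      have "(if y \<in> I then w y else 0) = 0" if "y \<in> - interior I" for y
        using that front[of y] closure_subset[of I] by (auto simp: frontier_def)
      then have 2: "continuous_on (- interior I) (\<lambda>y. if y \<in> I then w y else 0)"
        by (intro continuous_on_eq[OF continuous_on_const[of _ 0]]) simp
      have "I \<union> - interior I = UNIV" using interior_subset by blast
      then show ?thesis
        using continuous_on_closed_Un[OF facts(2) closed_Compl[OF open_interior] 1 2] by simp
    qed
    have start: "AE y in uniform_measure \<rho>0 I. y \<in> I"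
      using facts(5) sets by (intro AE_uniform_measureI) auto
    obtain Y u where "sticky_flow (uniform_measure \<rho>0 I) I Y u \<bar>M0\<bar> (\<lambda>y. if y \<in> I then w y else 0)"
      "AE y in uniform_measure \<rho>0 I. continuous_on {0..} (\<lambda>s. X I s y) \<and> (\<forall>t\<ge>0. stopped_path I (\<lambda>s. X I s y) t = Y t y)"
      "\<And>t. 0 \<le> t \<Longrightarrow> AE y in uniform_measure \<rho>0 I. u t (Y t y) = (if Y t y \<in> interior I then v I t (Y t y) else 0)"
    proof (rule lagrangian_map_sticky_flow[OF facts(8,9) assms(5)[OF I, unfolded eq] facts(2,3) start])
      show "\<bar>if y \<in> I then w y else 0\<bar> \<le> \<bar>M0\<bar>" for y using wb by simp
    qed (use cont front in blast)+
    then have "component_solution I Y u" unfolding component_solution_def by blast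
    then show ?thesis by (intro exI[of _ "(Y, u)"]) simp
  qed
  define Y where "Y I = fst (SOME p. component_solution I (fst p) (snd p))" for I
  define u where "u I = snd (SOME p. component_solution I (fst p) (snd p))" for I
  have "component_solution I (Y I) (u I)" if "?mov I" for I
    unfolding Y_def u_def by (rule someI_ex[OF ex[OF that]])
  then have flow: "\<And>I. ?mov I \<Longrightarrow> sticky_flow (uniform_measure \<rho>0 I) I (Y I) (u I) \<bar>M0\<bar> (\<lambda>y. if y \<in> I then w y else 0)"
    and stop: "\<And>I. ?mov I \<Longrightarrow> AE y in uniform_measure \<rho>0 I. continuous_on {0..} (\<lambda>s. X I s y) \<and> (\<forall>t\<ge>0. stopped_path I (\<lambda>s. X I s y) t = Y I t y)"
    and vel: "\<And>I t. ?mov I \<Longrightarrow> 0 \<le> t \<Longrightarrow> AE y in uniform_measure \<rho>0 I. u I t (Y I t y) = (if Y I t y \<in> interior I then v I t (Y I t y) else 0)"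
    unfolding component_solution_def by blast+
  define Y' where "Y' t y = (if ?mov (?c y) then Y (?c y) t y else y)" for t y
  define v' where "v' t y = (if ?mov (?c y) then u (?c y) t y else 0)" for t y
  interpret S: sticky_flow \<rho>0 C Y' v' "\<bar>M0\<bar>" w
    using sticky_flow_of_components[OF C \<rho>0 wm wb wc wf flow] unfolding Y'_def[abs_def] v'_def[abs_def] .
  have stop_AE: "AE y in \<rho>0. ?mov (?c y) \<longrightarrow> continuous_on {0..} (\<lambda>s. X (?c y) s y) \<and>
      (\<forall>t\<ge>0. stopped_path (?c y) (\<lambda>s. X (?c y) s y) t = Y (?c y) t y)"
    by (rule AE_on_moving_components[OF C \<rho>0]) (rule stop)
  have push: "push_forward \<rho>0 (modified_flow C \<rho>0 X t) = distr \<rho>0 borel (Y' t)" if t: "0 \<le> t" for t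
  proof (rule push_forward_eq_distr)
    show "Y' t \<in> borel_measurable \<rho>0" by measurable
    show "AE y in \<rho>0. modified_flow C \<rho>0 X t y = Y' t y"
      using stop_AE by eventually_elim (use t in \<open>auto simp: modified_flow_def Y'_def Let_def\<close>)
  qed
  show ?thesis
    unfolding is_SPS_def
  proof (intro exI[of _ v'] conjI allI impI)
    show "SPS_conditions C \<rho>0 v0 (\<lambda>t. push_forward \<rho>0 (modified_flow C \<rho>0 X t)) v'"
      using S.SPS_conditions_of_flow[OF push] SPS_conditions_cong_initial[of C w v0] by (simp add: w_def)
    fix t :: real assume t: "0 \<le> t"
    have joint: "(\<lambda>(t, x). if ?mov (?c x) then if x \<in> interior (?c x) then v (?c x) (max 0 t) x else 0 else 0) \<in> borel_measurable borel"
    proof (rule piecewise_measurable[OF C \<rho>0, where F = "\<lambda>I t x. if x \<in> interior I then v I (max 0 t) x else 0" and G = "\<lambda>t x. 0"])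
      fix I assume I: "?mov I"
      have "(\<lambda>(t, x). v I (max 0 t) x) \<in> borel_measurable borel"
        using assms(5)[OF I] by (intro measurable_extend_time) (simp add: lagrangian_map_def SPS_conditions_def)
      then have [measurable]: "(\<lambda>p. v I (max 0 (fst p)) (snd p)) \<in> borel_measurable (borel \<Otimes>\<^sub>M borel)"
        by (simp add: case_prod_beta' borel_prod)
      have [measurable]: "interior I \<in> sets borel" by simp
      have "(\<lambda>p. if snd p \<in> interior I then v I (max 0 (fst p)) (snd p) else 0) \<in> borel_measurable (borel \<Otimes>\<^sub>M borel)"
        by measurable
      then show "(\<lambda>(t, x). if x \<in> interior I then v I (max 0 t) x else 0) \<in> borel_measurable borel"
        by (simp add: case_prod_beta' borel_prod)
    qed simp
    have slice: "(\<lambda>x. (t, x)) \<in> borel \<rightarrow>\<^sub>M borel" by (intro borel_measurable_continuous_onI continuous_intros)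
    have "(\<lambda>x. if ?mov (?c x) then if x \<in> interior (?c x) then v (?c x) (max 0 t) x else 0 else 0) \<in> borel_measurable borel"
      using measurable_compose[OF slice joint] by simp
    also have "(\<lambda>x. if ?mov (?c x) then if x \<in> interior (?c x) then v (?c x) (max 0 t) x else 0 else 0) = modified_velocity C \<rho>0 v t"
      using t by (auto simp: modified_velocity_def Let_def fun_eq_iff)
    finally have [measurable]: "modified_velocity C \<rho>0 v t \<in> borel_measurable borel" .
    have vel_AE: "AE y in \<rho>0. ?mov (?c y) \<longrightarrow>
        u (?c y) t (Y (?c y) t y) = (if Y (?c y) t y \<in> interior (?c y) then v (?c y) t (Y (?c y) t y) else 0)"
      by (rule AE_on_moving_components[OF C \<rho>0]) (rule vel[OF _ t])
    have in_AE: "AE y in \<rho>0. ?mov (?c y) \<longrightarrow> Y (?c y) t y \<in> ?c y"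
    proof (rule AE_on_moving_components[OF C \<rho>0])
      fix I assume "?mov I"
      from bounded_flow.trajectories[OF sticky_flow.axioms(1)[OF flow[OF this]]]
      show "AE y in uniform_measure \<rho>0 I. Y I t y \<in> I" by eventually_elim (use t in simp)
    qed
    have "AE y in \<rho>0. v' t (Y' t y) = modified_velocity C \<rho>0 v t (Y' t y)"
      using vel_AE in_AE
    proof eventually_elim
      case (elim y)
      show ?case
      proof (cases "?mov (?c y)")
        case True
        then have "Y (?c y) t y \<in> ?c y" using elim(2) by simp
        then have c: "?c (Y (?c y) t y) = ?c y"
          using component_of_member[OF moving_component_facts(1)[OF C \<rho>0 True]] by blast
        show ?thesis using elim(1) True c by (simp add: v'_def Y'_def modified_velocity_def Let_def)
      next
        case False
        then show ?thesis by (simp add: v'_def Y'_def modified_velocity_def Let_def)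
      qed
    qed
    then have "AE y in distr \<rho>0 borel (Y' t). v' t y = modified_velocity C \<rho>0 v t y"
      by (subst AE_distr_iff) measurable
    then show "AE y in push_forward \<rho>0 (modified_flow C \<rho>0 X t). y \<in> C \<longrightarrow> v' t y = modified_velocity C \<rho>0 v t y"
      unfolding push[OF t] by eventually_elim simp
  qed
qed

end
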